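(* There is an absolute constant $C_0$ such that the following holds. Let $K$ be a convex body in $\mathbb{R}^n$ which has either its barycentre or its Santaló point at the origin. Then for every $1\leqslant l<n$ and every $F\in G_{n,l}$, \[ \bigl(|\mathrm{Proj}_F(K)|_l\cdot |K^\circ\cap F|_l\bigr)^{1/l}\leqslant C_0\frac{n}{l}\, |B_2^l|^{2/l}. \] Furthermore this is optimal up to the value of the constant: there is an absolute constant $c>0$ such that for every $1\leqslant l<n$ there exist a convex body $K$ in $\mathbb{R}^n$ having both its barycentre and its Santaló point at the origin (namely the polar of a regular simplex centred at the origin) and $F\in G_{n,l}$ with $\bigl(|\mathrm{Proj}_F(K)|_l\cdot |K^\circ\cap F|_l\bigr)^{1/l}\geqslant c\,\frac{n}{l}\,|B_2^l|^{2/l}$.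
   Context: A convex body is a compact convex set with non-empty interior. $G_{n,l}$ is the set of $l$-dimensional linear subspaces of $\mathbb{R}^n$; $\mathrm{Proj}_F$ is the orthogonal projection onto $F$; $|\cdot|_l$ is $l$-dimensional Lebesgue measure in $F$; $B_2^l$ is the Euclidean unit ball of $\mathbb{R}^l$. For a convex body $L$ with $0\in\mathrm{int}(L)$, $L^\circ=\{y:\langle x,y\rangle\leqslant1\ \forall x\in L\}$. The barycentre of $K$ is $\frac1{|K|}\int_K x\,dx$; the Santaló point of $K$ is the unique $z\in\mathrm{int}(K)$ minimizing $|K|\,|(K-z)^\circ|$. *)

theory Defs
  imports "HOL-Analysis.Analysis"
begin

text \<open>Points of R^n are represented as functions nat => real vanishing at all
  indices i >= n; this lets the dimension n vary inside the statement.\<close>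

type_synonym vec = "nat \<Rightarrow> real"

definition Rn :: "nat \<Rightarrow> vec set" where
  "Rn n = {x. \<forall>i\<ge>n. x i = 0}"

definition zvec :: vec where
  "zvec = (\<lambda>_. 0)"

definition ip :: "nat \<Rightarrow> vec \<Rightarrow> vec \<Rightarrow> real" where
  "ip n x y = (\<Sum>i<n. x i * y i)"

definition vdiff :: "vec \<Rightarrow> vec \<Rightarrow> vec" where
  "vdiff x y = (\<lambda>i. x i - y i)"

definition ext0 :: "nat \<Rightarrow> vec \<Rightarrow> vec" where
  "ext0 n y = (\<lambda>i. if i < n then y i else 0)"

definition lebM :: "nat \<Rightarrow> vec measure" where
  "lebM n = Pi\<^sub>M {..<n} (\<lambda>_. lborel)"

definition lebset :: "nat \<Rightarrow> vec set \<Rightarrow> vec set" where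
  "lebset n A = {y \<in> space (lebM n). ext0 n y \<in> A}"

definition lebn :: "nat \<Rightarrow> vec set \<Rightarrow> real" where
  "lebn n A = measure (lebM n) (lebset n A)"

definition is_convex :: "vec set \<Rightarrow> bool" where
  "is_convex K \<longleftrightarrow> (\<forall>x\<in>K. \<forall>y\<in>K. \<forall>t::real. 0 \<le> t \<and> t \<le> 1 \<longrightarrow>
      (\<lambda>i. (1 - t) * x i + t * y i) \<in> K)"

definition in_interior :: "nat \<Rightarrow> vec set \<Rightarrow> vec \<Rightarrow> bool" where
  "in_interior n K x \<longleftrightarrow> x \<in> Rn n \<and>
     (\<exists>r>0. \<forall>y\<in>Rn n. ip n (vdiff y x) (vdiff y x) < r\<^sup>2 \<longrightarrow> y \<in> K)"

text \<open>Compactness w.r.t. the product topology on nat => real, which on the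
  closed subspace R^n coincides with the Euclidean topology.\<close>
definition convex_body :: "nat \<Rightarrow> vec set \<Rightarrow> bool" where
  "convex_body n K \<longleftrightarrow> K \<subseteq> Rn n \<and> compact K \<and> is_convex K \<and> (\<exists>x. in_interior n K x)"

definition barycentre :: "nat \<Rightarrow> vec set \<Rightarrow> vec" where
  "barycentre n K = (\<lambda>i. if i < n then
      (1 / lebn n K) * (\<integral>y. indicator (lebset n K) y * y i \<partial>lebM n) else 0)"

definition polar :: "nat \<Rightarrow> vec set \<Rightarrow> vec set" where
  "polar n L = {y \<in> Rn n. \<forall>x\<in>L. ip n x y \<le> 1}"

definition santalo_point :: "nat \<Rightarrow> vec set \<Rightarrow> vec \<Rightarrow> bool" where
  "santalo_point n K z \<longleftrightarrow> in_interior n K z \<and>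
     (\<forall>w. in_interior n K w \<longrightarrow>
        lebn n K * lebn n (polar n ((\<lambda>x. vdiff x z) ` K))
          \<le> lebn n K * lebn n (polar n ((\<lambda>x. vdiff x w) ` K))) \<and>
     (\<forall>w. in_interior n K w \<and>
        lebn n K * lebn n (polar n ((\<lambda>x. vdiff x w) ` K))
          \<le> lebn n K * lebn n (polar n ((\<lambda>x. vdiff x z) ` K)) \<longrightarrow> w = z)"

definition lincomb :: "nat \<Rightarrow> (nat \<Rightarrow> vec) \<Rightarrow> vec \<Rightarrow> vec" where
  "lincomb l u c = (\<lambda>i. \<Sum>j<l. c j * u j i)"

definition onb :: "nat \<Rightarrow> nat \<Rightarrow> (nat \<Rightarrow> vec) \<Rightarrow> vec set \<Rightarrow> bool" where
  "onb n l u F \<longleftrightarrow> (\<forall>j<l. u j \<in> Rn n) \<and>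
     (\<forall>j<l. \<forall>k<l. ip n (u j) (u k) = (if j = k then 1 else 0)) \<and>
     F = {lincomb l u c | c. True}"

definition Grass :: "nat \<Rightarrow> nat \<Rightarrow> vec set set" where
  "Grass n l = {F. \<exists>u. onb n l u F}"

definition measF :: "nat \<Rightarrow> nat \<Rightarrow> vec set \<Rightarrow> vec set \<Rightarrow> real" where
  "measF n l F A = lebn l {c. lincomb l (SOME u. onb n l u F) c \<in> A}"

definition Proj :: "nat \<Rightarrow> vec set \<Rightarrow> vec \<Rightarrow> vec" where
  "Proj n F x = (THE y. y \<in> F \<and> (\<forall>w\<in>F. ip n (vdiff x y) w = 0))"

definition regular_simplex_centred :: "nat \<Rightarrow> vec set \<Rightarrow> bool" where
  "regular_simplex_centred n S \<longleftrightarrow> (\<exists>v::nat \<Rightarrow> vec. \<exists>d>0.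
     (\<forall>k\<le>n. v k \<in> Rn n) \<and>
     (\<forall>j\<le>n. \<forall>k\<le>n. j \<noteq> k \<longrightarrow> ip n (vdiff (v j) (v k)) (vdiff (v j) (v k)) = d) \<and>
     (\<forall>i. (\<Sum>k\<le>n. v k i) = 0) \<and>
     S = {(\<lambda>i. \<Sum>k\<le>n. t k * v k i) | t. (\<forall>k\<le>n. 0 \<le> t k) \<and> (\<Sum>k\<le>n. t k) = 1})"

end

theory Submission imports Defs "HOL-Probability.Distributions" begin

text \<open>The upper bound rests on a functional Santalo inequality with constant $16^n$, proved by
  Lehec's induction on the dimension: cut by a hyperplane that halves the mass of $f$, shear each
  half so that both marginals have a common barycentre, and apply a one-dimensional inequality along
  the fibres. Applied to $1_A$ and to the exponential of minus the gauge of $Q$, it gives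
  $l!\,m\,|Q|\le 16^l$ whenever $\langle x,y\rangle\le 1$ on $A\times Q$ and
  $\int_A e^{\langle x,\theta\rangle}dx\ge m$ for every $\theta$.

  If $K$ has its barycentre at the origin, take $A=\mathrm{Proj}_F K$: Jensen's inequality on $K$ bounds
  the exponential integrals below by $|K|$ divided by the largest fibre volume, which the
  Rogers-Shephard inequality compares with $|A|$. If $K$ has its Santalo point at the origin, then
  $K^\circ$ has its barycentre there, and $A=K^\circ\cap F$ is used instead: by Prekopa's theorem the
  exponential marginal of $K^\circ$ is log-concave, and a supergradient at the origin takes the place
  of the largest fibre. In both cases $m$ is $|A|$ up to a factor $(cl/n)^l$.

  For the lower bound $F$ is the span of $l$ vertices of the simplex. Both $\mathrm{Proj}_F K$ and
  $K^\circ\cap F$ contain a copy of the convex hull of these vertices and the origin.\<close>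

section \<open>Lebesgue measure on sequences supported in an initial segment\<close>

text \<open>The obstacle is that the centring of K does not pass to subspaces: neither the
  projection of K to F nor the section of its polar need be centred in F. A functional Santalo
  inequality instead supplies a shift \<theta> that is not known beforehand, so what is asked of A
  is a lower bound on its exponential integral for every \<theta>; this is what a centred barycentre
  in the larger space provides. Constants: halving the mass of f turns the one-dimensional constant
  4 into 2 * (4 + 4) = 16 per dimension. The Rogers-Shephard ratio s = l/n costs s^l (1-s)^(n-l)
  \<ge> (l/(3n))^l. Since l! |B_2^l|^2 \<ge> 1, the bound l! X \<le> (48 n/l)^l on the volume
  product X has the required form. The Santalo point is tied to the barycentre of the polar by n!
  |(K-w)^o| = \<integral> e^(<w,y> - h_K(y)) dy with h_K the support function: minimality in w
  centres the density e^(-h_K), whose first moments are (n+1)! times those of K^o. For the lower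
  bound, only the slab of the hull with total weight in (1/2, 1] is measured. In orthonormal
  coordinates it contains a translated difference of standard simplices, so that its volume is
  bounded without a determinant.\<close>

definition lebV :: "nat \<Rightarrow> vec measure" where
  "lebV n = distr (lebM n) borel (ext0 n)"

text \<open>Points of \<open>lebM n\<close> are \<open>undefined\<close> outside
  \<open>{..<n}\<close>, and its space changes with n. After the push-forward by \<open>ext0\<close>
  all dimensions share one space and one sigma-algebra, so measurability never mentions n.\<close>

lemma sets_lebV[simp, measurable_cong]: "sets (lebV n) = sets borel"
  by (simp add: lebV_def)

lemma space_lebV[simp]: "space (lebV n) = UNIV"
  by (simp add: lebV_def)

interpretation pl: product_sigma_finite "\<lambda>_::nat. lborel :: real measure" ..

lemma vec_measurableI:
  assumes "\<And>i. (\<lambda>x. f x i) \<in> borel_measurable M"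
  shows "(f :: _ \<Rightarrow> vec) \<in> borel_measurable M"
  by (rule measurable_coordinatewise_then_product) (use assms in auto)

lemma coord_measurable[measurable]: "(\<lambda>x::vec. x i) \<in> borel_measurable borel"
  by (rule measurable_product_coordinates)

lemma ext0_measurable[measurable]: "ext0 n \<in> borel_measurable (lebM n)"
  unfolding ext0_def lebM_def
proof (rule vec_measurableI)
  fix i show "(\<lambda>x. if i < n then x i else 0) \<in> borel_measurable (Pi\<^sub>M {..<n} (\<lambda>_. lborel :: real measure))"
  proof (cases "i < n")
    case True
    then have "(\<lambda>x. x i) \<in> Pi\<^sub>M {..<n} (\<lambda>_. lborel :: real measure) \<rightarrow>\<^sub>M lborel"
      by (intro measurable_component_singleton) simp
    then show ?thesis using True by simp
  qed simp
qed

lemma upd_measurable[measurable (raw)]: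
  assumes "f \<in> borel_measurable M" "g \<in> borel_measurable M"
  shows "(\<lambda>x. (f x :: vec)(n := g x)) \<in> borel_measurable M"
  by (rule vec_measurableI) (use assms in \<open>auto\<close>)

lemma nn_integral_lebV:
  assumes "f \<in> borel_measurable borel"
  shows "nn_integral (lebV n) f = (\<integral>\<^sup>+x. f (ext0 n x) \<partial>lebM n)"
  unfolding lebV_def by (rule nn_integral_distr) (use assms in auto)

lemma nn_integral_lebV_0:
  assumes "f \<in> borel_measurable borel"
  shows "nn_integral (lebV 0) f = f (\<lambda>_. 0)"
proof -
  have "nn_integral (lebV 0) f = (\<integral>\<^sup>+x. f (ext0 0 x) \<partial>lebM 0)"
    by (rule nn_integral_lebV[OF assms])
  also have "\<dots> = f (\<lambda>_. 0)"
    unfolding lebM_def lessThan_0 by (subst pl.nn_integral_empty) (auto simp: ext0_def)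
  finally show ?thesis .
qed

lemma nn_integral_lebV_Suc:
  assumes [measurable]: "f \<in> borel_measurable borel"
  shows "nn_integral (lebV (Suc n)) f = (\<integral>\<^sup>+x. \<integral>\<^sup>+s. f (x(n := s)) \<partial>lborel \<partial>lebV n)"
proof -
  have "nn_integral (lebV (Suc n)) f = (\<integral>\<^sup>+x. f (ext0 (Suc n) x) \<partial>lebM (Suc n))"
    by (rule nn_integral_lebV[OF assms])
  also have "\<dots> = (\<integral>\<^sup>+x. \<integral>\<^sup>+s. f (ext0 (Suc n) (x(n := s))) \<partial>lborel \<partial>lebM n)"
    unfolding lebM_def lessThan_Suc
    by (rule pl.product_nn_integral_insert) (auto simp flip: lessThan_Suc lebM_def)
  also have "\<dots> = (\<integral>\<^sup>+x. \<integral>\<^sup>+s. f ((ext0 n x)(n := s)) \<partial>lborel \<partial>lebM n)"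
  proof -
    have "ext0 (Suc n) (x(n := s)) = (ext0 n x)(n := s)" for x s
      by (auto simp: ext0_def fun_eq_iff)
    then show ?thesis by simp
  qed
  also have "\<dots> = (\<integral>\<^sup>+x. \<integral>\<^sup>+s. f (x(n := s)) \<partial>lborel \<partial>lebV n)"
    by (rule nn_integral_lebV[symmetric]) measurable
  finally show ?thesis .
qed

definition cube :: "nat \<Rightarrow> real \<Rightarrow> vec set" where
  "cube n r = {x. \<forall>i<n. \<bar>x i\<bar> \<le> r}"

lemma cube_measurable[measurable]: "cube n r \<in> sets borel"
  unfolding cube_def by measurable

lemma emeasure_lebV_cube:
  assumes "0 \<le> r" shows "emeasure (lebV n) (cube n r) = ennreal ((2*r)^n)"
proof (induction n)
  case 0
  have "emeasure (lebV 0) (cube 0 r) = (\<integral>\<^sup>+x. indicator (cube 0 r) x \<partial>lebV 0)" by simp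
  also have "\<dots> = 1" by (subst nn_integral_lebV_0) (auto simp: cube_def)
  finally show ?case by simp
next
  case (Suc n)
  have "emeasure (lebV (Suc n)) (cube (Suc n) r) = (\<integral>\<^sup>+x. indicator (cube (Suc n) r) x \<partial>lebV (Suc n))" by simp
  also have "\<dots> = (\<integral>\<^sup>+x. \<integral>\<^sup>+s. indicator (cube (Suc n) r) (x(n := s)) \<partial>lborel \<partial>lebV n)"
    by (subst nn_integral_lebV_Suc) auto
  also have "\<dots> = (\<integral>\<^sup>+x. \<integral>\<^sup>+s. indicator (cube n r) x * indicator {-r..r} s \<partial>lborel \<partial>lebV n)"
    by (intro nn_integral_cong) (auto simp: cube_def less_Suc_eq split: split_indicator)
  also have "\<dots> = ennreal ((2*r)^n) * ennreal (2*r)"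
    using assms by (simp add: nn_integral_cmult nn_integral_multc Suc)
  also have "\<dots> = ennreal ((2*r)^Suc n)" using assms by (simp add: ennreal_mult[symmetric] mult.commute)
  finally show ?case .
qed

lemma sigma_finite_lebV: "sigma_finite_measure (lebV n)"
proof (unfold_locales, intro exI conjI)
  let ?A = "range (\<lambda>k::nat. cube n (real k))"
  show "countable ?A" "?A \<subseteq> sets (lebV n)" by auto
  show "\<forall>a\<in>?A. emeasure (lebV n) a \<noteq> \<infinity>" by (auto simp: emeasure_lebV_cube)
  show "\<Union> ?A = space (lebV n)"
  proof -
    have "\<exists>k::nat. x \<in> cube n (real k)" for x
    proof -
      obtain k :: nat where "(\<Sum>i<n. \<bar>x i\<bar>) \<le> real k" using real_arch_simple by blast
      moreover have "\<bar>x i\<bar> \<le> (\<Sum>i<n. \<bar>x i\<bar>)" if "i<n" for i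
        using that by (intro member_le_sum) auto
      ultimately have "\<bar>x i\<bar> \<le> real k" if "i<n" for i using that by fastforce
      then show ?thesis unfolding cube_def by blast
    qed
    then show ?thesis by auto
  qed
qed

interpretation lebV: sigma_finite_measure "lebV n" for n by (rule sigma_finite_lebV)
interpretation lebVV: pair_sigma_finite "lebV n" "lebV m" for n m ..
interpretation lebVl: pair_sigma_finite "lebV n" "lborel :: real measure" for n ..

lemma AE_lebV_Rn: "AE x in lebV n. x \<in> Rn n"
  unfolding lebV_def by (subst AE_distr_iff) (auto simp: ext0_def Rn_def)

lemma lebn_eq:
  assumes "A \<in> sets borel"
  shows "lebn n A = measure (lebV n) A"
proof -
  have "ext0 n -` A \<inter> space (lebM n) = lebset n A" by (auto simp: lebset_def)
  then show ?thesis unfolding lebn_def lebV_def using assms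
    by (subst measure_distr) auto
qed

lemma nn_integral_lebV_Suc2:
  assumes [measurable]: "f \<in> borel_measurable borel"
  shows "nn_integral (lebV (Suc n)) f = (\<integral>\<^sup>+s. \<integral>\<^sup>+x. f (x(n := s)) \<partial>lebV n \<partial>lborel)"
  unfolding nn_integral_lebV_Suc[OF assms]
  by (subst lebVl.Fubini'[symmetric]) auto

section \<open>The one-dimensional functional Santalo inequality\<close>

lemma nn_integral_exp_from:
  "(\<integral>\<^sup>+\<tau>. ennreal (exp (-\<tau>)) * indicator {h..} \<tau> \<partial>lborel) = ennreal (exp (-h))"
proof -
  have "((\<lambda>x::real. - exp (-x)) \<longlongrightarrow> 0) at_top"
    using tendsto_minus[OF filterlim_compose[OF exp_at_bot filterlim_uminus_at_bot_at_top]] by simp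
  then have "(\<integral>\<^sup>+\<tau>. ennreal (exp (-\<tau>)) * indicator {h..} \<tau> \<partial>lborel) = ennreal (0 - (- exp (-h)))"
    by (intro nn_integral_FTC_atLeast) (auto intro!: derivative_eq_intros)
  then show ?thesis by simp
qed

lemma nn_integral_exp_ident:
  "(\<integral>\<^sup>+\<tau>. ennreal (exp (-\<tau>)) * indicator {0..} \<tau> * ennreal \<tau> \<partial>lborel) = 1"
proof -
  have "(\<integral>\<^sup>+\<tau>. ennreal (exp (-\<tau>)) * indicator {0..} \<tau> * ennreal \<tau> \<partial>lborel)
      = (\<integral>\<^sup>+x. ennreal (x^1 * exp (-x)) * indicator {0 ..} x \<partial>lborel)"
    by (intro nn_integral_cong) (auto simp: ennreal_mult' mult.commute split: split_indicator)
  also have "\<dots> = 1" by (subst nn_intergal_power_times_exp_Ici) simp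
  finally show ?thesis .
qed

lemma nn_integral_inverse_Icc:
  assumes "0 < x" "x \<le> y"
  shows "(\<integral>\<^sup>+s. ennreal (1/s) * indicator {x..y} s \<partial>lborel) = ennreal (ln y - ln x)"
  by (rule nn_integral_FTC_Icc) (use assms in \<open>auto intro!: DERIV_ln_divide\<close>)

text \<open>Stands in for the one-dimensional Brunn-Minkowski inequality: N bounds the spread of the
  sumset A + B, and the sumset itself is never measured.\<close>

lemma oscillation_sum:
  fixes A B :: "real set"
  assumes ne: "A \<noteq> {}" "B \<noteq> {}"
   and N: "\<And>s s' t t'. s\<in>A \<Longrightarrow> s'\<in>A \<Longrightarrow> t\<in>B \<Longrightarrow> t'\<in>B \<Longrightarrow> (s' - s) + (t' - t) \<le> N"
  shows "bdd_above A" "bdd_below A" "bdd_above B" "bdd_below B" "(Sup A - Inf A) + (Sup B - Inf B) \<le> N"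
proof -
  obtain s0 t0 where s0: "s0 \<in> A" and t0: "t0 \<in> B" using assms by auto
  have bA: "s - s0 \<le> N" "s0 - s \<le> N" if "s \<in> A" for s
    using N[OF that s0 t0 t0] N[OF s0 that t0 t0] by auto
  have bB: "s - t0 \<le> N" "t0 - s \<le> N" if "s \<in> B" for s
    using N[OF s0 s0 that t0] N[OF s0 s0 t0 that] by auto
  show "bdd_above A" by (rule bdd_aboveI[of _ "s0 + N"]) (use bA(1) in force)
  show "bdd_below A" by (rule bdd_belowI[of _ "s0 - N"]) (use bA(2) in force)
  show "bdd_above B" by (rule bdd_aboveI[of _ "t0 + N"]) (use bB(1) in force)
  show "bdd_below B" by (rule bdd_belowI[of _ "t0 - N"]) (use bB(2) in force)
  \<comment> \<open>The four points are replaced by infima and suprema one at a time, in the order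
    s, t, s', t'.\<close>
  have 2: "s' + t' - N - t \<le> Inf A" if "s'\<in>A" "t\<in>B" "t'\<in>B" for s' t t'
  proof (rule cInf_greatest[OF ne(1)])
    fix s assume "s \<in> A" then show "s' + t' - N - t \<le> s" using N[of s s' t t'] that by linarith
  qed
  have 3: "s' + t' - N - Inf A \<le> Inf B" if "s'\<in>A" "t'\<in>B" for s' t'
  proof (rule cInf_greatest[OF ne(2)])
    fix t assume "t \<in> B" then show "s' + t' - N - Inf A \<le> t" using 2[of s' t t'] that by linarith
  qed
  have 4: "Sup A \<le> N + Inf A + Inf B - t'" if "t'\<in>B" for t'
  proof (rule cSup_least[OF ne(1)])
    fix s' assume "s' \<in> A" then show "s' \<le> N + Inf A + Inf B - t'" using 3[of s' t'] that by linarith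
  qed
  have "Sup B \<le> N + Inf A + Inf B - Sup A"
  proof (rule cSup_least[OF ne(2)])
    fix t' assume "t' \<in> B" then show "t' \<le> N + Inf A + Inf B - Sup A" using 4[of t'] by linarith
  qed
  then show "(Sup A - Inf A) + (Sup B - Inf B) \<le> N" by linarith
qed

lemma log_length:
  fixes C :: "real set"
  assumes ne: "C \<noteq> {}" and p: "\<And>s. s\<in>C \<Longrightarrow> s > 0" and b: "bdd_above (ln ` C)" "bdd_below (ln ` C)"
  shows "(\<integral>\<^sup>+s. ennreal (1/s) * indicator C s \<partial>lborel) \<le> ennreal (Sup (ln ` C) - Inf (ln ` C))" "Inf (ln ` C) \<le> Sup (ln ` C)"
proof -
  let ?lo = "Inf (ln ` C)" and ?hi = "Sup (ln ` C)"
  have l: "?lo \<le> ln s" "ln s \<le> ?hi" if "s\<in>C" for s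
    using that b by (auto intro: cInf_lower cSup_upper)
  show lh: "?lo \<le> ?hi" using ne l by fastforce
  have sub: "C \<subseteq> {exp ?lo..exp ?hi}"
  proof
    fix s assume s: "s \<in> C"
    have "exp ?lo \<le> exp (ln s)" "exp (ln s) \<le> exp ?hi" using l[OF s] by auto
    then show "s \<in> {exp ?lo..exp ?hi}" using p[OF s] by simp
  qed
  have "(\<integral>\<^sup>+s. ennreal (1/s) * indicator C s \<partial>lborel) \<le> (\<integral>\<^sup>+s. ennreal (1/s) * indicator {exp ?lo..exp ?hi} s \<partial>lborel)"
    by (intro nn_integral_mono) (use sub in \<open>auto split: split_indicator\<close>)
  also have "\<dots> = ennreal (?hi - ?lo)"
    by (subst nn_integral_inverse_Icc) (use lh in auto)
  finally show "(\<integral>\<^sup>+s. ennreal (1/s) * indicator C s \<partial>lborel) \<le> ennreal (?hi - ?lo)" .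
qed

text \<open>The measure ds/s is length in the variable ln s, so this is the multiplicative form of
  \<open>oscillation_sum\<close>: N bounds the logarithmic spread of the products s t.\<close>

lemma log_length_sum:
  fixes A B :: "real set"
  assumes ne: "A \<noteq> {}" "B \<noteq> {}" and pos: "\<And>s. s\<in>A \<Longrightarrow> s > 0" "\<And>t. t\<in>B \<Longrightarrow> t>0"
   and N: "\<And>s s' t t'. s\<in>A \<Longrightarrow> s'\<in>A \<Longrightarrow> t\<in>B \<Longrightarrow> t'\<in>B \<Longrightarrow> (ln s' - ln s) + (ln t' - ln t) \<le> N"
  shows "(\<integral>\<^sup>+s. ennreal (1/s) * indicator A s \<partial>lborel) + (\<integral>\<^sup>+s. ennreal (1/s) * indicator B s \<partial>lborel) \<le> ennreal N"
proof -
  have ne': "ln ` A \<noteq> {}" "ln ` B \<noteq> {}" using ne by auto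
  note osc = oscillation_sum[OF ne', of N]
  have o: "bdd_above (ln ` A)" "bdd_below (ln ` A)" "bdd_above (ln ` B)" "bdd_below (ln ` B)"
     "(Sup (ln ` A) - Inf (ln ` A)) + (Sup (ln ` B) - Inf (ln ` B)) \<le> N"
    by (rule osc; use N in blast)+
  note lA = log_length[OF ne(1) pos(1) o(1,2)] and lB = log_length[OF ne(2) pos(2) o(3,4)]
  have "(\<integral>\<^sup>+s. ennreal (1/s) * indicator A s \<partial>lborel) + (\<integral>\<^sup>+s. ennreal (1/s) * indicator B s \<partial>lborel)
     \<le> ennreal (Sup (ln ` A) - Inf (ln ` A)) + ennreal (Sup (ln ` B) - Inf (ln ` B))"
    by (intro add_mono lA lB)
  also have "\<dots> = ennreal ((Sup (ln ` A) - Inf (ln ` A)) + (Sup (ln ` B) - Inf (ln ` B)))"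
    by (rule ennreal_plus[symmetric]) (use lA lB in auto)
  also have "\<dots> \<le> ennreal N" using o(5) by (rule ennreal_leI)
  finally show ?thesis .
qed

text \<open>The levels are written U e^(-\<tau>) instead of absolute heights. Functions with
  different suprema then share the parameter \<tau>, and their level sets can be compared at equal
  relative height.\<close>

lemma layer_cake_exp:
  assumes [measurable]: "p \<in> borel_measurable borel" "v \<in> borel_measurable borel"
    and U: "U > 0" "\<And>s. 0 \<le> p s \<and> p s \<le> U"
  shows "(\<integral>\<^sup>+s. ennreal (p s) * v s \<partial>lborel)
    = ennreal U * (\<integral>\<^sup>+\<tau>. ennreal (exp (-\<tau>)) * indicator {0..} \<tau> *
         (\<integral>\<^sup>+s. v s * indicator {s. p s \<ge> U * exp (-\<tau>)} s \<partial>lborel) \<partial>(lborel :: real measure))"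
proof -
  have pt: "ennreal (p s) * v s =
     (\<integral>\<^sup>+\<tau>. ennreal U * (ennreal (exp (-\<tau>)) * indicator {0..} \<tau> * (v s * indicator {s. p s \<ge> U * exp (-\<tau>)} s)) \<partial>lborel)" for s
  proof (cases "p s > 0")
    case True
    \<comment> \<open>The level set with parameter \<tau> contains s exactly when \<tau> \<ge> h,
      and the exponential mass of that half-line is p s / U.\<close>
    define h where "h = - ln (p s / U)"
    have h0: "h \<ge> 0" using U(2)[of s] True U(1) by (simp add: h_def)
    have iff: "p s \<ge> U * exp (-\<tau>) \<longleftrightarrow> \<tau> \<ge> h" for \<tau>
    proof -
      have "p s \<ge> U * exp (-\<tau>) \<longleftrightarrow> exp (-\<tau>) \<le> p s / U" using U(1) by (simp add: field_simps)
      also have "\<dots> \<longleftrightarrow> -\<tau> \<le> ln (p s / U)" using True U(1) by (subst ln_ge_iff) auto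
      finally show ?thesis by (auto simp: h_def)
    qed
    have "(\<integral>\<^sup>+\<tau>. ennreal U * (ennreal (exp (-\<tau>)) * indicator {0..} \<tau> * (v s * indicator {s. p s \<ge> U * exp (-\<tau>)} s)) \<partial>lborel)
      = (\<integral>\<^sup>+\<tau>. (ennreal U * v s) * (ennreal (exp (-\<tau>)) * indicator {h..} \<tau>) \<partial>lborel)"
      using h0 by (intro nn_integral_cong) (auto simp: iff mult_ac split: split_indicator)
    also have "\<dots> = ennreal U * v s * ennreal (exp (-h))"
      by (subst nn_integral_cmult) (auto simp: nn_integral_exp_from)
    also have "\<dots> = ennreal (U * (p s / U)) * v s"
    proof -
      have "exp (-h) = p s / U" using True U(1) by (simp add: h_def)
      then show ?thesis using True U(1) by (simp add: ennreal_mult mult_ac del: times_divide_eq_left times_divide_eq_right)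
    qed
    finally show ?thesis using U(1) by simp
  next
    case False
    then have p0: "p s = 0" using U(2)[of s] by simp
    have z: "ennreal U * (ennreal (exp (-\<tau>)) * indicator {0..} \<tau> * (v s * indicator {s. p s \<ge> U * exp (-\<tau>)} s)) = 0" for \<tau>
      using U(1) by (auto simp: p0 not_le)
    show ?thesis by (simp only: z p0) simp
  qed
  have "(\<integral>\<^sup>+s. ennreal (p s) * v s \<partial>lborel) =
    (\<integral>\<^sup>+s. (\<integral>\<^sup>+\<tau>. ennreal U * (ennreal (exp (-\<tau>)) * indicator {0..} \<tau> * (v s * indicator {s. p s \<ge> U * exp (-\<tau>)} s)) \<partial>lborel) \<partial>lborel)"
    using pt by simp
  also have "\<dots> = (\<integral>\<^sup>+\<tau>. (\<integral>\<^sup>+s. ennreal U * (ennreal (exp (-\<tau>)) * indicator {0..} \<tau> * (v s * indicator {s. p s \<ge> U * exp (-\<tau>)} s)) \<partial>lborel) \<partial>lborel)"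
    by (rule lborel_pair.Fubini') measurable
  also have "\<dots> = ennreal U * (\<integral>\<^sup>+\<tau>. ennreal (exp (-\<tau>)) * indicator {0..} \<tau> *
         (\<integral>\<^sup>+s. v s * indicator {s. p s \<ge> U * exp (-\<tau>)} s \<partial>lborel) \<partial>lborel)"
    by (simp add: nn_integral_cmult)
  finally show ?thesis .
qed

text \<open>Writes a(s) ds as s a(s) ds/s, so that the level sets are those of s a(s) and their size
  is a logarithmic length.\<close>

lemma layer_cake_log:
  assumes [measurable]: "a \<in> borel_measurable borel"
    and U: "U > 0" "\<And>s. s > 0 \<Longrightarrow> 0 \<le> a s \<and> s * a s \<le> U"
  shows "(\<integral>\<^sup>+s. ennreal (a s) * indicator {0<..} s \<partial>lborel)
    = ennreal U * (\<integral>\<^sup>+\<tau>. ennreal (exp (-\<tau>)) * indicator {0..} \<tau> *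
         (\<integral>\<^sup>+s. ennreal (1/s) * indicator {s. s > 0 \<and> s * a s \<ge> U * exp (-\<tau>)} s \<partial>lborel) \<partial>(lborel :: real measure))"
proof -
  define p v where "p s = (if s > 0 then s * a s else 0)" and "v s = ennreal (1/s) * indicator {0<..} s" for s
  have [measurable]: "p \<in> borel_measurable borel" "v \<in> borel_measurable borel" unfolding p_def v_def by measurable
  have "(\<integral>\<^sup>+s. ennreal (a s) * indicator {0<..} s \<partial>lborel) = (\<integral>\<^sup>+s. ennreal (p s) * v s \<partial>lborel)"
    using U(2) by (intro nn_integral_cong) (auto simp: p_def v_def ennreal_mult[symmetric] split: split_indicator)
  also have "\<dots> = ennreal U * (\<integral>\<^sup>+\<tau>. ennreal (exp (-\<tau>)) * indicator {0..} \<tau> *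
         (\<integral>\<^sup>+s. v s * indicator {s. p s \<ge> U * exp (-\<tau>)} s \<partial>lborel) \<partial>(lborel :: real measure))"
    by (rule layer_cake_exp) (use U in \<open>auto simp: p_def\<close>)
  finally have l: "(\<integral>\<^sup>+s. ennreal (a s) * indicator {0<..} s \<partial>lborel) = ennreal U * (\<integral>\<^sup>+\<tau>. ennreal (exp (-\<tau>)) * indicator {0..} \<tau> *
         (\<integral>\<^sup>+s. v s * indicator {s. p s \<ge> U * exp (-\<tau>)} s \<partial>lborel) \<partial>(lborel :: real measure))" .
  have e: "v s * indicator {s. p s \<ge> U * exp (-\<tau>)} s = ennreal (1/s) * indicator {s. s > 0 \<and> s * a s \<ge> U * exp (-\<tau>)} s" for s \<tau>
    by (auto simp: p_def v_def split: split_indicator)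
  show ?thesis unfolding l unfolding e ..
qed

text \<open>Both bounds say m e^(-m) \<le> min(m, 1/m); the second is m^2 \<le> e^m, which follows
  by squaring m \<le> e^(m/2).\<close>

lemma mult_exp_bounds:
  assumes "m > (0::real)" "\<kappa> \<le> m * exp (-m)" "\<kappa> > 0"
  shows "m \<ge> \<kappa>" "m \<le> 1/\<kappa>"
proof -
  have "m * exp (-m) \<le> m" using assms by (simp add: mult_le_cancel_left1)
  then show "m \<ge> \<kappa>" using assms by linarith
  have "m^2 \<le> exp m"
  proof -
    have "exp (m/2) \<ge> 1 + m/2 + (m/2)^2/2" by (rule exp_lower_Taylor_quadratic) (use assms in simp)
    moreover have "1 + m/2 + (m/2)^2/2 \<ge> m"
    proof -
      have "0 \<le> (m - 2)^2" by simp
      then show ?thesis by (simp add: power2_eq_square algebra_simps)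
    qed
    ultimately have "m^2 \<le> (exp (m/2))^2" using assms by (intro power_mono) auto
    then show ?thesis by (simp add: power2_eq_square exp_add[symmetric])
  qed
  then have "m * (m * exp (-m)) \<le> 1" by (simp add: exp_minus power2_eq_square field_simps)
  moreover have "m * \<kappa> \<le> m * (m * exp (-m))" using assms by (intro mult_left_mono) auto
  ultimately have "m * \<kappa> \<le> 1" by linarith
  then show "m \<le> 1/\<kappa>" using assms by (simp add: field_simps)
qed

text \<open>With $U=\sup s\,a(s)$ and $V=\sup t\,b(t)$, a product $st$ of points of the level sets of $s\,a(s)$ and
  $t\,b(t)$ at the relative height $e^{-\tau}$ lies between $\kappa=e^{-2\tau}UV$ and $1/\kappa$. So the
  logarithmic lengths of these sets add up to at most $2\ln(1/\kappa)$.\<close>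
lemma santalo_one_dim_real:
  fixes a b :: "real \<Rightarrow> real"
  assumes [measurable]: "a \<in> borel_measurable borel" "b \<in> borel_measurable borel"
    and nn: "\<And>s. s > 0 \<Longrightarrow> 0 \<le> a s" "\<And>s. s > 0 \<Longrightarrow> 0 \<le> b s"
    and ab: "\<And>s t. s > 0 \<Longrightarrow> t > 0 \<Longrightarrow> a s * b t \<le> exp (- (s*t))"
    and s0: "s0 > 0" "a s0 > 0" and t0: "t0 > 0" "b t0 > 0"
  shows "(\<integral>\<^sup>+s. ennreal (a s) * indicator {0<..} s \<partial>lborel) * (\<integral>\<^sup>+s. ennreal (b s) * indicator {0<..} s \<partial>lborel) \<le> 4"
proof -
  define U where "U = (SUP s\<in>{0<..}. s * a s)"
  define V where "V = (SUP t\<in>{0<..}. t * b t)"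
  have ex: "s * (exp (- (s * t)) / c) \<le> 1 / (t * c)" if "s > 0" "t > 0" "c > 0" for s t c :: real
  proof -
    have "s * t \<le> exp (s * t)" using exp_ge_add_one_self[of "s*t"] by linarith
    then show ?thesis using that by (simp add: exp_minus field_simps)
  qed
  have bA: "bdd_above ((\<lambda>s. s * a s) ` {0<..})"
  proof (rule bdd_aboveI2)
    fix s :: real assume "s \<in> {0<..}" then have s: "s > 0" by simp
    have "a s \<le> exp (- (s * t0)) / b t0" using ab[OF s t0(1)] t0 by (simp add: pos_le_divide_eq)
    then have "s * a s \<le> s * (exp (- (s * t0)) / b t0)" using s by (intro mult_left_mono) auto
    then show "s * a s \<le> 1 / (t0 * b t0)" using ex[OF s t0] by linarith
  qed
  have bB: "bdd_above ((\<lambda>s. s * b s) ` {0<..})"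
  proof (rule bdd_aboveI2)
    fix s :: real assume "s \<in> {0<..}" then have s: "s > 0" by simp
    have "b s \<le> exp (- (s * s0)) / a s0" using ab[OF s0(1) s] s0 by (simp add: pos_le_divide_eq mult.commute)
    then have "s * b s \<le> s * (exp (- (s * s0)) / a s0)" using s by (intro mult_left_mono) auto
    then show "s * b s \<le> 1 / (s0 * a s0)" using ex[OF s s0] by linarith
  qed
  have leU: "s * a s \<le> U" if "s > 0" for s unfolding U_def using bA that by (intro cSUP_upper) auto
  have leV: "s * b s \<le> V" if "s > 0" for s unfolding V_def using bB that by (intro cSUP_upper) auto
  have U0: "U > 0" using leU[OF s0(1)] mult_pos_pos[OF s0] by linarith
  have V0: "V > 0" using leV[OF t0(1)] mult_pos_pos[OF t0] by linarith
  define q where "q = U * V"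
  have q0: "q > 0" using U0 V0 by (simp add: q_def)
  define A B where "A \<tau> = {s. s > 0 \<and> s * a s \<ge> U * exp (-\<tau>)}" and "B \<tau> = {s. s > 0 \<and> s * b s \<ge> V * exp (-\<tau>)}" for \<tau>
  have [measurable]: "A \<tau> \<in> sets borel" "B \<tau> \<in> sets borel" for \<tau> unfolding A_def B_def by measurable
  have key: "exp (-2*\<tau>) * q \<le> s * t \<and> s * t \<le> 1 / (exp (-2*\<tau>) * q)" if "s \<in> A \<tau>" "t \<in> B \<tau>" for s t \<tau>
  proof -
    have st: "s > 0" "t > 0" using that by (auto simp: A_def B_def)
    have "(U * exp (-\<tau>)) * (V * exp (-\<tau>)) \<le> (s * a s) * (t * b t)"
      using that U0 V0 nn[of s] nn[of t] by (intro mult_mono[of "U * exp (-\<tau>)" "s * a s" "V * exp (-\<tau>)"]) (auto simp: A_def B_def)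
    also have "\<dots> = (s * t) * (a s * b t)" by simp
    also have "\<dots> \<le> (s * t) * exp (-(s*t))" using ab[OF st] st by (intro mult_left_mono) auto
    finally have "exp (-2*\<tau>) * q \<le> (s * t) * exp (-(s*t))"
      by (simp add: q_def exp_add[symmetric] mult_ac)
    then show ?thesis using mult_exp_bounds[of "s*t" "exp (-2*\<tau>) * q"] st q0 by auto
  qed
  \<comment> \<open>The suprema U and V need not be attained, so the level sets are only known to be
    nonempty for \<tau> > 0. The single value \<tau> = 0 is a null set in the integral over
    \<tau>.\<close>
  have ne: "A \<tau> \<noteq> {}" "B \<tau> \<noteq> {}" if "\<tau> > 0" for \<tau>
  proof -
    have e: "exp (-\<tau>) < 1" using that by simp
    have "U * exp (-\<tau>) < U" using e U0 by simp
    then obtain s where "s > 0" "U * exp (-\<tau>) < s * a s"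
      unfolding U_def using less_cSUP_iff[OF _ bA] by (metis greaterThan_iff greaterThan_non_empty)
    then show "A \<tau> \<noteq> {}" by (auto simp: A_def intro: less_imp_le)
    have "V * exp (-\<tau>) < V" using e V0 by simp
    then obtain s where "s > 0" "V * exp (-\<tau>) < s * b s"
      unfolding V_def using less_cSUP_iff[OF _ bB] by (metis greaterThan_iff greaterThan_non_empty)
    then show "B \<tau> \<noteq> {}" by (auto simp: B_def intro: less_imp_le)
  qed
  \<comment> \<open>For q > 1 the choice \<tau> = ln q / 4 makes the lower bound on s t equal to
    sqrt q > 1 and the upper bound 1 / sqrt q < 1.\<close>
  have q1: "q \<le> 1"
  proof (rule ccontr)
    assume "\<not> q \<le> 1"
    then have lq: "ln q > 0" by simp
    define \<tau> where "\<tau> = ln q / 4"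
    have "\<tau> > 0" using lq by (simp add: \<tau>_def)
    then obtain s t where "s \<in> A \<tau>" "t \<in> B \<tau>" using ne by blast
    from key[OF this] have "exp (-2*\<tau>) * q \<le> 1 / (exp (-2*\<tau>) * q)" by linarith
    moreover have "exp (-2*\<tau>) * q = exp (ln q / 2)"
    proof -
      have "exp (-2*\<tau>) * q = exp (-2*\<tau>) * exp (ln q)" using q0 by simp
      also have "\<dots> = exp (ln q / 2)" by (simp add: exp_add[symmetric] \<tau>_def)
      finally show ?thesis .
    qed
    moreover have "exp (ln q / 2) > 1" using lq by simp
    ultimately have "exp (ln q / 2) * exp (ln q / 2) \<le> 1" by (simp add: field_simps)
    then show False using \<open>exp (ln q / 2) > 1\<close> by (smt (verit) mult_le_cancel_right1)
  qed
  \<comment> \<open>This is 2 ln (1/\<kappa>) with \<kappa> = e^(-2\<tau>) q. Its mean against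
    e^(-\<tau>) is 4 - 2 ln q.\<close>
  define N where "N \<tau> = 4 * \<tau> - 2 * ln q" for \<tau>
  have len: "(\<integral>\<^sup>+s. ennreal (1/s) * indicator (A \<tau>) s \<partial>lborel) + (\<integral>\<^sup>+s. ennreal (1/s) * indicator (B \<tau>) s \<partial>lborel) \<le> ennreal (N \<tau>)"
    if "\<tau> > 0" for \<tau>
  proof (rule log_length_sum)
    fix s s' t t' assume s: "s \<in> A \<tau>" "s' \<in> A \<tau>" "t \<in> B \<tau>" "t' \<in> B \<tau>"
    then have p: "s > 0" "s' > 0" "t > 0" "t' > 0" by (auto simp: A_def B_def)
    define \<kappa> where "\<kappa> = exp (-2*\<tau>) * q"
    have k0: "\<kappa> > 0" using q0 by (simp add: \<kappa>_def)
    have "ln (s' * t') \<le> ln (1/\<kappa>)" using key[OF s(2,4)] p k0 unfolding \<kappa>_def[symmetric] by (subst ln_le_cancel_iff) auto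
    moreover have "ln \<kappa> \<le> ln (s * t)" using key[OF s(1,3)] p k0 unfolding \<kappa>_def[symmetric] by (subst ln_le_cancel_iff) auto
    moreover have "ln \<kappa> = -2*\<tau> + ln q" using q0 by (simp add: \<kappa>_def ln_mult)
    ultimately show "(ln s' - ln s) + (ln t' - ln t) \<le> N \<tau>" using p k0
      by (simp add: ln_mult ln_div N_def)
  qed (use ne that in \<open>auto simp: A_def B_def\<close>)
  define IA IB where "IA \<tau> = (\<integral>\<^sup>+s. ennreal (1/s) * indicator (A \<tau>) s \<partial>lborel)" and "IB \<tau> = (\<integral>\<^sup>+s. ennreal (1/s) * indicator (B \<tau>) s \<partial>lborel)" for \<tau>
  have [measurable]: "IA \<in> borel_measurable borel" "IB \<in> borel_measurable borel"
    unfolding IA_def IB_def A_def B_def by measurable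
  define X Y where "X = (\<integral>\<^sup>+\<tau>. ennreal (exp (-\<tau>)) * indicator {0..} \<tau> * IA \<tau> \<partial>lborel)" and
     "Y = (\<integral>\<^sup>+\<tau>. ennreal (exp (-\<tau>)) * indicator {0..} \<tau> * IB \<tau> \<partial>lborel)"
  have XY: "X + Y \<le> ennreal (4 - 2 * ln q)"
  proof -
    have lq: "ln q \<le> 0" using q0 q1 by simp
    have "X + Y = (\<integral>\<^sup>+\<tau>. ennreal (exp (-\<tau>)) * indicator {0..} \<tau> * (IA \<tau> + IB \<tau>) \<partial>lborel)"
      unfolding X_def Y_def by (subst nn_integral_add[symmetric]) (auto simp: distrib_left)
    also have "\<dots> \<le> (\<integral>\<^sup>+\<tau>. ennreal (exp (-\<tau>)) * indicator {0..} \<tau> * ennreal (N \<tau>) \<partial>lborel)"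
    proof (rule nn_integral_mono_AE)
      show "AE \<tau> in lborel. ennreal (exp (-\<tau>)) * indicator {0..} \<tau> * (IA \<tau> + IB \<tau>) \<le> ennreal (exp (-\<tau>)) * indicator {0..} \<tau> * ennreal (N \<tau>)"
        using AE_lborel_singleton[of 0]
      proof eventually_elim
        case (elim \<tau>)
        then show ?case using len[of \<tau>] unfolding IA_def IB_def
          by (cases "\<tau> > 0") (auto intro!: mult_left_mono)
      qed
    qed
    also have "\<dots> = (\<integral>\<^sup>+\<tau>. ennreal 4 * (ennreal (exp (-\<tau>)) * indicator {0..} \<tau> * ennreal \<tau>) + ennreal (-2 * ln q) * (ennreal (exp (-\<tau>)) * indicator {0..} \<tau>) \<partial>lborel)"
    proof (intro nn_integral_cong)
      fix \<tau> :: real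
      have "ennreal (N \<tau>) = ennreal 4 * ennreal \<tau> + ennreal (-2 * ln q)" if "\<tau> \<ge> 0"
        proof -
        have "ennreal 4 * ennreal \<tau> + ennreal (-2 * ln q) = ennreal (4 * \<tau> + -2 * ln q)"
          using that lq by (subst ennreal_mult[symmetric]) (auto simp: ennreal_plus[symmetric] simp del: ennreal_plus)
        then show ?thesis by (simp add: N_def)
      qed
      then show "ennreal (exp (-\<tau>)) * indicator {0..} \<tau> * ennreal (N \<tau>) = ennreal 4 * (ennreal (exp (-\<tau>)) * indicator {0..} \<tau> * ennreal \<tau>) + ennreal (-2 * ln q) * (ennreal (exp (-\<tau>)) * indicator {0..} \<tau>)"
        by (auto simp: distrib_left mult_ac split: split_indicator)
    qed
    also have "\<dots> = ennreal 4 + ennreal (-2 * ln q)"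
      by (subst nn_integral_add) (auto simp: nn_integral_cmult nn_integral_exp_ident nn_integral_exp_from[of 0, simplified])
    also have "\<dots> = ennreal (4 + -2 * ln q)"
      by (rule ennreal_plus[symmetric]) (use lq in auto)
    also have "\<dots> = ennreal (4 - 2 * ln q)" by simp
    finally show ?thesis .
  qed
  have ia: "(\<integral>\<^sup>+s. ennreal (a s) * indicator {0<..} s \<partial>lborel) = ennreal U * X"
    unfolding X_def IA_def A_def by (rule layer_cake_log) (use U0 leU nn in auto)
  have ib: "(\<integral>\<^sup>+s. ennreal (b s) * indicator {0<..} s \<partial>lborel) = ennreal V * Y"
    unfolding Y_def IB_def B_def by (rule layer_cake_log) (use V0 leV nn in auto)
  have "X < top" "Y < top" using XY by (auto simp: less_top[symmetric] top_unique)
  then obtain x y where x: "X = ennreal x" "x \<ge> 0" and y: "Y = ennreal y" "y \<ge> 0"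
    by (metis ennreal_cases less_irrefl)
  have xy: "x + y \<le> 4 - 2 * ln q"
  proof -
    have "ln q \<le> 0" using q0 q1 by simp
    then show ?thesis using XY x y by (auto simp: ennreal_plus[symmetric] ennreal_le_iff2 simp del: ennreal_plus)
  qed
  \<comment> \<open>By the inequality of arithmetic and geometric means the product is at most q (2
    - ln q)^2, which is 4 (r (1 - ln r))^2. Then ln (1/r) \<le> 1/r - 1 gives r (1 - ln r) \<le>
    1.\<close>
  define r where "r = sqrt q"
  have r: "r > 0" "r^2 = q" using q0 by (auto simp: r_def)
  have lnq: "ln q = 2 * ln r" using r by (metis ln_realpow of_nat_numeral)
  have "x * y \<le> ((x + y)/2)^2"
  proof -
    have "((x + y)/2)^2 - x * y = ((x - y)/2)^2" by (simp add: power2_eq_square field_simps)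
    then show ?thesis using zero_le_power2[of "(x-y)/2"] by linarith
  qed
  also have "\<dots> \<le> (2 - 2 * ln r)^2" using xy x y lnq by (intro power_mono) auto
  finally have "q * (x * y) \<le> q * (2 - 2 * ln r)^2" using q0 by simp
  also have "\<dots> = 4 * (r * (1 - ln r))^2" unfolding r(2)[symmetric] by (simp add: power2_eq_square algebra_simps)
  also have "\<dots> \<le> 4"
  proof -
    have "ln (1/r) \<le> 1/r - 1" using r by (intro ln_le_minus_one) auto
    then have "r * (1 - ln r) \<le> 1" using r by (simp add: ln_div field_simps)
    moreover have "ln q \<le> 0" using q0 q1 by simp
    then have "ln r \<le> 0" using lnq by linarith
    then have "0 \<le> r * (1 - ln r)" using r(1) by (intro mult_nonneg_nonneg) linarith+
    ultimately have "(r * (1 - ln r))^2 \<le> 1" by (intro power_le_one) auto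
    then show ?thesis by simp
  qed
  finally have "q * (x * y) \<le> 4" .
  have "ennreal U * X * (ennreal V * Y) = ennreal (q * (x * y))"
    using x y U0 V0 by (simp add: q_def ennreal_mult[symmetric] mult_ac)
  then show ?thesis unfolding ia ib using \<open>q * (x * y) \<le> 4\<close> by (metis ennreal_leI ennreal_numeral)
qed

text \<open>If both functions are positive somewhere, the hypothesis forces both to be finite on the
  half-line, which reduces to real values. Otherwise one of the integrals is 0.\<close>

lemma santalo_one_dim:
  fixes a b :: "real \<Rightarrow> ennreal"
  assumes [measurable]: "a \<in> borel_measurable borel" "b \<in> borel_measurable borel"
    and ab: "\<And>s t. s > 0 \<Longrightarrow> t > 0 \<Longrightarrow> a s * b t \<le> ennreal (exp (- (s*t)))"
  shows "(\<integral>\<^sup>+s. a s * indicator {0<..} s \<partial>lborel) * (\<integral>\<^sup>+s. b s * indicator {0<..} s \<partial>lborel) \<le> 4"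
proof (cases "(\<exists>s>0. a s > 0) \<and> (\<exists>t>0. b t > 0)")
  case True
  then obtain s0 t0 where s0: "s0 > 0" "a s0 > 0" and t0: "t0 > 0" "b t0 > 0" by blast
  have fa: "a s < top" if "s > 0" for s
  proof (rule ccontr)
    assume "\<not> a s < top"
    then have "a s = top" by (simp add: less_top[symmetric])
    then have "a s * b t0 = top" using t0 by (simp add: ennreal_top_mult)
    then show False using ab[OF that t0(1)] by (simp add: top_unique)
  qed
  have fb: "b s < top" if "s > 0" for s
  proof (rule ccontr)
    assume "\<not> b s < top"
    then have "b s = top" by (simp add: less_top[symmetric])
    then have "a s0 * b s = top" using s0 by (simp add: ennreal_mult_top)
    then show False using ab[OF s0(1) that] by (simp add: top_unique)
  qed
  have ea: "ennreal (enn2real (a s)) = a s" if "s > 0" for s using fa[OF that] by simp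
  have eb: "ennreal (enn2real (b s)) = b s" if "s > 0" for s using fb[OF that] by simp
  have "(\<integral>\<^sup>+s. ennreal (enn2real (a s)) * indicator {0<..} s \<partial>lborel) * (\<integral>\<^sup>+s. ennreal (enn2real (b s)) * indicator {0<..} s \<partial>lborel) \<le> 4"
  proof (rule santalo_one_dim_real[of _ _ s0 t0])
    fix s t :: real assume st: "s > 0" "t > 0"
    have "ennreal (enn2real (a s) * enn2real (b t)) \<le> ennreal (exp (-(s*t)))"
      using ab[OF st] ea eb st by (simp add: ennreal_mult)
    then show "enn2real (a s) * enn2real (b t) \<le> exp (-(s*t))" by (simp add: ennreal_le_iff)
  qed (use s0 t0 fa fb in \<open>auto simp: enn2real_positive_iff\<close>)
  also have "(\<integral>\<^sup>+s. ennreal (enn2real (a s)) * indicator {0<..} s \<partial>lborel) = (\<integral>\<^sup>+s. a s * indicator {0<..} s \<partial>lborel)"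
    by (intro nn_integral_cong) (auto simp: ea split: split_indicator)
  also have "(\<integral>\<^sup>+s. ennreal (enn2real (b s)) * indicator {0<..} s \<partial>lborel) = (\<integral>\<^sup>+s. b s * indicator {0<..} s \<partial>lborel)"
    by (intro nn_integral_cong) (auto simp: eb split: split_indicator)
  finally show ?thesis .
next
  case False
  then have "(\<integral>\<^sup>+s. a s * indicator {0<..} s \<partial>lborel) = 0 \<or> (\<integral>\<^sup>+s. b s * indicator {0<..} s \<partial>lborel) = 0"
    by (auto simp: nn_integral_0_iff_AE split: split_indicator)
  then show ?thesis by auto
qed

section \<open>The functional Santalo inequality\<close>

lemma measurable_lebV[simp]: "measurable (lebV n) N = measurable borel N"
  by (rule measurable_cong_sets) auto

lemma vec_affine_measurable[measurable (raw)]: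
  assumes [measurable]: "z \<in> borel_measurable M" "x \<in> borel_measurable M" "c \<in> borel_measurable M"
  shows "(\<lambda>w. (\<lambda>i. (z w :: vec) i + c w * x w i)) \<in> borel_measurable M"
  by (rule vec_measurableI) measurable

lemma vec_shear_measurable[measurable (raw)]:
  assumes [measurable]: "z \<in> borel_measurable M" "x \<in> borel_measurable M" "c \<in> borel_measurable M" "u \<in> borel_measurable M"
  shows "(\<lambda>w. (\<lambda>i. (z w :: vec) i + (x w i + c w * u w i))) \<in> borel_measurable M"
  by (rule vec_measurableI) measurable

lemma vec_add_measurable:
  assumes [measurable]: "z \<in> borel_measurable M" "x \<in> borel_measurable M"
  shows "(\<lambda>w. (\<lambda>i. (z w :: vec) i + x w i)) \<in> borel_measurable M"
  by (rule vec_measurableI) measurable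

lemma ip_measurable[measurable (raw)]:
  assumes [measurable]: "z \<in> borel_measurable M" "x \<in> borel_measurable M"
  shows "(\<lambda>w. ip n (z w) (x w)) \<in> borel_measurable M"
  unfolding ip_def by measurable

section \<open>Affine changes of variables and shears\<close>

lemma lebV_affine:
  assumes "f \<in> borel_measurable borel" "z \<in> Rn n" "c \<noteq> 0"
  shows "nn_integral (lebV n) f = ennreal (\<bar>c\<bar>^n) * (\<integral>\<^sup>+x. f (\<lambda>i. z i + c * x i) \<partial>lebV n)"
  using assms(1,2)
proof (induction n arbitrary: f z)
  case 0
  have [measurable]: "f \<in> borel_measurable borel" by fact
  have [measurable]: "(\<lambda>x. f (\<lambda>i. z i + c * x i)) \<in> borel_measurable borel" by measurable
  have "z = (\<lambda>_. 0)" using 0 by (auto simp: Rn_def)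
  then have z0: "(\<lambda>i. z i + c * 0) = (\<lambda>_. 0)" by simp
  have "(\<integral>\<^sup>+x. f (\<lambda>i. z i + c * x i) \<partial>lebV 0) = f (\<lambda>i. z i + c * 0)"
    by (rule nn_integral_lebV_0[where f="\<lambda>x. f (\<lambda>i. z i + c * x i)"]) measurable
  then show ?case unfolding z0 by (simp add: nn_integral_lebV_0)
next
  case (Suc n)
  have [measurable]: "f \<in> borel_measurable borel" by fact
  define z' where "z' = z(n := 0)"
  have z': "z' \<in> Rn n" using Suc.prems by (auto simp: z'_def Rn_def)
  have "nn_integral (lebV (Suc n)) f = (\<integral>\<^sup>+x. \<integral>\<^sup>+s. f (x(n := s)) \<partial>lborel \<partial>lebV n)"
    by (rule nn_integral_lebV_Suc) measurable
  also have "\<dots> = (\<integral>\<^sup>+x. ennreal \<bar>c\<bar> * (\<integral>\<^sup>+s. f (x(n := z n + c * s)) \<partial>lborel) \<partial>lebV n)"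
    by (intro nn_integral_cong nn_integral_real_affine[where c=c]) (use assms(3) in auto)
  also have "\<dots> = ennreal \<bar>c\<bar> * (\<integral>\<^sup>+x. (\<integral>\<^sup>+s. f (x(n := z n + c * s)) \<partial>lborel) \<partial>lebV n)"
    by (rule nn_integral_cmult) measurable
  also have "(\<integral>\<^sup>+x. (\<integral>\<^sup>+s. f (x(n := z n + c * s)) \<partial>lborel) \<partial>lebV n) =
     ennreal (\<bar>c\<bar>^n) * (\<integral>\<^sup>+x. (\<integral>\<^sup>+s. f ((\<lambda>i. z' i + c * x i)(n := z n + c * s)) \<partial>lborel) \<partial>lebV n)"
    by (rule Suc.IH[OF _ z']) measurable
  also have "(\<integral>\<^sup>+x. (\<integral>\<^sup>+s. f ((\<lambda>i. z' i + c * x i)(n := z n + c * s)) \<partial>lborel) \<partial>lebV n) =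
     (\<integral>\<^sup>+x. (\<integral>\<^sup>+s. f (\<lambda>i. z i + c * (x(n := s)) i) \<partial>lborel) \<partial>lebV n)"
  proof -
    have "(\<lambda>i. z' i + c * x i)(n := z n + c * s) = (\<lambda>i. z i + c * (x(n := s)) i)" for x s
      by (auto simp: z'_def fun_eq_iff)
    then show ?thesis by simp
  qed
  also have "\<dots> = (\<integral>\<^sup>+x. f (\<lambda>i. z i + c * x i) \<partial>lebV (Suc n))"
    by (rule nn_integral_lebV_Suc[symmetric]) measurable
  finally show ?case by (simp add: ennreal_mult mult.assoc)
qed

lemma lebV_translate:
  assumes "f \<in> borel_measurable borel" "z \<in> Rn n"
  shows "(\<integral>\<^sup>+x. f (\<lambda>i. z i + x i) \<partial>lebV n) = nn_integral (lebV n) f"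
  using lebV_affine[OF assms, of 1] by simp

text \<open>Turns a change of variables for nonnegative integrands into an identity of measures,
  which then also transports the signed integrals in barycentre conditions.\<close>

lemma measure_eq_nn:
  assumes "sets M = sets borel" "sets N = sets borel"
   "\<And>f. f \<in> borel_measurable borel \<Longrightarrow> nn_integral M f = nn_integral N f"
  shows "M = N"
proof (rule measure_eqI)
  fix A assume "A \<in> sets M"
  then have "(\<integral>\<^sup>+x. indicator A x \<partial>M) = (\<integral>\<^sup>+x. indicator A x \<partial>N)"
    using assms by (intro assms(3)) auto
  then show "emeasure M A = emeasure N A" using \<open>A \<in> sets M\<close> assms(1,2) by simp
qed (use assms in simp)

lemma lebV_translate_distr:
  assumes "z \<in> Rn n"
  shows "lebV n = distr (lebV n) borel (\<lambda>x i. z i + x i)"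
proof (rule measure_eq_nn)
  fix f :: "vec \<Rightarrow> ennreal" assume [measurable]: "f \<in> borel_measurable borel"
  note vec_add_measurable[measurable (raw)]
  have "nn_integral (distr (lebV n) borel (\<lambda>x i. z i + x i)) f = (\<integral>\<^sup>+x. f (\<lambda>i. z i + x i) \<partial>lebV n)"
    by (rule nn_integral_distr) measurable
  also have "\<dots> = nn_integral (lebV n) f" by (rule lebV_translate) (use assms in auto)
  finally show "nn_integral (lebV n) f = nn_integral (distr (lebV n) borel (\<lambda>x i. z i + x i)) f" ..
qed auto

text \<open>The hyperplane x_n = r becomes s = 0, and the slice at signed height \<sigma> s is
  translated by z + \<sigma> s w. Taking \<sigma> = 1 or -1 makes s > 0 describe the upper or the
  lower side, so one lemma serves both halves.\<close>

lemma lebV_shear: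
  assumes [measurable]: "f \<in> borel_measurable borel" and w: "w \<in> Rn n" and z: "z \<in> Rn n" and \<sigma>: "\<bar>\<sigma>\<bar> = 1"
  shows "nn_integral (lebV (Suc n)) f = (\<integral>\<^sup>+x. \<integral>\<^sup>+s. f ((\<lambda>i. z i + (x i + \<sigma> * s * w i))(n := r + \<sigma> * s)) \<partial>lborel \<partial>lebV n)"
proof -
  have zw: "(\<lambda>i. z i + \<sigma> * s * w i) \<in> Rn n" for s using w z by (auto simp: Rn_def)
  have "nn_integral (lebV (Suc n)) f = (\<integral>\<^sup>+s. \<integral>\<^sup>+x. f (x(n := s)) \<partial>lebV n \<partial>lborel)"
    by (rule nn_integral_lebV_Suc2) measurable
  also have "\<dots> = ennreal \<bar>\<sigma>\<bar> * (\<integral>\<^sup>+s. \<integral>\<^sup>+x. f (x(n := r + \<sigma> * s)) \<partial>lebV n \<partial>lborel)"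
    by (rule nn_integral_real_affine) (use \<sigma> in auto)
  also have "\<dots> = (\<integral>\<^sup>+s. \<integral>\<^sup>+x. f (x(n := r + \<sigma> * s)) \<partial>lebV n \<partial>lborel)" using \<sigma> by simp
  also have "\<dots> = (\<integral>\<^sup>+s. \<integral>\<^sup>+x. f ((\<lambda>i. (z i + \<sigma> * s * w i) + x i)(n := r + \<sigma> * s)) \<partial>lebV n \<partial>lborel)"
  proof (rule nn_integral_cong)
    fix s :: real
    show "(\<integral>\<^sup>+x. f (x(n := r + \<sigma> * s)) \<partial>lebV n) = (\<integral>\<^sup>+x. f ((\<lambda>i. (z i + \<sigma> * s * w i) + x i)(n := r + \<sigma> * s)) \<partial>lebV n)"
      by (rule lebV_translate[OF _ zw, where f="\<lambda>x. f (x(n := r + \<sigma> * s))", symmetric]) measurable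
  qed
  also have "\<dots> = (\<integral>\<^sup>+s. \<integral>\<^sup>+x. f ((\<lambda>i. z i + (x i + \<sigma> * s * w i))(n := r + \<sigma> * s)) \<partial>lebV n \<partial>lborel)"
    by (simp add: add_ac)
  also have "\<dots> = (\<integral>\<^sup>+x. \<integral>\<^sup>+s. f ((\<lambda>i. z i + (x i + \<sigma> * s * w i))(n := r + \<sigma> * s)) \<partial>lborel \<partial>lebV n)"
    by (rule lebVl.Fubini') measurable
  finally show ?thesis .
qed

lemma lebV_shear_distr:
  assumes w: "w \<in> Rn n" and z: "z \<in> Rn n" and \<sigma>: "\<bar>\<sigma>\<bar> = 1"
  shows "lebV (Suc n) = distr (lebV n \<Otimes>\<^sub>M lborel) borel (\<lambda>p. (\<lambda>i. z i + (fst p i + \<sigma> * snd p * w i))(n := r + \<sigma> * snd p))"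
proof (rule measure_eq_nn)
  fix f :: "vec \<Rightarrow> ennreal" assume [measurable]: "f \<in> borel_measurable borel"
  let ?S = "\<lambda>p. (\<lambda>i. z i + (fst p i + \<sigma> * snd p * w i))(n := r + \<sigma> * snd p) :: vec"
  have [measurable]: "?S \<in> borel_measurable (lebV n \<Otimes>\<^sub>M lborel)" by measurable
  have "nn_integral (lebV (Suc n)) f = (\<integral>\<^sup>+x. \<integral>\<^sup>+s. f (?S (x, s)) \<partial>lborel \<partial>lebV n)"
    unfolding fst_conv snd_conv by (rule lebV_shear[OF _ w z \<sigma>]) measurable
  also have "\<dots> = (\<integral>\<^sup>+p. f (?S p) \<partial>(lebV n \<Otimes>\<^sub>M lborel))"
    by (rule lborel.nn_integral_fst) measurable
  also have "\<dots> = nn_integral (distr (lebV n \<Otimes>\<^sub>M lborel) borel ?S) f"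
    by (rule nn_integral_distr[where f=f and T="?S", symmetric]) measurable
  finally show "nn_integral (lebV (Suc n)) f = nn_integral (distr (lebV n \<Otimes>\<^sub>M lborel) borel ?S) f" .
qed auto

text \<open>The shear contragredient to \<open>lebV_shear\<close>: the pairing of (x + \<sigma> s w,
  \<sigma> s) with (y, \<sigma> t - <w,y>) is <x,y> + s t, since \<sigma>^2 = 1.\<close>

lemma lebV_dual_shear:
  assumes [measurable]: "f \<in> borel_measurable borel" and \<sigma>: "\<bar>\<sigma>\<bar> = 1"
  shows "nn_integral (lebV (Suc n)) f = (\<integral>\<^sup>+y. \<integral>\<^sup>+t. f (y(n := \<sigma> * t - ip n w y)) \<partial>lborel \<partial>lebV n)"
proof -
  have "nn_integral (lebV (Suc n)) f = (\<integral>\<^sup>+x. \<integral>\<^sup>+s. f (x(n := s)) \<partial>lborel \<partial>lebV n)"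
    by (rule nn_integral_lebV_Suc) measurable
  also have "\<dots> = (\<integral>\<^sup>+x. ennreal \<bar>\<sigma>\<bar> * (\<integral>\<^sup>+s. f (x(n := - ip n w x + \<sigma> * s)) \<partial>lborel) \<partial>lebV n)"
    by (intro nn_integral_cong nn_integral_real_affine) (use \<sigma> in auto)
  finally show ?thesis using \<sigma> by simp
qed

text \<open>A class in which all first moments and exponential tilts are integrable. One number
  bounds both the values and the support; coordinates from n on stay free because
  \<open>lebV n\<close> lives on \<open>Rn n\<close>.\<close>

definition nice :: "nat \<Rightarrow> (vec \<Rightarrow> real) \<Rightarrow> bool" where
  "nice n f \<longleftrightarrow> f \<in> borel_measurable borel \<and> (\<exists>R\<ge>0. \<forall>x. 0 \<le> f x \<and> f x \<le> R \<and> (f x \<noteq> 0 \<longrightarrow> x \<in> cube n R))"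

lemma nice_integrable:
  assumes "nice n f" and [measurable]: "h \<in> borel_measurable borel"
    and h: "\<And>R. \<exists>c. \<forall>x\<in>cube n R. \<bar>h x\<bar> \<le> c"
  shows "integrable (lebV n) (\<lambda>x. f x * h x :: real)"
proof -
  obtain R where R: "R \<ge> 0" "\<And>x. 0 \<le> f x \<and> f x \<le> R \<and> (f x \<noteq> 0 \<longrightarrow> x \<in> cube n R)"
    and [measurable]: "f \<in> borel_measurable borel" using assms(1) by (auto simp: nice_def)
  obtain c where c: "\<And>x. x\<in>cube n R \<Longrightarrow> \<bar>h x\<bar> \<le> c" using h by blast
  have "integrable (lebV n) (\<lambda>x. f x * h x)"
  proof (rule integrableI_bounded_set[where A="cube n R" and B="R * c"])
    show "AE x \<in> cube n R in lebV n. norm (f x * h x) \<le> R * c"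
    proof (intro AE_I2 impI)
      fix x assume x: "x \<in> cube n R"
      have "\<bar>f x\<bar> \<le> R" "\<bar>h x\<bar> \<le> c" using R(2)[of x] c[OF x] by auto
      then show "norm (f x * h x) \<le> R * c" unfolding real_norm_def abs_mult
        by (intro mult_mono) (use R(1) in auto)
    qed
    show "emeasure (lebV n) (cube n R) < \<infinity>" using R(1) by (simp add: emeasure_lebV_cube)
    show "AE x in lebV n. x \<notin> cube n R \<longrightarrow> f x * h x = 0" using R(2) by (intro AE_I2) force
  qed auto
  then show ?thesis .
qed

lemma nice_integrable_coord:
  assumes "nice n f" "i < n"
  shows "integrable (lebV n) (\<lambda>x. f x * x i)"
  by (rule nice_integrable[OF assms(1)]) (use assms(2) in \<open>auto simp: cube_def\<close>)

lemma nice_integrable_self: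
  assumes "nice n f"
  shows "integrable (lebV n) f"
  using nice_integrable[OF assms, of "\<lambda>_. 1"] by auto

lemma nice_nn_integral:
  assumes "nice n f"
  shows "(\<integral>\<^sup>+x. ennreal (f x) \<partial>lebV n) = ennreal (\<integral>x. f x \<partial>lebV n)"
  using nice_integrable_self[OF assms] assms by (intro nn_integral_eq_integral) (auto simp: nice_def)

lemma nice_mult_indicator:
  assumes "nice n f" and [measurable]: "A \<in> sets borel"
  shows "nice n (\<lambda>x. f x * indicator A x)"
proof -
  obtain R where R: "R \<ge> 0" "\<And>x. 0 \<le> f x \<and> f x \<le> R \<and> (f x \<noteq> 0 \<longrightarrow> x \<in> cube n R)"
    and [measurable]: "f \<in> borel_measurable borel" using assms(1) by (auto simp: nice_def)
  show ?thesis unfolding nice_def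
    by (intro conjI exI[of _ R] allI) (use R in \<open>auto split: split_indicator\<close>)
qed

text \<open>The induction alternates between two forms: \<open>bary_from_shift\<close> passes from
  \<open>santalo_shift\<close> to this one in the same dimension, and \<open>shift_from_bary\<close>
  raises the dimension by one. Only f is regular; g is an arbitrary Borel function.\<close>

definition santalo_bary :: "nat \<Rightarrow> bool" where
  "santalo_bary n \<longleftrightarrow> (\<forall>f (g :: vec \<Rightarrow> ennreal). nice n f \<and> g \<in> borel_measurable borel \<and>
     (\<forall>i<n. (\<integral>x. f x * x i \<partial>lebV n) = 0) \<and>
     (\<forall>x\<in>Rn n. \<forall>y\<in>Rn n. ennreal (f x) * g y \<le> ennreal (exp (- ip n x y))) \<longrightarrow>
     (\<integral>\<^sup>+x. ennreal (f x) \<partial>lebV n) * (\<integral>\<^sup>+y. g y \<partial>lebV n) \<le> 16 ^ n)"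

text \<open>The order of quantifiers matters: z depends on f alone, so that afterwards g may be
  chosen as a tilt depending on z.\<close>

definition santalo_shift :: "nat \<Rightarrow> bool" where
  "santalo_shift n \<longleftrightarrow> (\<forall>f. nice n f \<longrightarrow> (\<exists>z\<in>Rn n. \<forall>g :: vec \<Rightarrow> ennreal. g \<in> borel_measurable borel \<and>
     (\<forall>x\<in>Rn n. \<forall>y\<in>Rn n. ennreal (f (\<lambda>i. z i + x i)) * g y \<le> ennreal (exp (- ip n x y))) \<longrightarrow>
     (\<integral>\<^sup>+x. ennreal (f x) \<partial>lebV n) * (\<integral>\<^sup>+y. g y \<partial>lebV n) \<le> 16 ^ n))"

lemma cube_ip_bound: "x \<in> cube n R \<Longrightarrow> \<bar>ip n x z\<bar> \<le> (\<Sum>i<n. R * \<bar>z i\<bar>)"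
  unfolding ip_def cube_def
  by (rule order_trans[OF sum_abs]) (auto intro!: sum_mono mult_right_mono simp: abs_mult)

lemma ip_integral_zero:
  assumes "nice n f" "\<forall>i<n. (\<integral>x. f x * x i \<partial>lebV n) = 0"
  shows "(\<integral>x. f x * ip n x z \<partial>lebV n) = 0"
proof -
  have "(\<integral>x. f x * ip n x z \<partial>lebV n) = (\<integral>x. (\<Sum>i<n. f x * x i * z i) \<partial>lebV n)"
    by (simp add: ip_def sum_distrib_left mult.assoc)
  also have "\<dots> = (\<Sum>i<n. \<integral>x. f x * x i * z i \<partial>lebV n)"
    by (rule Bochner_Integration.integral_sum) (use nice_integrable_coord[OF assms(1)] in auto)
  also have "\<dots> = 0" using assms(2) by simp
  finally show ?thesis .
qed

text \<open>A centred barycentre is exploited in the upper bound through this inequality: the linear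
  term of e^t \<ge> 1 + t integrates to 0, whatever z is.\<close>

lemma exp_tilt_ge:
  assumes f: "nice n f" and b: "\<forall>i<n. (\<integral>x. f x * x i \<partial>lebV n) = 0"
  shows "(\<integral>\<^sup>+x. ennreal (f x) \<partial>lebV n) \<le> (\<integral>\<^sup>+x. ennreal (f x * exp (ip n x z)) \<partial>lebV n)"
proof -
  have m: "f \<in> borel_measurable borel" and nn: "\<And>x. f x \<ge> 0" using f by (auto simp: nice_def)
  have i1: "integrable (lebV n) (\<lambda>x. f x * ip n x z)"
    by (rule nice_integrable[OF f]) (auto intro: cube_ip_bound)
  have i2: "integrable (lebV n) (\<lambda>x. f x * exp (ip n x z))"
  proof (rule nice_integrable[OF f])
    fix R show "\<exists>c. \<forall>x\<in>cube n R. \<bar>exp (ip n x z)\<bar> \<le> c"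
      using cube_ip_bound[of _ n R z] by (intro exI[of _ "exp (\<Sum>i<n. R * \<bar>z i\<bar>)"]) fastforce
  qed auto
  have "(\<integral>x. f x \<partial>lebV n) = (\<integral>x. f x + f x * ip n x z \<partial>lebV n)"
    using ip_integral_zero[OF f b] i1 nice_integrable_self[OF f] by simp
  also have "\<dots> \<le> (\<integral>x. f x * exp (ip n x z) \<partial>lebV n)"
  proof (rule integral_mono)
    fix x have "f x * (1 + ip n x z) \<le> f x * exp (ip n x z)" using nn[of x] exp_ge_add_one_self
      by (intro mult_left_mono) auto
    then show "f x + f x * ip n x z \<le> f x * exp (ip n x z)" by (simp add: algebra_simps)
  qed (use i1 i2 nice_integrable_self[OF f] in auto)
  finally have "ennreal (\<integral>x. f x \<partial>lebV n) \<le> ennreal (\<integral>x. f x * exp (ip n x z) \<partial>lebV n)" by (rule ennreal_leI)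
  moreover have "(\<integral>\<^sup>+x. ennreal (f x * exp (ip n x z)) \<partial>lebV n) = ennreal (\<integral>x. f x * exp (ip n x z) \<partial>lebV n)"
    using nn by (intro nn_integral_eq_integral[OF i2]) auto
  ultimately show ?thesis unfolding nice_nn_integral[OF f] by simp
qed

lemma ip_add_left: "ip n (\<lambda>i. x i + y i) z = ip n x z + ip n y z"
  by (simp add: ip_def sum.distrib algebra_simps)

lemma ip_commute: "ip n x y = ip n y x" by (simp add: ip_def mult.commute)

lemma ip_add_right: "ip n z (\<lambda>i. x i + y i) = ip n z x + ip n z y"
  by (simp add: ip_def sum.distrib algebra_simps)

lemma Rn_add: "x \<in> Rn n \<Longrightarrow> y \<in> Rn n \<Longrightarrow> (\<lambda>i. x i + y i) \<in> Rn n" by (simp add: Rn_def)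

text \<open>Nice approximations from below: they make \<open>santalo_shift\<close>, which speaks
  about nice functions, applicable to any Borel function.\<close>

definition trunc :: "nat \<Rightarrow> nat \<Rightarrow> (vec \<Rightarrow> ennreal) \<Rightarrow> vec \<Rightarrow> real" where
  "trunc n k g y = enn2real (min (g y) (of_nat k)) * indicator (cube n (real k)) y"

lemma nice_trunc:
  fixes g :: "vec \<Rightarrow> ennreal"
  assumes [measurable]: "g \<in> borel_measurable borel"
  shows "nice n (trunc n k g)"
proof -
  have "enn2real (min (g y) (of_nat k)) \<le> real k" for y
  proof -
    have "enn2real (min (g y) (of_nat k)) \<le> enn2real (of_nat k)"
      by (intro enn2real_mono) (auto simp: ennreal_of_nat_eq_real_of_nat)
    then show ?thesis by (simp add: ennreal_of_nat_eq_real_of_nat)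
  qed
  then show ?thesis unfolding nice_def trunc_def
    by (intro conjI exI[of _ "real k"]) (auto split: split_indicator)
qed

lemma ennreal_trunc: "ennreal (trunc n k g y) = min (g y) (of_nat k) * indicator (cube n (real k)) y"
proof -
  have "min (g y) (of_nat k) < top" by (simp add: min_less_iff_disj of_nat_less_top)
  then show ?thesis by (auto simp: trunc_def split: split_indicator)
qed

lemma trunc_le: "ennreal (trunc n k g y) \<le> g y"
  by (auto simp: ennreal_trunc split: split_indicator)

lemma SUP_trunc: "(SUP k. ennreal (trunc n k g y)) = g y"
proof (rule antisym)
  obtain k0 :: nat where k0: "(\<Sum>i<n. \<bar>y i\<bar>) \<le> real k0" using real_arch_simple by blast
  have cub: "y \<in> cube n (real k)" if "k \<ge> k0" for k
  proof -
    have "\<bar>y i\<bar> \<le> real k" if "i < n" for i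
      using member_le_sum[of i "{..<n}" "\<lambda>i. \<bar>y i\<bar>"] that k0 \<open>k \<ge> k0\<close> by auto
    then show ?thesis by (auto simp: cube_def)
  qed
  show "(SUP k. ennreal (trunc n k g y)) \<le> g y" by (rule SUP_least) (rule trunc_le)
  have "g y = (SUP k. min (g y) (of_nat k))"
  proof -
    have "(SUP k. inf (g y) (of_nat k)) = inf (g y) (SUP k. of_nat k)" by (simp add: inf_SUP)
    then show ?thesis by (simp add: inf_min ennreal_SUP_of_nat_eq_top)
  qed
  also have "\<dots> \<le> (SUP k. ennreal (trunc n k g y))"
  proof (rule SUP_least)
    fix k
    have "min (g y) (of_nat k) \<le> min (g y) (of_nat (max k k0))" by (intro min.mono) auto
    also have "\<dots> = ennreal (trunc n (max k k0) g y)" using cub[of "max k k0"] by (simp add: ennreal_trunc)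
    also have "\<dots> \<le> (SUP k. ennreal (trunc n k g y))" by (rule SUP_upper) auto
    finally show "min (g y) (of_nat k) \<le> (SUP k. ennreal (trunc n k g y))" .
  qed
  finally show "g y \<le> (SUP k. ennreal (trunc n k g y))" .
qed

text \<open>Monotone convergence in k. The shift obtained for a truncation may vary with k, so only
  the final numerical bound is passed to the limit.\<close>

lemma trunc_bound:
  assumes g: "g \<in> borel_measurable borel"
    and bound: "\<And>k. c * (\<integral>\<^sup>+y. ennreal (trunc n k g y) \<partial>lebV n) \<le> B"
  shows "c * (\<integral>\<^sup>+y. g y \<partial>lebV n) \<le> B"
proof -
  have "(\<integral>\<^sup>+y. g y \<partial>lebV n) = (\<integral>\<^sup>+y. (SUP k. ennreal (trunc n k g y)) \<partial>lebV n)" by (simp add: SUP_trunc)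
  also have "\<dots> = (SUP k. \<integral>\<^sup>+y. ennreal (trunc n k g y) \<partial>lebV n)"
  proof (rule nn_integral_monotone_convergence_SUP)
    show "incseq (\<lambda>k y. ennreal (trunc n k g y))"
    proof (rule monoI, rule le_funI)
      fix k k' :: nat and y assume "k \<le> k'"
      then have "(of_nat k :: ennreal) \<le> of_nat k'" by (rule of_nat_mono)
      then have "min (g y) (of_nat k) \<le> min (g y) (of_nat k')" by (rule min.mono[OF order_refl])
      moreover have "y \<in> cube n (real k) \<Longrightarrow> y \<in> cube n (real k')" using \<open>k \<le> k'\<close> by (force simp: cube_def)
      ultimately show "ennreal (trunc n k g y) \<le> ennreal (trunc n k' g y)" by (auto simp: ennreal_trunc split: split_indicator)
    qed
    have "trunc n k g \<in> borel_measurable (lebV n)" for k using nice_trunc[OF g, of n k] by (simp add: nice_def)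
    then show "(\<lambda>y. ennreal (trunc n k g y)) \<in> borel_measurable (lebV n)" for k
      by (rule measurable_compose[OF _ measurable_ennreal])
  qed
  finally have "c * (\<integral>\<^sup>+y. g y \<partial>lebV n) = (SUP k. c * (\<integral>\<^sup>+y. ennreal (trunc n k g y) \<partial>lebV n))"
    by (simp add: SUP_mult_left_ennreal)
  also have "\<dots> \<le> B" by (rule SUP_least) (rule bound)
  finally show ?thesis .
qed

text \<open>The hypothesis is applied to a truncation of $g$ instead of $f$. The shift $z$ is compensated by the
  tilt $f(x)e^{\langle x,z\rangle}$, whose integral is at least that of $f$, since $e^t\ge 1+t$ and the
  barycentre of $f$ is the origin.\<close>
lemma bary_from_shift:
  assumes S: "santalo_shift n" shows "santalo_bary n"
  unfolding santalo_bary_def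
proof (intro allI impI, elim conjE)
  fix f :: "vec \<Rightarrow> real" and g :: "vec \<Rightarrow> ennreal"
  assume f: "nice n f" and g[measurable]: "g \<in> borel_measurable borel"
    and b: "\<forall>i<n. (\<integral>x. f x * x i \<partial>lebV n) = 0"
    and fg: "\<forall>x\<in>Rn n. \<forall>y\<in>Rn n. ennreal (f x) * g y \<le> ennreal (exp (- ip n x y))"
  have [measurable]: "f \<in> borel_measurable borel" and nn: "\<And>x. f x \<ge> 0" using f by (auto simp: nice_def)
  show "(\<integral>\<^sup>+x. ennreal (f x) \<partial>lebV n) * (\<integral>\<^sup>+y. g y \<partial>lebV n) \<le> 16 ^ n"
  proof (rule trunc_bound[OF g])
    fix k
    from S[unfolded santalo_shift_def, rule_format, OF nice_trunc[OF g, of n k]]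
    obtain z where z: "z \<in> Rn n" and Z: "\<forall>h :: vec \<Rightarrow> ennreal. h \<in> borel_measurable borel \<and>
      (\<forall>x\<in>Rn n. \<forall>y\<in>Rn n. ennreal (trunc n k g (\<lambda>i. z i + x i)) * h y \<le> ennreal (exp (- ip n x y))) \<longrightarrow>
      (\<integral>\<^sup>+x. ennreal (trunc n k g x) \<partial>lebV n) * (\<integral>\<^sup>+y. h y \<partial>lebV n) \<le> 16 ^ n"
      by (elim bexE)
    have "(\<integral>\<^sup>+x. ennreal (trunc n k g x) \<partial>lebV n) * (\<integral>\<^sup>+x. ennreal (f x * exp (ip n x z)) \<partial>lebV n) \<le> 16 ^ n"
    proof (rule Z[rule_format], intro conjI ballI)
      fix x y assume x: "x \<in> Rn n" and y: "y \<in> Rn n"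
      have "ennreal (trunc n k g (\<lambda>i. z i + x i)) * ennreal (f y * exp (ip n y z))
        \<le> g (\<lambda>i. z i + x i) * ennreal (f y * exp (ip n y z))"
        by (intro mult_right_mono trunc_le) auto
      also have "\<dots> = ennreal (f y) * g (\<lambda>i. z i + x i) * ennreal (exp (ip n y z))"
        using nn by (simp add: ennreal_mult mult_ac)
      also have "\<dots> \<le> ennreal (exp (- ip n y (\<lambda>i. z i + x i))) * ennreal (exp (ip n y z))"
        using fg y Rn_add[OF z x] by (intro mult_right_mono) auto
      also have "\<dots> = ennreal (exp (- ip n x y))"
        by (simp add: ennreal_mult[symmetric] exp_add[symmetric] ip_add_right ip_commute)
      finally show "ennreal (trunc n k g (\<lambda>i. z i + x i)) * ennreal (f y * exp (ip n y z)) \<le> ennreal (exp (- ip n x y))" .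
    qed measurable
    then have "(\<integral>\<^sup>+x. ennreal (trunc n k g x) \<partial>lebV n) * (\<integral>\<^sup>+x. ennreal (f x) \<partial>lebV n) \<le> 16 ^ n"
      using mult_left_mono[OF exp_tilt_ge[OF f b, of z], of "\<integral>\<^sup>+x. ennreal (trunc n k g x) \<partial>lebV n"] by (meson order_trans zero_le)
    then show "(\<integral>\<^sup>+x. ennreal (f x) \<partial>lebV n) * (\<integral>\<^sup>+x. ennreal (trunc n k g x) \<partial>lebV n) \<le> 16 ^ n" by (simp add: mult.commute)
  qed
qed

text \<open>In dimension 0 the measure is a unit mass at the origin, and the hypothesis at that
  point is the claim.\<close>

lemma santalo_shift_0: "santalo_shift 0"
  unfolding santalo_shift_def
proof (intro allI impI)
  fix f assume f: "nice 0 f"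
  then have [measurable]: "f \<in> borel_measurable borel" by (simp add: nice_def)
  show "\<exists>z\<in>Rn 0. \<forall>g :: vec \<Rightarrow> ennreal. g \<in> borel_measurable borel \<and>
     (\<forall>x\<in>Rn 0. \<forall>y\<in>Rn 0. ennreal (f (\<lambda>i. z i + x i)) * g y \<le> ennreal (exp (- ip 0 x y))) \<longrightarrow>
     (\<integral>\<^sup>+x. ennreal (f x) \<partial>lebV 0) * (\<integral>\<^sup>+y. g y \<partial>lebV 0) \<le> 16 ^ 0"
  proof (intro bexI[of _ "\<lambda>_. 0"] allI impI)
    fix g :: "vec \<Rightarrow> ennreal" assume "g \<in> borel_measurable borel \<and>
     (\<forall>x\<in>Rn 0. \<forall>y\<in>Rn 0. ennreal (f (\<lambda>i. 0 + x i)) * g y \<le> ennreal (exp (- ip 0 x y)))"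
    then have [measurable]: "g \<in> borel_measurable borel" and
      fg: "\<And>x y. x \<in> Rn 0 \<Longrightarrow> y \<in> Rn 0 \<Longrightarrow> ennreal (f (\<lambda>i. 0 + x i)) * g y \<le> ennreal (exp (- ip 0 x y))" by auto
    have "ennreal (f (\<lambda>_. 0)) * g (\<lambda>_. 0) \<le> 1"
      using fg[of "\<lambda>_. 0" "\<lambda>_. 0"] by (simp add: Rn_def ip_def)
    moreover have "(\<integral>\<^sup>+x. ennreal (f x) \<partial>lebV 0) = ennreal (f (\<lambda>_. 0))"
      by (rule nn_integral_lebV_0) measurable
    ultimately show "(\<integral>\<^sup>+x. ennreal (f x) \<partial>lebV 0) * (\<integral>\<^sup>+y. g y \<partial>lebV 0) \<le> 16 ^ 0"
      by (simp add: nn_integral_lebV_0)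
  qed (simp add: Rn_def)
qed

section \<open>Median hyperplanes and the step from dimension n to n + 1\<close>

lemma nn_integral_split_zero:
  fixes h :: "real \<Rightarrow> ennreal"
  assumes [measurable]: "h \<in> borel_measurable borel"
  shows "(\<integral>\<^sup>+t. h t \<partial>lborel) = (\<integral>\<^sup>+t. h t * indicator {0<..} t \<partial>lborel) + (\<integral>\<^sup>+t. h (-t) * indicator {0<..} t \<partial>lborel)"
proof -
  have "(\<integral>\<^sup>+t. h t * indicator {..<0} t \<partial>lborel) = ennreal \<bar>-1\<bar> * (\<integral>\<^sup>+t. h (0 + (-1) * t) * indicator {..<0} (0 + (-1) * t) \<partial>lborel)"
    by (rule nn_integral_real_affine) auto
  also have "\<dots> = (\<integral>\<^sup>+t. h (-t) * indicator {0<..} t \<partial>lborel)"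
    by (auto intro!: nn_integral_cong split: split_indicator)
  finally have e: "(\<integral>\<^sup>+t. h t * indicator {..<0} t \<partial>lborel) = (\<integral>\<^sup>+t. h (-t) * indicator {0<..} t \<partial>lborel)" .
  have "(\<integral>\<^sup>+t. h t \<partial>lborel) = (\<integral>\<^sup>+t. h t * indicator {0<..} t + h t * indicator {..<0} t \<partial>lborel)"
  proof (rule nn_integral_cong_AE)
    show "AE t in lborel. h t = h t * indicator {0<..} t + h t * indicator {..<0} t"
      using AE_lborel_singleton[of 0] by eventually_elim (auto split: split_indicator)
  qed
  also have "\<dots> = (\<integral>\<^sup>+t. h t * indicator {0<..} t \<partial>lborel) + (\<integral>\<^sup>+t. h t * indicator {..<0} t \<partial>lborel)"
    by (rule nn_integral_add) auto
  finally show ?thesis unfolding e .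
qed

lemma hyperplane_null: "AE x in lebV (Suc n). x n \<noteq> r"
proof (rule AE_I')
  have "emeasure (lebV (Suc n)) {x. x n = r} = (\<integral>\<^sup>+x. indicator {x. x n = r} x \<partial>lebV (Suc n))" by simp
  also have "\<dots> = (\<integral>\<^sup>+x. \<integral>\<^sup>+s. indicator {x. x n = r} (x(n := s)) \<partial>lborel \<partial>lebV n)"
    by (rule nn_integral_lebV_Suc) measurable
  also have "\<dots> = (\<integral>\<^sup>+x. \<integral>\<^sup>+s. indicator {r} s \<partial>lborel \<partial>lebV n)"
    by (intro nn_integral_cong) (auto split: split_indicator)
  also have "\<dots> = 0" by simp
  finally show "{x. x n = r} \<in> null_sets (lebV (Suc n))" by (intro null_setsI) auto
qed auto

text \<open>In dimension n + 1 the set \<open>cube n R\<close> leaves the last coordinate free, so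
  the slab is a box of height r' - r.\<close>

lemma emeasure_slab:
  assumes "0 \<le> R" "r \<le> r'"
  shows "emeasure (lebV (Suc n)) (cube n R \<inter> {x. r < x n \<and> x n \<le> r'}) = ennreal ((2*R)^n * (r' - r))"
proof -
  have "emeasure (lebV (Suc n)) (cube n R \<inter> {x. r < x n \<and> x n \<le> r'}) = (\<integral>\<^sup>+x. indicator (cube n R \<inter> {x. r < x n \<and> x n \<le> r'}) x \<partial>lebV (Suc n))" by simp
  also have "\<dots> = (\<integral>\<^sup>+x. \<integral>\<^sup>+s. indicator (cube n R \<inter> {x. r < x n \<and> x n \<le> r'}) (x(n := s)) \<partial>lborel \<partial>lebV n)"
    by (rule nn_integral_lebV_Suc) measurable
  also have "\<dots> = (\<integral>\<^sup>+x. \<integral>\<^sup>+s. indicator (cube n R) x * indicator {r<..r'} s \<partial>lborel \<partial>lebV n)"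
    by (intro nn_integral_cong) (auto simp: cube_def split: split_indicator)
  also have "\<dots> = ennreal ((2*R)^n) * ennreal (r' - r)"
    using assms by (simp add: nn_integral_cmult nn_integral_multc emeasure_lebV_cube)
  finally show ?thesis using assms by (simp add: ennreal_mult)
qed

text \<open>The mass above height r is Lipschitz in r, because f is bounded and a thin slab of its
  support has small volume; the intermediate value theorem finds the median. Hyperplanes are null,
  so both open sides carry exactly half.\<close>

lemma nice_median:
  assumes f: "nice (Suc n) f"
  obtains r where "(\<integral>x. f x * indicator {x. x n > r} x \<partial>lebV (Suc n)) = (\<integral>x. f x \<partial>lebV (Suc n)) / 2"
    "(\<integral>x. f x * indicator {x. x n < r} x \<partial>lebV (Suc n)) = (\<integral>x. f x \<partial>lebV (Suc n)) / 2"
proof -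
  obtain R where R: "R \<ge> 0" "\<And>x. 0 \<le> f x \<and> f x \<le> R \<and> (f x \<noteq> 0 \<longrightarrow> x \<in> cube (Suc n) R)"
    and [measurable]: "f \<in> borel_measurable borel" using f by (auto simp: nice_def)
  define M where "M = (\<integral>x. f x \<partial>lebV (Suc n))"
  have M0: "M \<ge> 0" unfolding M_def using R(2) by (intro integral_nonneg_AE) auto
  define m where "m r = (\<integral>x. f x * indicator {x. x n > r} x \<partial>lebV (Suc n))" for r
  have int: "integrable (lebV (Suc n)) (\<lambda>x. f x * indicator A x)" if [measurable]: "A \<in> sets borel" for A
    by (rule nice_integrable_self[OF nice_mult_indicator[OF f]]) measurable
  have step: "\<bar>m r - m r'\<bar> \<le> R * (2*R)^n * (r' - r)" if "r \<le> r'" for r r'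
  proof -
    have "m r - m r' = (\<integral>x. f x * indicator {x. x n > r} x - f x * indicator {x. x n > r'} x \<partial>lebV (Suc n))"
      unfolding m_def by (rule Bochner_Integration.integral_diff[symmetric]) (auto intro!: int)
    also have "\<dots> = (\<integral>x. f x * indicator {x. r < x n \<and> x n \<le> r'} x \<partial>lebV (Suc n))"
      using that by (intro Bochner_Integration.integral_cong) (auto split: split_indicator)
    finally have e: "m r - m r' = (\<integral>x. f x * indicator {x. r < x n \<and> x n \<le> r'} x \<partial>lebV (Suc n))" .
    have "\<dots> \<le> (\<integral>x. R * indicator (cube n R \<inter> {x. r < x n \<and> x n \<le> r'}) x \<partial>lebV (Suc n))"
    proof (rule integral_mono)
      show "integrable (lebV (Suc n)) (\<lambda>x. R * indicator (cube n R \<inter> {x. r < x n \<and> x n \<le> r'}) x)"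
        using emeasure_slab[OF R(1) that, of n] by (intro integrable_mult_right) (auto simp: integrable_indicator_iff emeasure_lborel_Icc_eq)
      fix x
      show "f x * indicator {x. r < x n \<and> x n \<le> r'} x \<le> R * indicator (cube n R \<inter> {x. r < x n \<and> x n \<le> r'}) x"
      proof (cases "f x = 0")
        case False
        then have "x \<in> cube n R" using R(2)[of x] by (auto simp: cube_def)
        then show ?thesis using R(2)[of x] by (auto split: split_indicator)
      qed (use R in auto)
    qed (auto intro!: int)
    also have "\<dots> = R * ((2*R)^n * (r' - r))"
      using emeasure_slab[OF R(1) that, of n] R(1) that by (simp add: measure_def)
    finally have "m r - m r' \<le> R * (2*R)^n * (r' - r)" unfolding e by (simp add: mult.assoc)
    moreover have "m r - m r' \<ge> 0" unfolding e using R(2) by (intro integral_nonneg_AE) auto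
    ultimately show ?thesis by simp
  qed
  have "(R * (2*R)^n)-lipschitz_on UNIV m"
  proof (rule lipschitz_onI)
    fix r r' show "dist (m r) (m r') \<le> R * (2*R)^n * dist r r'"
      using step[of r r'] step[of r' r] by (cases "r \<le> r'") (auto simp: dist_real_def abs_minus_commute)
  qed (use R in auto)
  then have "continuous_on UNIV m" by (rule lipschitz_on_continuous_on)
  then have cont: "continuous_on {-R-1..R} m" by (rule continuous_on_subset) auto
  have "m R = 0"
  proof -
    have "f x * indicator {x. x n > R} x = 0" for x using R(2)[of x] by (force simp: cube_def split: split_indicator)
    then show ?thesis unfolding m_def by (simp only: Bochner_Integration.integral_zero)
  qed
  \<comment> \<open>One unit below the support: at -R the strict inequality would still cut off the
    points with \<open>x n = -R\<close>.\<close>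
  moreover have "m (-R-1) = M"
  proof -
    have "f x * indicator {x. x n > -R-1} x = f x" for x using R(2)[of x] by (force simp: cube_def split: split_indicator)
    then show ?thesis unfolding m_def M_def by (simp only:)
  qed
  ultimately obtain r where r: "m r = M / 2"
    using IVT2'[of m R "M/2" "-R-1"] cont M0 R(1) by auto
  have "M = (\<integral>x. f x * indicator {x. x n > r} x + f x * indicator {x. x n < r} x \<partial>lebV (Suc n))"
    unfolding M_def
  proof (rule integral_cong_AE)
    show "AE x in lebV (Suc n). f x = f x * indicator {x. x n > r} x + f x * indicator {x. x n < r} x"
      using hyperplane_null[of n r] by eventually_elim (auto split: split_indicator)
  qed measurable
  also have "\<dots> = m r + (\<integral>x. f x * indicator {x. x n < r} x \<partial>lebV (Suc n))"
    unfolding m_def by (rule Bochner_Integration.integral_add) (auto intro!: int)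
  finally show ?thesis using that[of r] r unfolding m_def M_def by simp
qed

lemma sum_le_bound: "i < (n::nat) \<Longrightarrow> \<bar>z i\<bar> \<le> (\<Sum>i<n. \<bar>z i :: real\<bar>)"
  by (intro member_le_sum) auto

text \<open>Handles the side of the hyperplane with sign \<sigma>. In sheared coordinates F is the
  integral of f along rays and G that of g along dual rays; the one-dimensional inequality gives
  F(x) G(y) \<le> 4 e^(-<x,y>). The hypothesis H says exactly that F is centred, so
  \<open>santalo_bary\<close> applies to F and G/4.\<close>

lemma santalo_half:
  assumes B: "santalo_bary n" and f: "nice (Suc n) f" and w: "w \<in> Rn n" and z0: "z0 \<in> Rn n"
    and \<sigma>: "\<bar>\<sigma>\<bar> = 1"
    and H: "\<And>i. i < n \<Longrightarrow> (\<integral>X. f X * indicator {X. \<sigma> * (X n - r) > 0} X * (X i - z0 i - w i * (X n - r)) \<partial>lebV (Suc n)) = 0"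
    and g[measurable]: "g \<in> borel_measurable borel"
    and fg: "\<And>x y. x \<in> Rn (Suc n) \<Longrightarrow> y \<in> Rn (Suc n) \<Longrightarrow> ennreal (f (\<lambda>i. (z0(n := r)) i + x i)) * g y \<le> ennreal (exp (- ip (Suc n) x y))"
  shows "(\<integral>\<^sup>+X. ennreal (f X * indicator {X. \<sigma> * (X n - r) > 0} X) \<partial>lebV (Suc n)) *
    (\<integral>\<^sup>+y. (\<integral>\<^sup>+t. g (y(n := \<sigma> * t - ip n w y)) * indicator {0<..} t \<partial>lborel) \<partial>lebV n) \<le> 4 * 16 ^ n"
proof -
  obtain R where R: "R \<ge> 0" "\<And>x. 0 \<le> f x \<and> f x \<le> R \<and> (f x \<noteq> 0 \<longrightarrow> x \<in> cube (Suc n) R)"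
    and [measurable]: "f \<in> borel_measurable borel" using f by (auto simp: nice_def)
  have \<sigma>2: "\<sigma> * \<sigma> = 1" using \<sigma> by (metis abs_mult_self_eq mult_1)
  define S where "S p = (\<lambda>i. z0 i + (fst p i + \<sigma> * snd p * w i))(n := r + \<sigma> * snd p)" for p :: "vec \<times> real"
  have [measurable]: "S \<in> borel_measurable (lebV n \<Otimes>\<^sub>M lborel)" unfolding S_def by measurable
  have [measurable]: "(\<lambda>s. S (x, s)) \<in> borel_measurable borel" for x unfolding S_def fst_conv snd_conv by measurable
  have distr: "lebV (Suc n) = distr (lebV n \<Otimes>\<^sub>M lborel) borel S"
    unfolding S_def by (rule lebV_shear_distr[OF w z0 \<sigma>])
  have Sn: "S (x, s) n = r + \<sigma> * s" for x s by (simp add: S_def)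
  have Spos: "\<sigma> * (S (x, s) n - r) > 0 \<longleftrightarrow> s > 0" for x s
    unfolding Sn using \<sigma>2 by (simp add: mult.assoc[symmetric])
  have Si: "S (x, s) i - z0 i - w i * (S (x, s) n - r) = x i" if "i < n" for x s i
    unfolding Sn using that by (simp add: S_def)
  define F where "F x = (\<integral>s. f (S (x, s)) * indicator {0<..} s \<partial>lborel)" for x
  have F_meas[measurable]: "F \<in> borel_measurable borel"
  proof -
    have "(\<lambda>x. \<integral>s. f (S (x, s)) * indicator {0<..} s \<partial>lborel) \<in> borel_measurable (lebV n)" by measurable
    then show ?thesis unfolding F_def by simp
  qed
  have supp: "s \<le> R + \<bar>r\<bar>" "\<And>i. i < n \<Longrightarrow> \<bar>x i\<bar> \<le> R + (\<Sum>i<n. \<bar>z0 i\<bar>) + (R + \<bar>r\<bar>) * (\<Sum>i<n. \<bar>w i\<bar>)"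
    if "f (S (x, s)) \<noteq> 0" "s > 0" for x s
  proof -
    have c: "S (x, s) \<in> cube (Suc n) R" using R(2) that by blast
    then have "\<bar>S (x, s) n\<bar> \<le> R" by (auto simp: cube_def)
    then have "\<bar>\<sigma> * s\<bar> \<le> R + \<bar>r\<bar>" unfolding Sn by linarith
    then show s: "s \<le> R + \<bar>r\<bar>" using \<sigma> that by (simp add: abs_mult)
    fix i assume i: "i < n"
    have "\<bar>S (x, s) i\<bar> \<le> R" using c i by (auto simp: cube_def)
    then have "\<bar>z0 i + (x i + \<sigma> * s * w i)\<bar> \<le> R" using i by (simp add: S_def)
    then have "\<bar>x i\<bar> \<le> R + \<bar>z0 i\<bar> + \<bar>\<sigma> * s * w i\<bar>" by linarith
    also have "\<bar>\<sigma> * s * w i\<bar> = s * \<bar>w i\<bar>" using \<sigma> that by (simp add: abs_mult)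
    also have "\<dots> \<le> (R + \<bar>r\<bar>) * (\<Sum>i<n. \<bar>w i\<bar>)" using s that sum_le_bound[OF i, of w] R(1) by (intro mult_mono) auto
    finally show "\<bar>x i\<bar> \<le> R + (\<Sum>i<n. \<bar>z0 i\<bar>) + (R + \<bar>r\<bar>) * (\<Sum>i<n. \<bar>w i\<bar>)" using sum_le_bound[OF i, of z0] by linarith
  qed
  have dom: "f (S (x, s)) * indicator {0<..} s \<le> R * indicator {0..R + \<bar>r\<bar>} s" for x s
  proof (cases "f (S (x, s)) \<noteq> 0 \<and> s > 0")
    case True
    then show ?thesis using supp(1)[of x s] R(2)[of "S (x, s)"] by (auto split: split_indicator)
  next
    case False
    then have z: "f (S (x, s)) * indicator {0<..} s = 0" by (auto split: split_indicator)
    show ?thesis unfolding z using R(1) by simp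
  qed
  have Fint: "integrable lborel (\<lambda>s. f (S (x, s)) * indicator {0<..} s)" for x
  proof (rule Bochner_Integration.integrable_bound)
    show "integrable lborel (\<lambda>s. R * indicator {0..R + \<bar>r\<bar>} s)" by (intro integrable_mult_right) (auto simp: integrable_indicator_iff emeasure_lborel_Icc_eq)
    show "AE s in lborel. norm (f (S (x, s)) * indicator {0<..} s) \<le> norm (R * indicator {0..R + \<bar>r\<bar>} s)"
      using dom R by (intro AE_I2) (auto simp: abs_mult)
  qed measurable
  have Fenn: "ennreal (F x) = (\<integral>\<^sup>+s. ennreal (f (S (x, s))) * indicator {0<..} s \<partial>lborel)" for x
  proof -
    have "(\<integral>\<^sup>+s. ennreal (f (S (x, s))) * indicator {0<..} s \<partial>lborel) = (\<integral>\<^sup>+s. ennreal (f (S (x, s)) * indicator {0<..} s) \<partial>lborel)"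
      by (intro nn_integral_cong) (auto split: split_indicator)
    also have "\<dots> = ennreal (F x)" unfolding F_def
      by (rule nn_integral_eq_integral[OF Fint]) (use R in auto)
    finally show ?thesis ..
  qed
  have Fnn: "F x \<ge> 0" for x unfolding F_def using R(2) by (intro integral_nonneg_AE) auto
  have niceF: "nice n F"
  proof -
    define Q where "Q = R + (\<Sum>i<n. \<bar>z0 i\<bar>) + (R + \<bar>r\<bar>) * (\<Sum>i<n. \<bar>w i\<bar>)"
    have Q0: "Q \<ge> 0" unfolding Q_def using R(1) by (auto intro!: add_nonneg_nonneg sum_nonneg mult_nonneg_nonneg)
    have Fb: "F x \<le> R * (R + \<bar>r\<bar>)" for x
    proof -
      have "F x \<le> (\<integral>s. R * indicator {0..R + \<bar>r\<bar>} s \<partial>lborel)" unfolding F_def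
        by (rule integral_mono[OF Fint]) (auto intro!: integrable_mult_right dom simp: integrable_indicator_iff emeasure_lborel_Icc_eq)
      also have "\<dots> = R * (R + \<bar>r\<bar>)" using R(1) by simp
      finally show ?thesis .
    qed
    have Fs: "x \<in> cube n Q" if "F x \<noteq> 0" for x
    proof -
      have "\<exists>s>0. f (S (x, s)) \<noteq> 0"
      proof (rule ccontr)
        assume "\<not> ?thesis"
        then have "f (S (x, s)) * indicator {0<..} s = 0" for s by (auto split: split_indicator)
        then have "F x = 0" unfolding F_def by (simp only: Bochner_Integration.integral_zero)
        then show False using that by simp
      qed
      then show ?thesis using supp(2) unfolding cube_def Q_def by blast
    qed
    have R0: "R * (R + \<bar>r\<bar>) \<ge> 0" using R(1) by simp
    show ?thesis unfolding nice_def
    \<comment> \<open>\<open>nice\<close> asks for one number bounding values and support, hence the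
      sum of the two bounds.\<close>
    proof (intro conjI exI[of _ "R * (R + \<bar>r\<bar>) + Q"] allI impI)
      fix x
      show "F x \<le> R * (R + \<bar>r\<bar>) + Q" using Fb[of x] Q0 by linarith
      assume "F x \<noteq> 0"
      then have "\<bar>x i\<bar> \<le> Q" if "i < n" for i using Fs[of x] that by (auto simp: cube_def)
      then show "x \<in> cube n (R * (R + \<bar>r\<bar>) + Q)" using R0 unfolding cube_def by (simp add: add_increasing)
    qed (use R0 Q0 Fnn F_meas in auto)
  qed
  have baryF: "(\<integral>x. F x * x i \<partial>lebV n) = 0" if i: "i < n" for i
  proof -
    define h where "h X = f X * indicator {X. \<sigma> * (X n - r) > 0} X * (X i - z0 i - w i * (X n - r))" for X
    have [measurable]: "h \<in> borel_measurable borel" unfolding h_def by measurable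
    have hint: "integrable (lebV (Suc n)) h" unfolding h_def
    proof (rule nice_integrable[OF nice_mult_indicator[OF f]])
      fix R' :: real
      have "\<bar>x i - z0 i - w i * (x n - r)\<bar> \<le> \<bar>R'\<bar> + \<bar>z0 i\<bar> + \<bar>w i\<bar> * (\<bar>R'\<bar> + \<bar>r\<bar>)" if "x \<in> cube (Suc n) R'" for x
      proof -
        have x: "\<bar>x i\<bar> \<le> \<bar>R'\<bar>" "\<bar>x n\<bar> \<le> \<bar>R'\<bar>"
        proof -
          have "\<bar>x i\<bar> \<le> R'" "\<bar>x n\<bar> \<le> R'" using that i by (simp_all add: cube_def)
          then show "\<bar>x i\<bar> \<le> \<bar>R'\<bar>" "\<bar>x n\<bar> \<le> \<bar>R'\<bar>" by linarith+
        qed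
        have "\<bar>w i * (x n - r)\<bar> \<le> \<bar>w i\<bar> * (\<bar>R'\<bar> + \<bar>r\<bar>)" unfolding abs_mult using x by (intro mult_left_mono) auto
        then show ?thesis using x by linarith
      qed
      then show "\<exists>c. \<forall>x\<in>cube (Suc n) R'. \<bar>x i - z0 i - w i * (x n - r)\<bar> \<le> c" by blast
    qed measurable
    then have pint: "integrable (lebV n \<Otimes>\<^sub>M lborel) (\<lambda>p. h (S p))"
      unfolding distr by (subst (asm) integrable_distr_eq) auto
    have hS: "h (S (x, s)) = f (S (x, s)) * indicator {0<..} s * x i" for x s
      unfolding h_def Si[OF i] using Spos[of x s] by (auto split: split_indicator)
    have "0 = (\<integral>X. h X \<partial>lebV (Suc n))" using H[OF i] by (simp add: h_def)
    also have "\<dots> = (\<integral>p. h (S p) \<partial>(lebV n \<Otimes>\<^sub>M lborel))"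
      unfolding distr by (rule integral_distr) auto
    also have "\<dots> = (\<integral>x. \<integral>s. h (S (x, s)) \<partial>lborel \<partial>lebV n)"
      by (rule lebVl.integral_fst'[symmetric, OF pint])
    also have "\<dots> = (\<integral>x. F x * x i \<partial>lebV n)"
      unfolding hS F_def by simp
    finally show ?thesis by simp
  qed
  define G where "G y = (\<integral>\<^sup>+t. g (y(n := \<sigma> * t - ip n w y)) * indicator {0<..} t \<partial>lborel)" for y
  have [measurable]: "G \<in> borel_measurable borel"
  proof -
    have "G \<in> borel_measurable (lebV n)" unfolding G_def by measurable
    then show ?thesis by simp
  qed
  have FG: "ennreal (F x) * G y \<le> 4 * ennreal (exp (- ip n x y))" if x: "x \<in> Rn n" and y: "y \<in> Rn n" for x y
  proof -
    define a where "a s = ennreal (f (S (x, s)))" for s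
    \<comment> \<open>The factor e^(<x,y>) removes the part of the pairing that is constant along
      the two rays and leaves e^(-s t).\<close>
    define b where "b t = ennreal (exp (ip n x y)) * g (y(n := \<sigma> * t - ip n w y))" for t
    have [measurable]: "a \<in> borel_measurable borel" "b \<in> borel_measurable borel" unfolding a_def b_def by measurable
    have "(\<integral>\<^sup>+s. a s * indicator {0<..} s \<partial>lborel) * (\<integral>\<^sup>+s. b s * indicator {0<..} s \<partial>lborel) \<le> 4"
    proof (rule santalo_one_dim)
      fix s t :: real assume "s > 0" "t > 0"
      define X where "X = (\<lambda>i. x i + \<sigma> * s * w i)(n := \<sigma> * s)"
      define Y where "Y = y(n := \<sigma> * t - ip n w y)"
      have XR: "X \<in> Rn (Suc n)" "Y \<in> Rn (Suc n)" using x y w by (auto simp: X_def Y_def Rn_def)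
      have "S (x, s) = (\<lambda>i. (z0(n := r)) i + X i)" by (auto simp: S_def X_def)
      then have "a s * g Y \<le> ennreal (exp (- ip (Suc n) X Y))" using fg[OF XR] by (simp add: a_def)
      moreover have "ip (Suc n) X Y = ip n x y + s * t"
      proof -
        have "ip (Suc n) X Y = (\<Sum>i<n. (x i + \<sigma> * s * w i) * y i) + \<sigma> * s * (\<sigma> * t - ip n w y)"
          unfolding ip_def by (simp add: X_def Y_def ip_def)
        also have "(\<Sum>i<n. (x i + \<sigma> * s * w i) * y i) = ip n x y + \<sigma> * s * ip n w y"
          by (simp add: ip_def distrib_right sum.distrib sum_distrib_left mult.assoc)
        also have "ip n x y + \<sigma> * s * ip n w y + \<sigma> * s * (\<sigma> * t - ip n w y) = ip n x y + (\<sigma> * \<sigma>) * (s * t)"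
          by (simp add: algebra_simps)
        finally show ?thesis by (simp add: \<sigma>2)
      qed
      ultimately have "ennreal (exp (ip n x y)) * (a s * g Y) \<le> ennreal (exp (ip n x y)) * ennreal (exp (- (ip n x y + s * t)))"
        by (intro mult_left_mono) auto
      also have "\<dots> = ennreal (exp (- (s * t)))" by (simp add: ennreal_mult[symmetric] exp_add[symmetric])
      finally show "a s * b t \<le> ennreal (exp (- (s * t)))" by (simp add: b_def Y_def mult_ac)
    qed measurable
    also have "(\<integral>\<^sup>+s. a s * indicator {0<..} s \<partial>lborel) = ennreal (F x)" by (simp add: a_def Fenn)
    also have "(\<integral>\<^sup>+s. b s * indicator {0<..} s \<partial>lborel) = ennreal (exp (ip n x y)) * G y"
    proof -
      have [measurable]: "(\<lambda>t. g (y(n := \<sigma> * t - ip n w y))) \<in> borel_measurable borel" by measurable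
      then have "(\<lambda>t. g (y(n := \<sigma> * t - ip n w y)) * indicator {0<..} t) \<in> borel_measurable lborel" by simp
      then show ?thesis unfolding b_def G_def mult.assoc by (rule nn_integral_cmult)
    qed
    finally have "ennreal (exp (- ip n x y)) * (ennreal (F x) * (ennreal (exp (ip n x y)) * G y)) \<le> ennreal (exp (- ip n x y)) * 4"
      by (rule mult_left_mono) simp
    moreover have "ennreal (exp (- ip n x y)) * (ennreal (F x) * (ennreal (exp (ip n x y)) * G y)) = (ennreal (exp (- ip n x y)) * ennreal (exp (ip n x y))) * (ennreal (F x) * G y)"
      by (simp only: mult_ac)
    moreover have "ennreal (exp (- ip n x y)) * ennreal (exp (ip n x y)) = 1"
      by (simp add: ennreal_mult[symmetric] exp_add[symmetric])
    ultimately show ?thesis by (simp add: mult.commute)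
  qed
  \<comment> \<open>The one-dimensional constant 4 is moved onto G, so that the induction hypothesis
    applies with its exact exponential bound.\<close>
  have q: "ennreal (1/4) * 4 = 1"
  proof -
    have "ennreal (1/4) * ennreal 4 = ennreal 1" by (subst ennreal_mult[symmetric]) auto
    then show ?thesis by simp
  qed
  have "(\<integral>\<^sup>+x. ennreal (F x) \<partial>lebV n) * (\<integral>\<^sup>+y. ennreal (1/4) * G y \<partial>lebV n) \<le> 16 ^ n"
  proof (rule B[unfolded santalo_bary_def, rule_format], intro conjI ballI allI impI)
    fix x y assume "x \<in> Rn n" "y \<in> Rn n"
    then have "ennreal (1/4) * (ennreal (F x) * G y) \<le> ennreal (1/4) * (4 * ennreal (exp (- ip n x y)))"
      by (intro mult_left_mono FG) auto
    also have "\<dots> = ennreal (exp (- ip n x y))" by (simp add: mult.assoc[symmetric] q)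
    finally show "ennreal (F x) * (ennreal (1/4) * G y) \<le> ennreal (exp (- ip n x y))" by (simp add: mult_ac)
  qed (use niceF baryF in auto)
  then have "4 * ((\<integral>\<^sup>+x. ennreal (F x) \<partial>lebV n) * (ennreal (1/4) * (\<integral>\<^sup>+y. G y \<partial>lebV n))) \<le> 4 * 16 ^ n"
    by (intro mult_left_mono) (auto simp: nn_integral_cmult)
  moreover have "4 * ((\<integral>\<^sup>+x. ennreal (F x) \<partial>lebV n) * (ennreal (1/4) * (\<integral>\<^sup>+y. G y \<partial>lebV n))) = (ennreal (1/4) * 4) * ((\<integral>\<^sup>+x. ennreal (F x) \<partial>lebV n) * (\<integral>\<^sup>+y. G y \<partial>lebV n))"
    by (simp only: mult_ac)
  ultimately have "(\<integral>\<^sup>+x. ennreal (F x) \<partial>lebV n) * (\<integral>\<^sup>+y. G y \<partial>lebV n) \<le> 4 * 16 ^ n" unfolding q by simp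
  moreover have "(\<integral>\<^sup>+X. ennreal (f X * indicator {X. \<sigma> * (X n - r) > 0} X) \<partial>lebV (Suc n)) = (\<integral>\<^sup>+x. ennreal (F x) \<partial>lebV n)"
  proof -
    have "(\<integral>\<^sup>+X. ennreal (f X * indicator {X. \<sigma> * (X n - r) > 0} X) \<partial>lebV (Suc n)) =
      (\<integral>\<^sup>+p. ennreal (f (S p) * indicator {X. \<sigma> * (X n - r) > 0} (S p)) \<partial>(lebV n \<Otimes>\<^sub>M lborel))"
      unfolding distr by (rule nn_integral_distr) auto
    also have "\<dots> = (\<integral>\<^sup>+x. \<integral>\<^sup>+s. ennreal (f (S (x,s)) * indicator {X. \<sigma> * (X n - r) > 0} (S (x,s))) \<partial>lborel \<partial>lebV n)"
      by (rule lborel.nn_integral_fst[symmetric, where f="\<lambda>p. ennreal (f (S p) * indicator {X. \<sigma> * (X n - r) > 0} (S p))"]) measurable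
    also have "\<dots> = (\<integral>\<^sup>+x. ennreal (F x) \<partial>lebV n)"
      unfolding Fenn by (intro nn_integral_cong) (use Spos in \<open>auto split: split_indicator\<close>)
    finally show ?thesis .
  qed
  ultimately show ?thesis by (simp add: G_def)
qed

text \<open>The shift z is the point where the line through the barycentres of the two halves of f
  meets the median hyperplane. With z as origin, a shear along that line centres both marginals at
  once.\<close>

lemma shift_from_bary:
  assumes B: "santalo_bary n" shows "santalo_shift (Suc n)"
  unfolding santalo_shift_def
proof (intro allI impI)
  fix f assume f: "nice (Suc n) f"
  obtain R where R: "R \<ge> 0" "\<And>x. 0 \<le> f x \<and> f x \<le> R \<and> (f x \<noteq> 0 \<longrightarrow> x \<in> cube (Suc n) R)"
    and [measurable]: "f \<in> borel_measurable borel" using f by (auto simp: nice_def)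
  define M where "M = (\<integral>x. f x \<partial>lebV (Suc n))"
  have M: "(\<integral>\<^sup>+x. ennreal (f x) \<partial>lebV (Suc n)) = ennreal M" unfolding M_def by (rule nice_nn_integral[OF f])
  have M0: "M \<ge> 0" unfolding M_def using R(2) by (intro integral_nonneg_AE) auto
  show "\<exists>z\<in>Rn (Suc n). \<forall>g :: vec \<Rightarrow> ennreal. g \<in> borel_measurable borel \<and>
     (\<forall>x\<in>Rn (Suc n). \<forall>y\<in>Rn (Suc n). ennreal (f (\<lambda>i. z i + x i)) * g y \<le> ennreal (exp (- ip (Suc n) x y))) \<longrightarrow>
     (\<integral>\<^sup>+x. ennreal (f x) \<partial>lebV (Suc n)) * (\<integral>\<^sup>+y. g y \<partial>lebV (Suc n)) \<le> 16 ^ Suc n"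
  proof (cases "M = 0")
    case True
    then show ?thesis unfolding M by (intro bexI[of _ "\<lambda>_. 0"]) (auto simp: Rn_def)
  next
    case False
    then have Mpos: "M > 0" using M0 by simp
    obtain r where r: "(\<integral>x. f x * indicator {x. x n > r} x \<partial>lebV (Suc n)) = M / 2"
      "(\<integral>x. f x * indicator {x. x n < r} x \<partial>lebV (Suc n)) = M / 2"
      using nice_median[OF f] unfolding M_def by blast
    define I where "I \<sigma> = {X :: vec. \<sigma> * (X n - r) > 0}" for \<sigma> :: real
    have [measurable]: "I \<sigma> \<in> sets borel" for \<sigma> unfolding I_def by measurable
    have niceI: "nice (Suc n) (\<lambda>x. f x * indicator (I \<sigma>) x)" for \<sigma> by (rule nice_mult_indicator[OF f]) measurable
    have mass: "(\<integral>x. f x * indicator (I \<sigma>) x \<partial>lebV (Suc n)) = M / 2" if "\<sigma> = 1 \<or> \<sigma> = -1" for \<sigma>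
    proof -
      have "I 1 = {x. x n > r}" "I (-1) = {x. x n < r}" by (auto simp: I_def)
      then show ?thesis using r that by auto
    qed
    define E where "E \<sigma> i = (\<integral>x. f x * indicator (I \<sigma>) x * x i \<partial>lebV (Suc n))" for \<sigma> i
    define D where "D \<sigma> = (\<integral>x. f x * indicator (I \<sigma>) x * (x n - r) \<partial>lebV (Suc n))" for \<sigma>
    have intE: "integrable (lebV (Suc n)) (\<lambda>x. f x * indicator (I \<sigma>) x * x i)" if "i \<le> n" for \<sigma> i
      by (rule nice_integrable_coord[OF niceI]) (use that in simp)
    have int1: "integrable (lebV (Suc n)) (\<lambda>x. f x * indicator (I \<sigma>) x)" for \<sigma>
      by (rule nice_integrable_self[OF niceI])
    have intD: "integrable (lebV (Suc n)) (\<lambda>x. f x * indicator (I \<sigma>) x * (x n - r))" for \<sigma>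
      unfolding right_diff_distrib by (intro Bochner_Integration.integrable_diff intE integrable_mult_left int1) simp
    \<comment> \<open>Strict, because \<sigma> (x_n - r) is positive on the open side and this side
      has mass M/2 > 0. Hence \<open>D 1 > 0 > D (-1)\<close>, and the slope w below is well
      defined.\<close>
    have Dpos: "\<sigma> * D \<sigma> > 0" if \<sigma>: "\<sigma> = 1 \<or> \<sigma> = -1" for \<sigma>
    proof -
      have e: "\<sigma> * D \<sigma> = (\<integral>x. f x * indicator (I \<sigma>) x * (\<sigma> * (x n - r)) \<partial>lebV (Suc n))"
        unfolding D_def by (subst integral_mult_right_zero[symmetric]) (simp add: mult_ac)
      have nn: "0 \<le> f x * indicator (I \<sigma>) x * (\<sigma> * (x n - r))" for x
        using R(2)[of x] by (auto simp: I_def split: split_indicator)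
      have int: "integrable (lebV (Suc n)) (\<lambda>x. f x * indicator (I \<sigma>) x * (\<sigma> * (x n - r)))"
        using integrable_mult_right[OF intD, of \<sigma> \<sigma>] by (simp add: mult_ac)
      have "\<sigma> * D \<sigma> \<ge> 0" unfolding e using nn by (intro integral_nonneg_AE) auto
      moreover have "0 \<noteq> \<sigma> * D \<sigma>"
      proof
        assume "0 = \<sigma> * D \<sigma>"
        then have "\<sigma> * D \<sigma> = 0" ..
        then have "AE x in lebV (Suc n). f x * indicator (I \<sigma>) x * (\<sigma> * (x n - r)) = 0"
          unfolding e using nn by (subst (asm) integral_nonneg_eq_0_iff_AE[OF int]) auto
        then have "AE x in lebV (Suc n). f x * indicator (I \<sigma>) x = 0"
          by eventually_elim (auto simp: I_def split: split_indicator)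
        then have "(\<integral>x. f x * indicator (I \<sigma>) x \<partial>lebV (Suc n)) = 0" by (rule integral_eq_zero_AE)
        then show False using mass[OF \<sigma>] Mpos by simp
      qed
      ultimately show ?thesis by (rule le_neq_trans)
    qed
    have D12: "D 1 > 0" "D (-1) < 0" using Dpos[of 1] Dpos[of "-1"] by auto
    \<comment> \<open>w is the horizontal displacement per unit of height between the two
      barycentres, and z0 is the position of their line at height r.\<close>
    define w where "w i = (if i < n then (E 1 i - E (-1) i) / (D 1 - D (-1)) else 0)" for i
    define z0 where "z0 i = (if i < n then (E 1 i - w i * D 1) / (M/2) else 0)" for i
    have wR: "w \<in> Rn n" "z0 \<in> Rn n" by (auto simp: w_def z0_def Rn_def)
    have EE: "E \<sigma> i - w i * D \<sigma> = z0 i * (M/2)" if "i < n" "\<sigma> = 1 \<or> \<sigma> = -1" for \<sigma> i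
    proof -
      have "w i * (D 1 - D (-1)) = E 1 i - E (-1) i" using that D12 by (simp add: w_def)
      then have "E 1 i - w i * D 1 = E (-1) i - w i * D (-1)" by (simp add: algebra_simps)
      moreover have "z0 i * (M/2) = E 1 i - w i * D 1" using that Mpos by (simp add: z0_def)
      ultimately show ?thesis using that by auto
    qed
    have H: "(\<integral>X. f X * indicator (I \<sigma>) X * (X i - z0 i - w i * (X n - r)) \<partial>lebV (Suc n)) = 0"
      if i: "i < n" and \<sigma>: "\<sigma> = 1 \<or> \<sigma> = -1" for i \<sigma>
    proof -
      have "(\<integral>X. f X * indicator (I \<sigma>) X * (X i - z0 i - w i * (X n - r)) \<partial>lebV (Suc n)) =
        (\<integral>X. f X * indicator (I \<sigma>) X * X i - (z0 i * (f X * indicator (I \<sigma>) X) + w i * (f X * indicator (I \<sigma>) X * (X n - r))) \<partial>lebV (Suc n))"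
        by (simp add: algebra_simps)
      also have "\<dots> = E \<sigma> i - (z0 i * (M / 2) + w i * D \<sigma>)"
        unfolding E_def D_def using i
        by (subst Bochner_Integration.integral_diff Bochner_Integration.integral_add; (intro Bochner_Integration.integrable_add integrable_mult_right intE int1 intD)?; simp add: mass[OF \<sigma>])+
      finally show ?thesis using EE[OF that] by simp
    qed
    define z where "z = z0(n := r)"
    have zR: "z \<in> Rn (Suc n)" using wR by (auto simp: z_def Rn_def)
    show ?thesis
    proof (intro bexI[OF _ zR] allI impI, elim conjE)
      fix g :: "vec \<Rightarrow> ennreal" assume g[measurable]: "g \<in> borel_measurable borel"
        and fg: "\<forall>x\<in>Rn (Suc n). \<forall>y\<in>Rn (Suc n). ennreal (f (\<lambda>i. z i + x i)) * g y \<le> ennreal (exp (- ip (Suc n) x y))"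
      define G where "G \<sigma> = (\<integral>\<^sup>+y. (\<integral>\<^sup>+t. g (y(n := \<sigma> * t - ip n w y)) * indicator {0<..} t \<partial>lborel) \<partial>lebV n)" for \<sigma>
      have half: "ennreal (M/2) * G \<sigma> \<le> 4 * 16 ^ n" if \<sigma>: "\<sigma> = 1 \<or> \<sigma> = -1" for \<sigma>
      proof -
        have "(\<integral>\<^sup>+X. ennreal (f X * indicator {X. \<sigma> * (X n - r) > 0} X) \<partial>lebV (Suc n)) * G \<sigma> \<le> 4 * 16 ^ n"
          unfolding G_def
        proof (rule santalo_half[OF B f wR])
          show "\<bar>\<sigma>\<bar> = 1" using \<sigma> by auto
        qed (use fg H[OF _ \<sigma>] g in \<open>auto simp: I_def z_def\<close>)
        then show ?thesis using nice_nn_integral[OF niceI[of \<sigma>], unfolded mass[OF \<sigma>], unfolded I_def] by simp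
      qed
      have "(\<integral>\<^sup>+y. g y \<partial>lebV (Suc n)) = (\<integral>\<^sup>+y. \<integral>\<^sup>+t. g (y(n := 1 * t - ip n w y)) \<partial>lborel \<partial>lebV n)"
        by (rule lebV_dual_shear) auto
      also have "\<dots> = (\<integral>\<^sup>+y. (\<integral>\<^sup>+t. g (y(n := 1 * t - ip n w y)) * indicator {0<..} t \<partial>lborel) + (\<integral>\<^sup>+t. g (y(n := -1 * t - ip n w y)) * indicator {0<..} t \<partial>lborel) \<partial>lebV n)"
        by (rule nn_integral_cong, subst nn_integral_split_zero) auto
      also have "\<dots> = G 1 + G (-1)" unfolding G_def by (rule nn_integral_add) measurable
      finally have gG: "(\<integral>\<^sup>+y. g y \<partial>lebV (Suc n)) = G 1 + G (-1)" .
      have "ennreal M = 2 * ennreal (M/2)"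
      proof -
        have "ennreal 2 * ennreal (M/2) = ennreal M" using Mpos by (subst ennreal_mult[symmetric]) auto
        then show ?thesis by simp
      qed
      then have "ennreal M * (G 1 + G (-1)) = 2 * (ennreal (M/2) * G 1 + ennreal (M/2) * G (-1))"
        by (simp add: distrib_left mult.assoc)
      \<comment> \<open>Each side costs 4 * 16^n against half of the mass; doubling the mass and
        adding two sides produces the factor 16 per dimension.\<close>
      also have "\<dots> \<le> 2 * (4 * 16 ^ n + 4 * 16 ^ n)"
        by (intro mult_left_mono add_mono half) auto
      also have "\<dots> = 16 ^ Suc n"
      proof -
        have "2 * (4 * 16 ^ n + 4 * 16 ^ n) = (16 :: ennreal) ^ Suc n"
          by (simp add: distrib_left mult.assoc[symmetric] distrib_right[symmetric])
        then show ?thesis .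
      qed
      finally show "(\<integral>\<^sup>+x. ennreal (f x) \<partial>lebV (Suc n)) * (\<integral>\<^sup>+y. g y \<partial>lebV (Suc n)) \<le> 16 ^ Suc n"
        unfolding M gG .
    qed
  qed
qed

lemma santalo_shift: "santalo_shift n"
  by (induction n) (auto intro: santalo_shift_0 shift_from_bary bary_from_shift)

section \<open>Volume products of sets\<close>

definition join :: "nat \<Rightarrow> vec \<Rightarrow> vec \<Rightarrow> vec" where
  "join p x w = (\<lambda>i. if i < p then x i else w (i - p))"

lemma join_measurable[measurable (raw)]:
  assumes [measurable]: "f \<in> borel_measurable M" "g \<in> borel_measurable M"
  shows "(\<lambda>x. join p (f x) (g x)) \<in> borel_measurable M"
proof (rule vec_measurableI)
  fix i show "(\<lambda>x. join p (f x) (g x) i) \<in> borel_measurable M"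
    by (cases "i < p") (simp_all add: join_def)
qed

lemma nn_integral_lebV_join:
  assumes "f \<in> borel_measurable borel"
  shows "nn_integral (lebV (p + q)) f = (\<integral>\<^sup>+x. \<integral>\<^sup>+w. f (join p x w) \<partial>lebV q \<partial>lebV p)"
  using assms
proof (induction q arbitrary: f)
  case 0
  have [measurable]: "f \<in> borel_measurable borel" by fact
  have "(\<integral>\<^sup>+w. f (join p x w) \<partial>lebV 0) = f (join p x (\<lambda>_. 0))" for x
    by (rule nn_integral_lebV_0) measurable
  moreover have "(\<integral>\<^sup>+x. f (join p x (\<lambda>_. 0)) \<partial>lebV p) = (\<integral>\<^sup>+x. f x \<partial>lebV p)"
  proof (rule nn_integral_cong_AE)
    show "AE x in lebV p. f (join p x (\<lambda>_. 0)) = f x" using AE_lebV_Rn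
    proof eventually_elim
      case (elim x)
      then have "join p x (\<lambda>_. 0) = x" by (auto simp: join_def Rn_def)
      then show ?case by simp
    qed
  qed
  ultimately show ?case by simp
next
  case (Suc q)
  have [measurable]: "f \<in> borel_measurable borel" by fact
  have "nn_integral (lebV (Suc (p + q))) f = (\<integral>\<^sup>+x. \<integral>\<^sup>+s. f (x(p + q := s)) \<partial>lborel \<partial>lebV (p + q))"
    by (rule nn_integral_lebV_Suc) measurable
  also have "\<dots> = (\<integral>\<^sup>+x. \<integral>\<^sup>+w. \<integral>\<^sup>+s. f ((join p x w)(p + q := s)) \<partial>lborel \<partial>lebV q \<partial>lebV p)"
    by (rule Suc.IH) measurable
  also have "\<dots> = (\<integral>\<^sup>+x. \<integral>\<^sup>+w. \<integral>\<^sup>+s. f (join p x (w(q := s))) \<partial>lborel \<partial>lebV q \<partial>lebV p)"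
  proof -
    have "(join p x w)(p + q := s) = join p x (w(q := s))" for x w s
      by (auto simp: join_def fun_eq_iff)
    then show ?thesis by simp
  qed
  also have "\<dots> = (\<integral>\<^sup>+x. \<integral>\<^sup>+w. f (join p x w) \<partial>lebV (Suc q) \<partial>lebV p)"
  proof (rule nn_integral_cong)
    fix x
    show "(\<integral>\<^sup>+w. \<integral>\<^sup>+s. f (join p x (w(q := s))) \<partial>lborel \<partial>lebV q) = (\<integral>\<^sup>+w. f (join p x w) \<partial>lebV (Suc q))"
      by (rule nn_integral_lebV_Suc[where f="\<lambda>w. f (join p x w)", symmetric]) measurable
  qed
  finally show ?case by simp
qed

text \<open>Rogers-Shephard argument at one fixed ratio s: by convexity the fibre over (1-s) y0 + s
  y contains a translate of (1-s) times the fibre over y0. Integrating over y in P, a scaling by s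
  in p variables, gives the factor s^p (1-s)^q.\<close>

lemma rogers_shephard:
  assumes K[measurable]: "K \<in> sets borel" and conv: "is_convex K"
    and P[measurable]: "P \<in> sets borel" and P: "\<And>y. y \<in> P \<Longrightarrow> \<exists>w\<in>Rn q. join p y w \<in> K"
    and y0: "y0 \<in> Rn p" and s: "0 < s" "s < 1"
  shows "ennreal (s^p * (1-s)^q) * (emeasure (lebV p) P * emeasure (lebV q) {w. join p y0 w \<in> K}) \<le> emeasure (lebV (p + q)) K"
proof -
  define S where "S = {w. join p y0 w \<in> K}"
  have [measurable]: "S \<in> sets borel" unfolding S_def by measurable
  have fib: "ennreal ((1-s)^q) * emeasure (lebV q) S \<le> (\<integral>\<^sup>+w. indicator K (join p (\<lambda>i. (1-s) * y0 i + s * y i) w) \<partial>lebV q)"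
    if y: "y \<in> P" for y
  proof -
    obtain wy where wy: "wy \<in> Rn q" "join p y wy \<in> K" using P[OF y] by blast
    have "ennreal ((1-s)^q) * emeasure (lebV q) S = ennreal (\<bar>1-s\<bar>^q) * (\<integral>\<^sup>+w. indicator S w \<partial>lebV q)" using s by simp
    also have "\<dots> \<le> ennreal (\<bar>1-s\<bar>^q) * (\<integral>\<^sup>+w. indicator K (join p (\<lambda>i. (1-s) * y0 i + s * y i) (\<lambda>i. s * wy i + (1-s) * w i)) \<partial>lebV q)"
    proof (intro mult_left_mono nn_integral_mono)
      fix w
      have "join p (\<lambda>i. (1-s) * y0 i + s * y i) (\<lambda>i. s * wy i + (1-s) * w i) \<in> K" if "w \<in> S"
      proof -
        have "(\<lambda>i. (1-s) * join p y0 w i + s * join p y wy i) \<in> K"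
          using conv[unfolded is_convex_def, rule_format, of "join p y0 w" "join p y wy" s] that wy s by (simp add: S_def)
        also have "(\<lambda>i. (1-s) * join p y0 w i + s * join p y wy i) = join p (\<lambda>i. (1-s) * y0 i + s * y i) (\<lambda>i. s * wy i + (1-s) * w i)"
          by (auto simp: join_def)
        finally show ?thesis .
      qed
      then show "(indicator S w :: ennreal) \<le> indicator K (join p (\<lambda>i. (1-s) * y0 i + s * y i) (\<lambda>i. s * wy i + (1-s) * w i))"
        by (auto split: split_indicator)
    qed auto
    also have "\<dots> = (\<integral>\<^sup>+w. indicator K (join p (\<lambda>i. (1-s) * y0 i + s * y i) w) \<partial>lebV q)"
    proof (rule lebV_affine[where f="\<lambda>w. indicator K (join p (\<lambda>i. (1-s) * y0 i + s * y i) w)", symmetric])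
      show "(\<lambda>i. s * wy i) \<in> Rn q" using wy by (simp add: Rn_def)
    qed (use s in auto)
    finally show ?thesis .
  qed
  define h where "h x = (\<integral>\<^sup>+w. indicator K (join p x w) \<partial>lebV q :: ennreal)" for x
  have [measurable]: "h \<in> borel_measurable borel"
  proof -
    have "h \<in> borel_measurable (lebV p)" unfolding h_def by measurable
    then show ?thesis by simp
  qed
  have "ennreal (s^p * (1-s)^q) * (emeasure (lebV p) P * emeasure (lebV q) S) =
     ennreal (\<bar>s\<bar>^p) * (\<integral>\<^sup>+y. (ennreal ((1-s)^q) * emeasure (lebV q) S) * indicator P y \<partial>lebV p)"
    using s by (subst nn_integral_cmult_indicator) (auto simp: ennreal_mult mult_ac)
  also have "\<dots> \<le> ennreal (\<bar>s\<bar>^p) * (\<integral>\<^sup>+y. h (\<lambda>i. (1-s) * y0 i + s * y i) \<partial>lebV p)"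
    by (intro mult_left_mono nn_integral_mono) (use fib in \<open>auto simp: h_def split: split_indicator\<close>)
  also have "\<dots> = (\<integral>\<^sup>+y. h y \<partial>lebV p)"
  proof (rule lebV_affine[where f=h, symmetric])
    show "(\<lambda>i. (1-s) * y0 i) \<in> Rn p" using y0 by (simp add: Rn_def)
  qed (use s in auto)
  also have "\<dots> = (\<integral>\<^sup>+x. indicator K x \<partial>lebV (p + q))"
    unfolding h_def by (rule nn_integral_lebV_join[symmetric]) measurable
  finally show ?thesis by (simp add: S_def)
qed

text \<open>For $Q$ containing the origin in its interior this is $e^{-\|y\|_Q}$.\<close>
definition gexp :: "vec set \<Rightarrow> vec \<Rightarrow> ennreal" where
  "gexp Q y = (\<integral>\<^sup>+s. ennreal (exp (-s)) * indicator {0<..} s * indicator Q (\<lambda>i. 0 + (1/s) * y i) \<partial>lborel)"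

lemma gexp_measurable[measurable]:
  assumes [measurable]: "Q \<in> sets borel" shows "gexp Q \<in> borel_measurable borel"
proof -
  have "(\<lambda>y. \<integral>\<^sup>+s. ennreal (exp (-s)) * indicator {0<..} s * indicator Q (\<lambda>i. (\<lambda>_. 0) i + (1/s) * y i) \<partial>lborel) \<in> borel_measurable borel"
    by measurable
  then show ?thesis unfolding gexp_def[abs_def] by simp
qed

text \<open>After Tonelli, the substitution y = s y' leaves the integral of s^(n+d) e^(-s), which is
  (n+d)!. Degree d = 0 yields volumes, d = 1 first moments.\<close>

lemma gexp_integral:
  assumes [measurable]: "Q \<in> sets borel" "u \<in> borel_measurable borel"
    and hom: "\<And>s y. s > 0 \<Longrightarrow> u (\<lambda>i. s * y i) = ennreal (s^d) * u y"
  shows "(\<integral>\<^sup>+y. u y * gexp Q y \<partial>lebV n) = ennreal (fact (n + d)) * (\<integral>\<^sup>+y. u y * indicator Q y \<partial>lebV n)"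
proof -
  have [measurable]: "(\<lambda>p. indicator Q (\<lambda>i. 0 + (1/snd p) * fst p i) :: ennreal) \<in> borel_measurable (lebV n \<Otimes>\<^sub>M lborel)"
  proof -
    have "(\<lambda>p. indicator Q (\<lambda>i. (\<lambda>_. 0) i + (1/snd p) * fst p i) :: ennreal) \<in> borel_measurable (lebV n \<Otimes>\<^sub>M lborel)" by measurable
    then show ?thesis by simp
  qed
  have "(\<integral>\<^sup>+y. u y * gexp Q y \<partial>lebV n) =
    (\<integral>\<^sup>+y. \<integral>\<^sup>+s. u y * (ennreal (exp (-s)) * indicator {0<..} s * indicator Q (\<lambda>i. 0 + (1/s) * y i)) \<partial>lborel \<partial>lebV n)"
  proof (rule nn_integral_cong)
    fix y
    have "(\<lambda>s. indicator Q (\<lambda>i. (\<lambda>_. 0) i + (1/s) * y i) :: ennreal) \<in> borel_measurable borel" by measurable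
    then have "(\<lambda>s. ennreal (exp (-s)) * indicator {0<..} s * indicator Q (\<lambda>i. 0 + (1/s) * y i)) \<in> borel_measurable lborel" by simp
    then show "u y * gexp Q y = (\<integral>\<^sup>+s. u y * (ennreal (exp (-s)) * indicator {0<..} s * indicator Q (\<lambda>i. 0 + (1/s) * y i)) \<partial>lborel)"
      unfolding gexp_def by (rule nn_integral_cmult[symmetric])
  qed
  also have "\<dots> = (\<integral>\<^sup>+s. \<integral>\<^sup>+y. u y * (ennreal (exp (-s)) * indicator {0<..} s * indicator Q (\<lambda>i. 0 + (1/s) * y i)) \<partial>lebV n \<partial>lborel)"
    by (rule lebVl.Fubini'[symmetric]) (unfold case_prod_beta, measurable)
  also have "\<dots> = (\<integral>\<^sup>+s. (ennreal (s^(n + d) * exp (-s)) * indicator {0..} s) * (\<integral>\<^sup>+y. u y * indicator Q y \<partial>lebV n) \<partial>lborel)"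
  proof (rule nn_integral_cong_AE)
    show "AE s in lborel. (\<integral>\<^sup>+y. u y * (ennreal (exp (-s)) * indicator {0<..} s * indicator Q (\<lambda>i. 0 + (1/s) * y i)) \<partial>lebV n) =
      (ennreal (s^(n + d) * exp (-s)) * indicator {0..} s) * (\<integral>\<^sup>+y. u y * indicator Q y \<partial>lebV n)"
      using AE_lborel_singleton[of "0::real"]
    proof eventually_elim
      case (elim s)
      show ?case
      proof (cases "s > 0")
        case True
        have qm: "(\<lambda>y. indicator Q (\<lambda>i. 0 + (1/s) * y i) :: ennreal) \<in> borel_measurable borel"
        proof -
          have "(\<lambda>y. indicator Q (\<lambda>i. (\<lambda>_. 0) i + (1/s) * y i) :: ennreal) \<in> borel_measurable borel" by measurable
          then show ?thesis by simp
        qed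
        have um: "(\<lambda>y. u y * indicator Q (\<lambda>i. 0 + (1/s) * y i)) \<in> borel_measurable borel" using qm by simp
        have "(\<integral>\<^sup>+y. u y * (ennreal (exp (-s)) * indicator {0<..} s * indicator Q (\<lambda>i. 0 + (1/s) * y i)) \<partial>lebV n)
          = (\<integral>\<^sup>+y. ennreal (exp (-s)) * (u y * indicator Q (\<lambda>i. 0 + (1/s) * y i)) \<partial>lebV n)"
          using True by (simp add: mult_ac)
        also have "\<dots> = ennreal (exp (-s)) * (\<integral>\<^sup>+y. u y * indicator Q (\<lambda>i. 0 + (1/s) * y i) \<partial>lebV n)"
          by (rule nn_integral_cmult) (use um in simp)
        also have "(\<integral>\<^sup>+y. u y * indicator Q (\<lambda>i. 0 + (1/s) * y i) \<partial>lebV n) =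
          ennreal (\<bar>s\<bar>^n) * (\<integral>\<^sup>+y. u (\<lambda>i. 0 + s * y i) * indicator Q (\<lambda>i. 0 + (1/s) * (0 + s * y i)) \<partial>lebV n)"
          by (rule lebV_affine[OF um, where z="\<lambda>_. 0"]) (use True in \<open>auto simp: Rn_def\<close>)
        also have "\<dots> = ennreal (s^n) * (\<integral>\<^sup>+y. ennreal (s^d) * (u y * indicator Q y) \<partial>lebV n)"
          using True hom[OF True] by (simp add: mult_ac)
        also have "\<dots> = ennreal (s^n) * (ennreal (s^d) * (\<integral>\<^sup>+y. u y * indicator Q y \<partial>lebV n))"
          by (subst nn_integral_cmult) auto
        finally show ?thesis using True by (simp add: ennreal_mult power_add mult_ac)
      qed (use elim in auto)
    qed
  qed
  also have "\<dots> = (\<integral>\<^sup>+s. ennreal (s^(n + d) * exp (-s)) * indicator {0..} s \<partial>lborel) * (\<integral>\<^sup>+y. u y * indicator Q y \<partial>lebV n)"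
    by (rule nn_integral_multc) simp
  also have "\<dots> = ennreal (fact (n + d)) * (\<integral>\<^sup>+y. u y * indicator Q y \<partial>lebV n)"
    by (subst nn_intergal_power_times_exp_Ici) simp
  finally show ?thesis .
qed

lemma gexp_integral_1:
  assumes "Q \<in> sets borel"
  shows "(\<integral>\<^sup>+y. gexp Q y \<partial>lebV n) = ennreal (fact n) * emeasure (lebV n) Q"
  using gexp_integral[OF assms, of "\<lambda>_. 1" 0 n] assms by simp

lemma gexp_le:
  assumes "\<And>s. s > 0 \<Longrightarrow> (\<lambda>i. 0 + (1/s) * y i) \<in> Q \<Longrightarrow> a \<le> s"
  shows "gexp Q y \<le> ennreal (exp (-a))"
proof -
  have "gexp Q y \<le> (\<integral>\<^sup>+s. ennreal (exp (-s)) * indicator {a..} s \<partial>lborel)"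
    unfolding gexp_def by (intro nn_integral_mono) (use assms in \<open>auto split: split_indicator\<close>)
  then show ?thesis by (simp add: nn_integral_exp_from)
qed

lemma ip_scale_right: "ip n x (\<lambda>i. c * y i) = c * ip n x y"
  by (simp add: ip_def sum_distrib_left mult_ac)

lemma ip_scale_left: "ip n (\<lambda>i. c * x i) y = c * ip n x y"
  by (simp add: ip_def sum_distrib_left mult_ac)

text \<open>\<open>santalo_shift\<close> is applied to truncations of the gauge exponential of Q;
  moving its shift to the other factor turns the indicator of A into a tilted indicator. The shift
  is not known in advance, hence the hypothesis on all \<theta>. The factorial comes from
  \<open>gexp_integral_1\<close>.\<close>

lemma volume_product_bound:
  assumes [measurable]: "A \<in> sets borel" "Q \<in> sets borel"
    and AQ: "\<And>x y. x \<in> A \<Longrightarrow> y \<in> Q \<Longrightarrow> ip n x y \<le> 1"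
    and m: "\<And>\<theta>. \<theta> \<in> Rn n \<Longrightarrow> m \<le> (\<integral>\<^sup>+x. indicator A x * ennreal (exp (ip n x \<theta>)) \<partial>lebV n)"
  shows "m * (ennreal (fact n) * emeasure (lebV n) Q) \<le> 16 ^ n"
proof -
  have "m * (\<integral>\<^sup>+y. gexp Q y \<partial>lebV n) \<le> 16 ^ n"
  proof (rule trunc_bound)
    fix k
    from santalo_shift[unfolded santalo_shift_def, rule_format, OF nice_trunc[OF gexp_measurable, of Q n k]]
    obtain z where z: "z \<in> Rn n" and Z: "\<forall>h :: vec \<Rightarrow> ennreal. h \<in> borel_measurable borel \<and>
      (\<forall>x\<in>Rn n. \<forall>y\<in>Rn n. ennreal (trunc n k (gexp Q) (\<lambda>i. z i + x i)) * h y \<le> ennreal (exp (- ip n x y))) \<longrightarrow>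
      (\<integral>\<^sup>+x. ennreal (trunc n k (gexp Q) x) \<partial>lebV n) * (\<integral>\<^sup>+y. h y \<partial>lebV n) \<le> 16 ^ n"
      using assms(2) by auto
    have "(\<integral>\<^sup>+x. ennreal (trunc n k (gexp Q) x) \<partial>lebV n) * (\<integral>\<^sup>+x. indicator A x * ennreal (exp (ip n x z)) \<partial>lebV n) \<le> 16 ^ n"
    proof (rule Z[rule_format], intro conjI ballI)
      fix x y
      show "ennreal (trunc n k (gexp Q) (\<lambda>i. z i + x i)) * (indicator A y * ennreal (exp (ip n y z))) \<le> ennreal (exp (- ip n x y))"
      proof (cases "y \<in> A")
        case True
        have "gexp Q (\<lambda>i. z i + x i) \<le> ennreal (exp (- ip n y (\<lambda>i. z i + x i)))"
        proof (rule gexp_le)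
          fix s :: real assume s: "s > 0" and "(\<lambda>i. 0 + (1/s) * (z i + x i)) \<in> Q"
          then have "ip n y (\<lambda>i. 0 + (1/s) * (z i + x i)) \<le> 1" using AQ[OF True] by blast
          then have "(1/s) * ip n y (\<lambda>i. z i + x i) \<le> 1" by (simp only: add_0_left ip_scale_right)
          then show "ip n y (\<lambda>i. z i + x i) \<le> s" using s by (simp add: field_simps)
        qed
        then have "ennreal (trunc n k (gexp Q) (\<lambda>i. z i + x i)) \<le> ennreal (exp (- ip n y (\<lambda>i. z i + x i)))"
          using trunc_le order_trans by blast
        then have "ennreal (trunc n k (gexp Q) (\<lambda>i. z i + x i)) * ennreal (exp (ip n y z)) \<le> ennreal (exp (- ip n y (\<lambda>i. z i + x i))) * ennreal (exp (ip n y z))"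
          by (rule mult_right_mono) simp
        also have "\<dots> = ennreal (exp (- ip n x y))"
          by (simp add: ennreal_mult[symmetric] exp_add[symmetric] ip_add_right ip_commute)
        finally show ?thesis using True by simp
      qed simp
    qed measurable
    then have "(\<integral>\<^sup>+x. ennreal (trunc n k (gexp Q) x) \<partial>lebV n) * m \<le> 16 ^ n"
      using mult_left_mono[OF m[OF z], of "\<integral>\<^sup>+x. ennreal (trunc n k (gexp Q) x) \<partial>lebV n"] by (meson order_trans zero_le)
    then show "m * (\<integral>\<^sup>+x. ennreal (trunc n k (gexp Q) x) \<partial>lebV n) \<le> 16 ^ n" by (simp add: mult.commute)
  qed measurable
  then show ?thesis by (simp add: gexp_integral_1)
qed

section \<open>Log-concave marginals\<close>

lemma length_le_oscillation:
  fixes X :: "real set"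
  assumes "X \<noteq> {}" "bdd_above X" "bdd_below X" "X \<in> sets borel"
  shows "emeasure lborel X \<le> ennreal (Sup X - Inf X)"
proof -
  have "X \<subseteq> {Inf X..Sup X}" using assms by (auto intro: cInf_lower cSup_upper)
  then have "emeasure lborel X \<le> emeasure lborel {Inf X..Sup X}" by (rule emeasure_mono) auto
  moreover have "Inf X \<le> Sup X" using assms by (intro cInf_le_cSup) auto
  ultimately show ?thesis by simp
qed

text \<open>Weighted one-dimensional Brunn-Minkowski inequality, with N bounding the spread of (1-t)
  X + t Y in place of its measure. Both sets are rescaled and \<open>oscillation_sum\<close>
  applies.\<close>

lemma length_mix:
  fixes X Y :: "real set"
  assumes ne: "X \<noteq> {}" "Y \<noteq> {}" and [measurable]: "X \<in> sets borel" "Y \<in> sets borel" and t: "0 < t" "t < 1"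
    and N: "\<And>x x' y y'. x \<in> X \<Longrightarrow> x' \<in> X \<Longrightarrow> y \<in> Y \<Longrightarrow> y' \<in> Y \<Longrightarrow> (1-t) * (x' - x) + t * (y' - y) \<le> N"
  shows "ennreal (1-t) * emeasure lborel X + ennreal t * emeasure lborel Y \<le> ennreal N"
proof -
  define A B where "A = (*) (1-t) ` X" and "B = (*) t ` Y"
  have ne': "A \<noteq> {}" "B \<noteq> {}" using ne by (auto simp: A_def B_def)
  have N': "(s' - s) + (t' - u) \<le> N" if "s \<in> A" "s' \<in> A" "u \<in> B" "t' \<in> B" for s s' u t'
    using that N by (fastforce simp: A_def B_def algebra_simps)
  note osc = oscillation_sum[OF ne', of N]
  have o: "bdd_above A" "bdd_below A" "bdd_above B" "bdd_below B" "(Sup A - Inf A) + (Sup B - Inf B) \<le> N"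
    by (rule osc; use N' in blast)+
  have scale: "ennreal c * emeasure lborel Z \<le> ennreal (Sup ((*) c ` Z) - Inf ((*) c ` Z))" "Inf ((*) c ` Z) \<le> Sup ((*) c ` Z)"
    if c: "c > 0" and Z: "Z \<noteq> {}" "Z \<in> sets borel" "bdd_above ((*) c ` Z)" "bdd_below ((*) c ` Z)" for c Z
  proof -
    have b: "bdd_above Z" "bdd_below Z"
    proof -
      obtain M m where M: "\<And>z. z\<in>Z \<Longrightarrow> c * z \<le> M" and m: "\<And>z. z\<in>Z \<Longrightarrow> m \<le> c * z"
        using Z unfolding bdd_above_def bdd_below_def by auto
      show "bdd_above Z" by (rule bdd_aboveI[of _ "M/c"]) (use M c in \<open>simp add: field_simps\<close>)
      show "bdd_below Z" by (rule bdd_belowI[of _ "m/c"]) (use m c in \<open>simp add: field_simps\<close>)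
    qed
    have "c * Sup Z \<le> Sup ((*) c ` Z)"
    proof -
      have "Sup Z \<le> Sup ((*) c ` Z) / c"
        using Z(1)
      proof (rule cSup_least)
        fix z assume "z \<in> Z"
        then have "c * z \<le> Sup ((*) c ` Z)" using Z by (intro cSup_upper) auto
        then show "z \<le> Sup ((*) c ` Z) / c" using c by (simp add: field_simps)
      qed
      then show ?thesis using c by (simp add: field_simps)
    qed
    moreover have "Inf ((*) c ` Z) \<le> c * Inf Z"
    proof -
      have "Inf ((*) c ` Z) / c \<le> Inf Z"
        using Z(1)
      proof (rule cInf_greatest)
        fix z assume "z \<in> Z"
        then have "Inf ((*) c ` Z) \<le> c * z" using Z by (intro cInf_lower) auto
        then show "Inf ((*) c ` Z) / c \<le> z" using c by (simp add: field_simps)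
      qed
      then show ?thesis using c by (simp add: field_simps)
    qed
    ultimately have le: "c * (Sup Z - Inf Z) \<le> Sup ((*) c ` Z) - Inf ((*) c ` Z)" by (simp add: algebra_simps)
    have "Inf Z \<le> Sup Z" using Z b by (intro cInf_le_cSup) auto
    then have nn: "0 \<le> c * (Sup Z - Inf Z)" using c by simp
    then show "Inf ((*) c ` Z) \<le> Sup ((*) c ` Z)" using le by linarith
    have "ennreal c * emeasure lborel Z \<le> ennreal c * ennreal (Sup Z - Inf Z)"
      using length_le_oscillation[OF Z(1) b Z(2)] by (rule mult_left_mono) simp
    also have "\<dots> = ennreal (c * (Sup Z - Inf Z))" using c by (subst ennreal_mult') auto
    also have "\<dots> \<le> ennreal (Sup ((*) c ` Z) - Inf ((*) c ` Z))" using le by (rule ennreal_leI)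
    finally show "ennreal c * emeasure lborel Z \<le> ennreal (Sup ((*) c ` Z) - Inf ((*) c ` Z))" .
  qed
  have t': "1 - t > 0" using t by simp
  have sX: "ennreal (1-t) * emeasure lborel X \<le> ennreal (Sup A - Inf A)" "Inf A \<le> Sup A"
    using scale[OF t' ne(1)] o unfolding A_def by auto
  have sY: "ennreal t * emeasure lborel Y \<le> ennreal (Sup B - Inf B)" "Inf B \<le> Sup B"
    using scale[OF t(1) ne(2)] o unfolding B_def by auto
  have "ennreal (1-t) * emeasure lborel X + ennreal t * emeasure lborel Y \<le> ennreal (Sup A - Inf A) + ennreal (Sup B - Inf B)"
    by (intro add_mono sX sY)
  also have "\<dots> = ennreal ((Sup A - Inf A) + (Sup B - Inf B))"
    by (rule ennreal_plus[symmetric]) (use sX sY in auto)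
  also have "\<dots> \<le> ennreal N" using o(5) by (rule ennreal_leI)
  finally show ?thesis .
qed

lemma superlevel_nonempty:
  fixes p :: "real \<Rightarrow> real"
  assumes "bdd_above (range p)" "(SUP s. p s) > 0" "\<tau> > 0"
  shows "\<exists>s. p s \<ge> (SUP s. p s) * exp (-\<tau>)"
proof -
  have "(SUP s. p s) * exp (-\<tau>) < (SUP s. p s)" using assms by simp
  then obtain s where "(SUP s. p s) * exp (-\<tau>) < p s" using less_cSUP_iff[OF _ assms(1)] by auto
  then show ?thesis by (auto intro: less_imp_le)
qed

text \<open>Prekopa-Leindler on the line. At equal relative height the level sets of p and q mix
  into one of r, so Brunn-Minkowski compares their lengths; integrating gives an arithmetic mean of
  the integrals normalised by P and Q, and Young's inequality passes to the geometric mean.\<close>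

lemma prekopa_one_dim:
  fixes p q r :: "real \<Rightarrow> real"
  assumes [measurable]: "p \<in> borel_measurable borel" "q \<in> borel_measurable borel" "r \<in> borel_measurable borel"
    and b: "\<And>s. 0 \<le> p s \<and> p s \<le> R" "\<And>s. 0 \<le> q s \<and> q s \<le> R" "\<And>s. 0 \<le> r s \<and> r s \<le> R"
    and supp: "\<And>s. r s \<noteq> 0 \<Longrightarrow> \<bar>s\<bar> \<le> R"
    and t: "0 < t" "t < 1"
    and pqr: "\<And>s s'. p s powr (1-t) * q s' powr t \<le> r ((1-t) * s + t * s')"
    and quasi: "\<And>s s' u. s \<le> u \<Longrightarrow> u \<le> s' \<Longrightarrow> min (r s) (r s') \<le> r u"
    and ip: "(\<integral>\<^sup>+s. ennreal (p s) \<partial>lborel) = ennreal x" "x > 0" and iq: "(\<integral>\<^sup>+s. ennreal (q s) \<partial>lborel) = ennreal y" "y > 0"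
  shows "ennreal (x powr (1-t) * y powr t) \<le> (\<integral>\<^sup>+s. ennreal (r s) \<partial>lborel)"
proof -
  define P Q where "P = (SUP s. p s)" and "Q = (SUP s. q s)"
  have bp: "bdd_above (range p)" "bdd_above (range q)" by (rule bdd_aboveI2[where M=R]; use b in blast)+
  have pP: "p s \<le> P" "q s \<le> Q" for s unfolding P_def Q_def using bp by (auto intro: cSUP_upper)
  have P0: "P > 0"
  proof (rule ccontr)
    assume "\<not> P > 0"
    then have "p s = 0" for s using pP(1)[of s] b(1)[of s] by linarith
    then show False using ip by simp
  qed
  have Q0: "Q > 0"
  proof (rule ccontr)
    assume "\<not> Q > 0"
    then have "q s = 0" for s using pP(2)[of s] b(2)[of s] by linarith
    then show False using iq by simp
  qed
  \<comment> \<open>The reference height for r is the geometric mean of the suprema of p and q. The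
    supremum of r may be larger, so r is cut off at W, which can only lower the integral to be
    bounded from below.\<close>
  define W where "W = P powr (1-t) * Q powr t"
  have W0: "W > 0" using P0 Q0 by (simp add: W_def)
  define X Y Z where "X \<tau> = {s. p s \<ge> P * exp (-\<tau>)}" and "Y \<tau> = {s. q s \<ge> Q * exp (-\<tau>)}" and "Z \<tau> = {s. min (r s) W \<ge> W * exp (-\<tau>)}" for \<tau>
  have [measurable]: "X \<tau> \<in> sets borel" "Y \<tau> \<in> sets borel" "Z \<tau> \<in> sets borel" for \<tau> unfolding X_def Y_def Z_def by measurable
  have XYZ: "(1-t) * s + t * s' \<in> Z \<tau>" if "\<tau> > 0" "s \<in> X \<tau>" "s' \<in> Y \<tau>" for s s' \<tau>
  proof -
    have "W * exp (-\<tau>) = (P * exp (-\<tau>)) powr (1-t) * (Q * exp (-\<tau>)) powr t"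
      using P0 Q0 by (simp add: W_def powr_mult powr_def[of "exp _"] mult_ac exp_add[symmetric] algebra_simps)
    also have "\<dots> \<le> p s powr (1-t) * q s' powr t"
      using that P0 Q0 t by (intro mult_mono powr_mono2) (auto simp: X_def Y_def)
    also have "\<dots> \<le> r ((1-t) * s + t * s')" by (rule pqr)
    finally have "W * exp (-\<tau>) \<le> r ((1-t) * s + t * s')" .
    moreover have "W * exp (-\<tau>) \<le> W" using W0 that by (simp add: mult_le_cancel_left1)
    ultimately show ?thesis by (simp add: Z_def)
  qed
  have len: "ennreal (1-t) * emeasure lborel (X \<tau>) + ennreal t * emeasure lborel (Y \<tau>) \<le> emeasure lborel (Z \<tau>)" if \<tau>: "\<tau> > 0" for \<tau>
  proof -
    \<comment> \<open>Quasi-concavity makes the level set of r an interval, so its length is at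
      least the distance between any two mixtures of points from the other two level sets.\<close>
    have sub: "{z..z'} \<subseteq> Z \<tau>" if "z \<in> Z \<tau>" "z' \<in> Z \<tau>" for z z'
    proof
      fix u assume "u \<in> {z..z'}"
      then show "u \<in> Z \<tau>" using quasi[of z u z'] that by (auto simp: Z_def)
    qed
    have "Z \<tau> \<subseteq> {-R..R}"
    proof
      fix s assume "s \<in> Z \<tau>"
      then have "r s \<ge> W * exp (-\<tau>)" by (simp add: Z_def)
      moreover have "W * exp (-\<tau>) > 0" using W0 by simp
      ultimately have "r s \<noteq> 0" by linarith
      then show "s \<in> {-R..R}" using supp[of s] by auto
    qed
    then have fin: "emeasure lborel (Z \<tau>) < \<infinity>" using emeasure_mono[of "Z \<tau>" "{-R..R}" lborel] emeasure_lborel_Icc_eq[of "-R" R]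
      by (metis (no_types, lifting) ennreal_less_top infinity_ennreal_def order_le_less_trans sets_lborel atLeastAtMost_borel ennreal_0)
    obtain N where N: "emeasure lborel (Z \<tau>) = ennreal N" "N \<ge> 0" using fin by (cases "emeasure lborel (Z \<tau>)") auto
    have "(1-t) * (x' - x) + t * (y' - y) \<le> N" if "x \<in> X \<tau>" "x' \<in> X \<tau>" "y \<in> Y \<tau>" "y' \<in> Y \<tau>" for x x' y y'
    proof -
      have zz: "(1-t) * x + t * y \<in> Z \<tau>" "(1-t) * x' + t * y' \<in> Z \<tau>" using XYZ[OF \<tau>] that by auto
      have "emeasure lborel {(1-t) * x + t * y..(1-t) * x' + t * y'} \<le> ennreal N"
        unfolding N(1)[symmetric] by (rule emeasure_mono[OF sub[OF zz]]) simp
      then have "(1-t) * x' + t * y' - ((1-t) * x + t * y) \<le> N"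
        using N(2) by (cases "(1-t) * x + t * y \<le> (1-t) * x' + t * y'") auto
      then show ?thesis by (simp add: algebra_simps)
    qed
    moreover have "X \<tau> \<noteq> {}" "Y \<tau> \<noteq> {}"
      using superlevel_nonempty[OF bp(1) _ \<tau>] superlevel_nonempty[OF bp(2) _ \<tau>] P0 Q0 unfolding P_def Q_def X_def Y_def by auto
    ultimately show ?thesis unfolding N(1) by (intro length_mix t) auto
  qed
  have cake: "(\<integral>\<^sup>+s. ennreal (h s) \<partial>lborel) = ennreal U * (\<integral>\<^sup>+\<tau>. ennreal (exp (-\<tau>)) * indicator {0..} \<tau> * emeasure lborel {s. h s \<ge> U * exp (-\<tau>)} \<partial>lborel)"
    if [measurable]: "h \<in> borel_measurable borel" and "U > 0" "\<And>s. 0 \<le> h s \<and> h s \<le> U" for h :: "real \<Rightarrow> real" and U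
    using layer_cake_exp[of h "\<lambda>_. 1" U] that by simp
  define a where "a \<tau> = ennreal (exp (-\<tau>)) * indicator {0..} \<tau>" for \<tau> :: real
  have [measurable]: "a \<in> borel_measurable borel" unfolding a_def by measurable
  have mX: "(\<lambda>\<tau>. emeasure lborel {s. h s \<ge> U * exp (-\<tau>)}) \<in> borel_measurable borel" if [measurable]: "h \<in> borel_measurable borel" for h :: "real \<Rightarrow> real" and U :: real
  proof -
    have "(\<lambda>\<tau>. \<integral>\<^sup>+s. indicator {s. h s \<ge> U * exp (-\<tau>)} s \<partial>lborel) \<in> borel_measurable borel" by measurable
    then show ?thesis by simp
  qed
  define IX IY where "IX = (\<integral>\<^sup>+\<tau>. a \<tau> * emeasure lborel (X \<tau>) \<partial>lborel)" and "IY = (\<integral>\<^sup>+\<tau>. a \<tau> * emeasure lborel (Y \<tau>) \<partial>lborel)"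
  have iX: "ennreal x = ennreal P * IX" unfolding IX_def a_def X_def ip(1)[symmetric] by (rule cake) (use P0 b pP in auto)
  have iY: "ennreal y = ennreal Q * IY" unfolding IY_def a_def Y_def iq(1)[symmetric] by (rule cake) (use Q0 b pP in auto)
  have "IX \<noteq> top" "IY \<noteq> top" using iX iY P0 Q0 by (auto simp: ennreal_mult_top)
  then obtain x' y' where x': "IX = ennreal x'" "x' \<ge> 0" and y': "IY = ennreal y'" "y' \<ge> 0"
    by (metis ennreal_cases)
  have "ennreal x = ennreal (P * x')" "ennreal y = ennreal (Q * y')" using iX iY x' y' P0 Q0 by (auto simp: ennreal_mult)
  then have xx: "x = P * x'" and yy: "y = Q * y'" using ip iq P0 Q0 x' y' by (auto simp: ennreal_inj)
  then have x0: "x' > 0" and y0: "y' > 0" using ip iq P0 Q0 by (auto simp: zero_less_mult_iff)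
  have "x powr (1-t) * y powr t = W * (x' powr (1-t) * y' powr t)"
    using P0 Q0 x0 y0 by (simp add: xx yy W_def powr_mult)
  also have "\<dots> \<le> W * ((1-t) * x' + t * y')"
    using W0 Youngs_inequality_0[of "1-t" t x' y'] t x0 y0 by (intro mult_left_mono) auto
  finally have "ennreal (x powr (1-t) * y powr t) \<le> ennreal (W * ((1-t) * x' + t * y'))" by (rule ennreal_leI)
  also have "\<dots> = ennreal W * (ennreal (1-t) * IX + ennreal t * IY)"
    using W0 x' y' t by (simp add: ennreal_mult ennreal_plus)
  also have "ennreal (1-t) * IX + ennreal t * IY = (\<integral>\<^sup>+\<tau>. a \<tau> * (ennreal (1-t) * emeasure lborel (X \<tau>) + ennreal t * emeasure lborel (Y \<tau>)) \<partial>lborel)"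
    unfolding IX_def IY_def X_def Y_def
    by (subst (1 2) nn_integral_cmult[symmetric]) (auto simp: mX nn_integral_add[symmetric] distrib_left mult_ac intro!: nn_integral_cong)
  also have "ennreal W * \<dots> \<le> ennreal W * (\<integral>\<^sup>+\<tau>. a \<tau> * emeasure lborel (Z \<tau>) \<partial>lborel)"
  proof (intro mult_left_mono nn_integral_mono_AE)
    show "AE \<tau> in lborel. a \<tau> * (ennreal (1-t) * emeasure lborel (X \<tau>) + ennreal t * emeasure lborel (Y \<tau>)) \<le> a \<tau> * emeasure lborel (Z \<tau>)"
      using AE_lborel_singleton[of 0]
    proof eventually_elim
      case (elim \<tau>)
      then show ?case using len[of \<tau>] by (cases "\<tau> > 0") (auto simp: a_def intro!: mult_left_mono)
    qed
  qed auto
  also have "\<dots> = (\<integral>\<^sup>+s. ennreal (min (r s) W) \<partial>lborel)"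
    unfolding a_def Z_def by (rule cake[symmetric]) (use W0 b in auto)
  also have "\<dots> \<le> (\<integral>\<^sup>+s. ennreal (r s) \<partial>lborel)" by (intro nn_integral_mono ennreal_leI) auto
  finally show ?thesis .
qed

text \<open>Because \<open>0 powr s = 0\<close>, for nonnegative f the inequality holds wherever a
  factor vanishes, and it also expresses that the set where f is positive is convex.\<close>

definition logconc :: "nat \<Rightarrow> (vec \<Rightarrow> real) \<Rightarrow> bool" where
  "logconc n f \<longleftrightarrow> (\<forall>x\<in>Rn n. \<forall>y\<in>Rn n. \<forall>t. 0 < t \<and> t < 1 \<longrightarrow>
     f x powr (1-t) * f y powr t \<le> f (\<lambda>i. (1-t) * x i + t * y i))"

lemma logconcD:
  "logconc n f \<Longrightarrow> x \<in> Rn n \<Longrightarrow> y \<in> Rn n \<Longrightarrow> 0 < t \<Longrightarrow> t < 1 \<Longrightarrow> f x powr (1-t) * f y powr t \<le> f (\<lambda>i. (1-t) * x i + t * y i)"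
  by (simp add: logconc_def)

text \<open>Turns log-concavity along a line into the quasi-concavity required by
  \<open>prekopa_one_dim\<close>.\<close>

lemma min_le_powr:
  fixes a b :: real
  assumes "a \<ge> 0" "b \<ge> 0" "0 < t" "t < 1"
  shows "min a b \<le> a powr (1-t) * b powr t"
proof -
  have "min a b = min a b powr (1-t) * min a b powr t"
    using assms by (cases "min a b = 0") (auto simp: powr_add[symmetric])
  also have "\<dots> \<le> a powr (1-t) * b powr t" using assms by (intro mult_mono powr_mono2) auto
  finally show ?thesis .
qed

text \<open>\<open>prekopa_one_dim\<close> is applied to f on the vertical lines over x, over y and
  over their mixture. Log-concavity on the last line supplies quasi-concavity, and niceness is
  preserved so that the step can be iterated.\<close>

lemma prekopa_step:
  assumes f: "nice (Suc n) f" and lc: "logconc (Suc n) f"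
  defines "F \<equiv> \<lambda>x. \<integral>s. f (x(n := s)) \<partial>lborel"
  shows "nice n F" "logconc n F" "\<And>x. ennreal (F x) = (\<integral>\<^sup>+s. ennreal (f (x(n := s))) \<partial>lborel)"
proof -
  obtain R where R: "R \<ge> 0" "\<And>x. 0 \<le> f x \<and> f x \<le> R \<and> (f x \<noteq> 0 \<longrightarrow> x \<in> cube (Suc n) R)"
    and [measurable]: "f \<in> borel_measurable borel" using f by (auto simp: nice_def)
  have supp: "\<bar>s\<bar> \<le> R" "x \<in> cube n R" if "f (x(n := s)) \<noteq> 0" for x s
  proof -
    have "x(n := s) \<in> cube (Suc n) R" using R(2) that by blast
    then have c: "\<And>i. i < Suc n \<Longrightarrow> \<bar>(x(n := s)) i\<bar> \<le> R" unfolding cube_def by blast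
    show "\<bar>s\<bar> \<le> R" using c[of n] by simp
    have "\<bar>x i\<bar> \<le> R" if "i < n" for i using c[of i] that by simp
    then show "x \<in> cube n R" by (simp add: cube_def)
  qed
  have [measurable]: "(\<lambda>s. f (x(n := s))) \<in> borel_measurable borel" for x by measurable
  have dom: "f (x(n := s)) \<le> R * indicator {-R..R} s" for x s
  proof (cases "f (x(n := s)) = 0")
    case False then show ?thesis using supp(1)[of x s] R(2)[of "x(n := s)"] by (auto simp: abs_le_iff)
  qed (use R in auto)
  have int: "integrable lborel (\<lambda>s. f (x(n := s)))" for x
  proof (rule Bochner_Integration.integrable_bound)
    show "integrable lborel (\<lambda>s. R * indicator {-R..R} s)" by (intro integrable_mult_right) (auto simp: integrable_indicator_iff emeasure_lborel_Icc_eq)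
    show "AE s in lborel. norm (f (x(n := s))) \<le> norm (R * indicator {-R..R} s)"
      using dom[of x] R by (intro AE_I2) auto
  qed simp
  show Fe: "ennreal (F x) = (\<integral>\<^sup>+s. ennreal (f (x(n := s))) \<partial>lborel)" for x
    unfolding F_def by (rule nn_integral_eq_integral[OF int, symmetric]) (use R in auto)
  have Fnn: "F x \<ge> 0" for x unfolding F_def using R(2) by (intro integral_nonneg_AE) auto
  have F_meas: "F \<in> borel_measurable borel"
  proof -
    have "F \<in> borel_measurable (lebV n)" unfolding F_def by measurable
    then show ?thesis by simp
  qed
  have Fb: "F x \<le> R * (2 * R)" for x
  proof -
    have "F x \<le> (\<integral>s. R * indicator {-R..R} s \<partial>lborel)" unfolding F_def
      by (rule integral_mono[OF int]) (auto intro!: integrable_mult_right dom simp: integrable_indicator_iff emeasure_lborel_Icc_eq)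
    also have "\<dots> = R * (2 * R)" using R(1) by simp
    finally show ?thesis .
  qed
  have Fs: "x \<in> cube n R" if "F x \<noteq> 0" for x
  proof (rule ccontr)
    assume "x \<notin> cube n R"
    then have "f (x(n := s)) = 0" for s using supp(2) by blast
    then have "F x = 0" unfolding F_def by simp
    then show False using that by simp
  qed
  show "nice n F" unfolding nice_def
  proof (intro conjI exI[of _ "R * (2 * R) + R"] allI impI)
    fix x
    have R0: "R * (2 * R) \<ge> 0" using R(1) by simp
    show "F x \<le> R * (2 * R) + R" using Fb[of x] R(1) by linarith
    assume "F x \<noteq> 0"
    then have "\<bar>x i\<bar> \<le> R" if "i < n" for i using Fs[of x] that by (auto simp: cube_def)
    then show "x \<in> cube n (R * (2 * R) + R)" using R0 unfolding cube_def by (simp add: add_increasing)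
  qed (use R Fnn F_meas in auto)
  show "logconc n F" unfolding logconc_def
  proof (intro ballI allI impI, elim conjE)
    fix x y t assume x: "x \<in> Rn n" and y: "y \<in> Rn n" and t: "0 < (t::real)" "t < 1"
    show "F x powr (1-t) * F y powr t \<le> F (\<lambda>i. (1-t) * x i + t * y i)"
    proof (cases "F x = 0 \<or> F y = 0")
      case True
      then show ?thesis using Fnn t by auto
    next
      case False
      then have pos: "F x > 0" "F y > 0" using Fnn[of x] Fnn[of y] by auto
      define z where "z = (\<lambda>i. (1-t) * x i + t * y i)"
      have upd: "u(n := s) \<in> Rn (Suc n)" if "u \<in> Rn n" for u s using that by (auto simp: Rn_def)
      have zR: "z \<in> Rn n" using x y by (simp add: z_def Rn_def)
      have "ennreal (F x powr (1-t) * F y powr t) \<le> (\<integral>\<^sup>+s. ennreal (f (z(n := s))) \<partial>lborel)"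
      proof (rule prekopa_one_dim[where p="\<lambda>s. f (x(n := s))" and q="\<lambda>s. f (y(n := s))" and R=R])
        fix s s'
        have "(\<lambda>i. (1-t) * (x(n := s)) i + t * (y(n := s')) i) = z(n := (1-t) * s + t * s')"
          by (auto simp: z_def)
        then show "f (x(n := s)) powr (1-t) * f (y(n := s')) powr t \<le> f (z(n := (1-t) * s + t * s'))"
          using logconcD[OF lc upd[OF x] upd[OF y] t] by metis
      next
        fix s s' u :: real assume u: "s \<le> u" "u \<le> s'"
        show "min (f (z(n := s))) (f (z(n := s'))) \<le> f (z(n := u))"
        proof (cases "u = s \<or> u = s'")
          case False
          define c where "c = (u - s) / (s' - s)"
          have c: "0 < c" "c < 1" using u False by (auto simp: c_def field_simps)
          have "c * (s' - s) = u - s" using u False by (simp add: c_def)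
          then have cu: "(1-c) * s + c * s' = u" by (simp add: algebra_simps)
          have "(\<lambda>i. (1-c) * (z(n := s)) i + c * (z(n := s')) i) = z(n := u)"
            using cu by (auto simp: fun_eq_iff algebra_simps)
          then have "f (z(n := s)) powr (1-c) * f (z(n := s')) powr c \<le> f (z(n := u))"
            using logconcD[OF lc upd[OF zR] upd[OF zR] c] by metis
          moreover have "min (f (z(n := s))) (f (z(n := s'))) \<le> f (z(n := s)) powr (1-c) * f (z(n := s')) powr c"
            using R(2) c by (intro min_le_powr) auto
          ultimately show ?thesis by linarith
        qed auto
      qed (use R supp pos t Fe in auto)
      then have "ennreal (F x powr (1-t) * F y powr t) \<le> ennreal (F z)" unfolding Fe[of z] .
      then show ?thesis using Fnn[of z] by (simp add: z_def)
    qed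
  qed
qed

text \<open>The l coordinates after the first m are integrated out one at a time. The marginal is
  asserted as a real function, the form in which \<open>nice\<close> and \<open>logconc\<close> can
  be stated.\<close>

lemma prekopa_marginal:
  assumes "nice (m + l) f" "logconc (m + l) f"
  shows "\<exists>F. nice m F \<and> logconc m F \<and> (\<forall>x. ennreal (F x) = (\<integral>\<^sup>+w. ennreal (f (join m x w)) \<partial>lebV l))"
  using assms
proof (induction l arbitrary: f)
  case 0
  have [measurable]: "f \<in> borel_measurable borel" using 0 by (simp add: nice_def)
  define F where "F x = f (join m x (\<lambda>_. 0))" for x
  have eq: "(\<integral>\<^sup>+w. ennreal (f (join m x w)) \<partial>lebV 0) = ennreal (F x)" for x
    unfolding F_def by (rule nn_integral_lebV_0) measurable
  have F_eq: "F x = f x" if "x \<in> Rn m" for x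
  proof -
    have "join m x (\<lambda>_. 0) = x" using that by (auto simp: join_def Rn_def)
    then show ?thesis by (simp add: F_def)
  qed
  have mixR: "(\<lambda>i. (1-t) * x i + t * y i) \<in> Rn m" if "x \<in> Rn m" "y \<in> Rn m" for x y and t :: real
    using that by (simp add: Rn_def)
  have "logconc m F" using 0(2) mixR unfolding logconc_def by (simp add: F_eq)
  moreover have "nice m F"
  proof -
    obtain R where R: "R \<ge> 0" "\<And>x. 0 \<le> f x \<and> f x \<le> R \<and> (f x \<noteq> 0 \<longrightarrow> x \<in> cube m R)" using 0 by (auto simp: nice_def)
    have "join m x (\<lambda>_. 0) \<in> cube m R \<longleftrightarrow> x \<in> cube m R" for x by (auto simp: cube_def join_def)
    moreover have "F \<in> borel_measurable borel" unfolding F_def by measurable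
    ultimately show ?thesis unfolding nice_def F_def using R by blast
  qed
  ultimately show ?case using eq by (intro exI[of _ F]) auto
next
  case (Suc l)
  have [measurable]: "f \<in> borel_measurable borel" using Suc.prems by (simp add: nice_def)
  define F1 where "F1 x = (\<integral>s. f (x(m + l := s)) \<partial>lborel)" for x
  note st = prekopa_step[of "m + l" f, folded F1_def]
  have s1: "nice (m + l) F1" "logconc (m + l) F1" "\<And>x. ennreal (F1 x) = (\<integral>\<^sup>+s. ennreal (f (x(m + l := s))) \<partial>lborel)"
    using st Suc.prems by auto
  from Suc.IH[OF s1(1,2)] obtain F where F: "nice m F" "logconc m F" "\<And>x. ennreal (F x) = (\<integral>\<^sup>+w. ennreal (F1 (join m x w)) \<partial>lebV l)" by blast
  have "ennreal (F x) = (\<integral>\<^sup>+w. ennreal (f (join m x w)) \<partial>lebV (Suc l))" for x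
  proof -
    have "(join m x w)(m + l := s) = join m x (w(l := s))" for w s
      by (auto simp: join_def fun_eq_iff)
    then have "ennreal (F x) = (\<integral>\<^sup>+w. \<integral>\<^sup>+s. ennreal (f (join m x (w(l := s)))) \<partial>lborel \<partial>lebV l)"
      unfolding F(3) s1(3) by simp
    also have "\<dots> = (\<integral>\<^sup>+w. ennreal (f (join m x w)) \<partial>lebV (Suc l))"
      by (rule nn_integral_lebV_Suc[where f="\<lambda>w. ennreal (f (join m x w))", symmetric]) measurable
    finally show ?thesis .
  qed
  then show ?case using F by blast
qed

lemma logconc_ln:
  assumes "logconc n f" "x \<in> Rn n" "y \<in> Rn n" "0 < t" "t < 1" "f x > 0" "f y > 0"
  shows "f (\<lambda>i. (1-t) * x i + t * y i) > 0" "(1-t) * ln (f x) + t * ln (f y) \<le> ln (f (\<lambda>i. (1-t) * x i + t * y i))"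
proof -
  have le: "f x powr (1-t) * f y powr t \<le> f (\<lambda>i. (1-t) * x i + t * y i)" using assms by (intro logconcD)
  moreover have pos: "f x powr (1-t) * f y powr t > 0" using assms by simp
  ultimately show p: "f (\<lambda>i. (1-t) * x i + t * y i) > 0" by linarith
  have "ln (f x powr (1-t) * f y powr t) \<le> ln (f (\<lambda>i. (1-t) * x i + t * y i))" using le pos p by simp
  then show "(1-t) * ln (f x) + t * ln (f y) \<le> ln (f (\<lambda>i. (1-t) * x i + t * y i))"
    using assms by (simp add: ln_mult ln_powr)
qed

text \<open>Hahn-Banach by induction on the coordinates: \<eta> is minus a supergradient of ln f at
  0. L measures the excess of ln f over the affine bound already found on R^m, and a slope in the
  new direction must separate the quotients from its two sides. The positive values of f on both
  half-axes keep that slope finite.\<close>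

lemma logconc_supergradient:
  assumes "logconc m f" and nn: "\<And>x. f x \<ge> 0" and pos: "f (\<lambda>_. 0) > 0"
    and nbh: "\<And>i. i < m \<Longrightarrow> \<exists>\<delta>>0. f ((\<lambda>_. 0)(i := \<delta>)) > 0 \<and> f ((\<lambda>_. 0)(i := -\<delta>)) > 0"
  shows "\<exists>\<eta>\<in>Rn m. \<forall>w\<in>Rn m. f w * exp (ip m w \<eta>) \<le> f (\<lambda>_. 0)"
  using assms(1) nbh
proof (induction m)
  case 0
  show ?case by (intro bexI[of _ "\<lambda>_. 0"]) (auto simp: Rn_def ip_def)
next
  case (Suc m)
  have RS: "x \<in> Rn (Suc m)" if "x \<in> Rn m" for x using that by (auto simp: Rn_def)
  have "logconc m f" using Suc.prems(1) RS by (auto simp: logconc_def)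
  then obtain \<eta>' where \<eta>': "\<eta>' \<in> Rn m" "\<And>w. w \<in> Rn m \<Longrightarrow> f w * exp (ip m w \<eta>') \<le> f (\<lambda>_. 0)"
    using Suc.IH Suc.prems(2) less_SucI by blast
  define c where "c = ln (f (\<lambda>_. 0))"
  define L where "L w = ln (f w) + ip m w \<eta>' - c" for w
  have L0: "L w \<le> 0" if "w \<in> Rn m" "f w > 0" for w
  proof -
    have "ln (f w * exp (ip m w \<eta>')) \<le> c" unfolding c_def using \<eta>'(2)[OF that(1)] that pos by (subst ln_le_cancel_iff) auto
    then show ?thesis using that by (simp add: L_def ln_mult)
  qed
  have cross: "L w / w m \<le> - L w' / (- w' m)"
    if "w \<in> Rn (Suc m)" "w' \<in> Rn (Suc m)" "f w > 0" "f w' > 0" "w m > 0" "w' m < 0" for w w'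
  proof -
    \<comment> \<open>At this ratio the mixture of w and w' has m-th coordinate 0, so the bound on
      R^m applies to it.\<close>
    define t where "t = w m / (w m - w' m)"
    have t: "0 < t" "t < 1" using that by (auto simp: t_def field_simps)
    define u where "u = (\<lambda>i. (1-t) * w i + t * w' i)"
    have tm: "t * (w m - w' m) = w m" using that by (simp add: t_def)
    have um: "u m = 0" using tm by (simp add: u_def algebra_simps)
    have uR: "u \<in> Rn m" unfolding Rn_def
    proof (intro CollectI allI impI)
      fix i assume "m \<le> i" then show "u i = 0" using um that(1,2) by (cases "i = m") (auto simp: u_def Rn_def)
    qed
    note ll = logconc_ln[OF Suc.prems(1) that(1,2) t that(3,4), folded u_def]
    have "L u \<le> 0" using L0[OF uR ll(1)] .
    moreover have "ip m u \<eta>' = (1-t) * ip m w \<eta>' + t * ip m w' \<eta>'"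
      by (simp add: u_def ip_def distrib_right sum.distrib sum_distrib_left mult.assoc)
    ultimately have "(1-t) * L w + t * L w' \<le> 0" using ll(2) by (simp add: L_def algebra_simps)
    then have "(w m - w' m) * ((1-t) * L w + t * L w') \<le> 0" using that by (simp add: mult_nonneg_nonpos)
    moreover have "(w m - w' m) * ((1-t) * L w + t * L w') = ((w m - w' m) - t * (w m - w' m)) * L w + (t * (w m - w' m)) * L w'"
      by (simp add: algebra_simps)
    ultimately have "(- w' m) * L w + w m * L w' \<le> 0" unfolding tm by (simp add: algebra_simps)
    then show ?thesis using that by (simp add: field_simps)
  qed
  obtain \<delta> where \<delta>: "\<delta> > 0" "f ((\<lambda>_. 0)(m := \<delta>)) > 0" "f ((\<lambda>_. 0)(m := -\<delta>)) > 0" using Suc.prems(2)[of m] by blast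
  define wp wm where "wp = (\<lambda>_. 0 :: real)(m := \<delta>)" and "wm = (\<lambda>_. 0 :: real)(m := -\<delta>)"
  have wR: "wp \<in> Rn (Suc m)" "wm \<in> Rn (Suc m)" by (auto simp: wp_def wm_def Rn_def)
  define D where "D = {w \<in> Rn (Suc m). f w > 0 \<and> w m > 0}"
  have wpD: "wp \<in> D" using wR \<delta> by (auto simp: D_def wp_def)
  \<comment> \<open>Any number between the quotients of the two sides would serve as slope; the
    supremum of the positive side is finite because \<open>wm\<close> bounds it.\<close>
  define \<alpha> where "\<alpha> = (SUP w\<in>D. L w / w m)"
  have \<alpha>_ge: "L w / w m \<le> \<alpha>" if "w \<in> D" for w
    unfolding \<alpha>_def
  proof (rule cSUP_upper[OF that])
    show "bdd_above ((\<lambda>w. L w / w m) ` D)"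
    proof (rule bdd_aboveI2)
      fix w assume "w \<in> D" then show "L w / w m \<le> - L wm / (- wm m)"
        using cross[of w wm] wR \<delta> by (auto simp: D_def wm_def)
    qed
  qed
  have \<alpha>_le: "\<alpha> \<le> - L w' / (- w' m)" if "w' \<in> Rn (Suc m)" "f w' > 0" "w' m < 0" for w'
    unfolding \<alpha>_def by (rule cSUP_least) (use wpD cross that in \<open>auto simp: D_def\<close>)
  define \<eta> where "\<eta> = \<eta>'(m := -\<alpha>)"
  have "\<eta> \<in> Rn (Suc m)" using \<eta>'(1) by (auto simp: \<eta>_def Rn_def)
  moreover have "f w * exp (ip (Suc m) w \<eta>) \<le> f (\<lambda>_. 0)" if w: "w \<in> Rn (Suc m)" for w
  proof (cases "f w = 0")
    case False
    then have fw: "f w > 0" using nn[of w] by simp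
    have ipe: "ip (Suc m) w \<eta> = ip m w \<eta>' - \<alpha> * w m" by (simp add: ip_def \<eta>_def)
    have "L w - \<alpha> * w m \<le> 0"
    proof (cases "w m" "0::real" rule: linorder_cases)
      case greater
      then have "L w / w m \<le> \<alpha>" using w fw by (intro \<alpha>_ge) (auto simp: D_def)
      then show ?thesis using greater by (simp add: field_simps)
    next
      case less
      then have "\<alpha> \<le> - L w / (- w m)" using w fw by (intro \<alpha>_le)
      then show ?thesis using less by (simp add: field_simps)
    next
      case equal
      have "w \<in> Rn m" unfolding Rn_def
      proof (intro CollectI allI impI)
        fix i assume "m \<le> i" then show "w i = 0" using equal w by (cases "i = m") (auto simp: Rn_def)
      qed
      then show ?thesis using L0 fw equal by simp
    qed
    then have "ln (f w * exp (ip (Suc m) w \<eta>)) \<le> ln (f (\<lambda>_. 0))" using fw by (simp add: ln_mult ipe L_def c_def)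
    then show ?thesis using fw pos by (subst (asm) ln_le_cancel_iff) auto
  qed (use pos in auto)
  ultimately show ?case by blast
qed

section \<open>Orthonormal systems\<close>

definition orthonormal :: "nat \<Rightarrow> nat \<Rightarrow> (nat \<Rightarrow> vec) \<Rightarrow> bool" where
  "orthonormal n k v \<longleftrightarrow> (\<forall>j<k. v j \<in> Rn n) \<and> (\<forall>i<k. \<forall>j<k. ip n (v i) (v j) = (if i = j then 1 else 0))"

lemma orthonormalD:
  "orthonormal n k v \<Longrightarrow> j < k \<Longrightarrow> v j \<in> Rn n"
  "orthonormal n k v \<Longrightarrow> i < k \<Longrightarrow> j < k \<Longrightarrow> ip n (v i) (v j) = (if i = j then 1 else 0)"
  by (auto simp: orthonormal_def)

lemma onb_orthonormal: "onb n l u F \<longleftrightarrow> orthonormal n l u \<and> F = {lincomb l u c | c. True}"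
  by (auto simp: onb_def orthonormal_def)

lemma ip_sum_right: "ip n x (\<lambda>i. \<Sum>j\<in>J. f j i) = (\<Sum>j\<in>J. ip n x (f j))"
  unfolding ip_def sum_distrib_left by (rule sum.swap)

lemma ip_diff_right: "ip n z (\<lambda>i. x i - y i) = ip n z x - ip n z y"
  by (simp add: ip_def sum_subtractf algebra_simps)

lemma ip_diff_left: "ip n (\<lambda>i. x i - y i) z = ip n x z - ip n y z"
  by (simp add: ip_def sum_subtractf algebra_simps)

lemma ip_lincomb_right: "ip n x (lincomb l u c) = (\<Sum>j<l. c j * ip n x (u j))"
  unfolding lincomb_def by (subst ip_sum_right) (simp add: ip_scale_right)

lemma ip_lincomb_left: "ip n (lincomb l u c) x = (\<Sum>j<l. c j * ip n (u j) x)"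
  by (subst ip_commute) (simp add: ip_lincomb_right ip_commute)

lemma lincomb_Rn: "(\<And>j. j < l \<Longrightarrow> u j \<in> Rn n) \<Longrightarrow> lincomb l u c \<in> Rn n"
  by (simp add: lincomb_def Rn_def)

lemma ip_lincomb_coord:
  assumes "orthonormal n k v" "j < k"
  shows "ip n (lincomb k v c) (v j) = c j"
proof -
  have "ip n (lincomb k v c) (v j) = (\<Sum>i<k. if i = j then c i else 0)"
    unfolding ip_lincomb_left by (rule sum.cong) (use assms orthonormalD in auto)
  also have "\<dots> = c j" using assms by simp
  finally show ?thesis .
qed

lemma ip_lincomb_lincomb:
  assumes "orthonormal n k v"
  shows "ip n (lincomb k v c) (lincomb k v d) = ip k c d"
  unfolding ip_lincomb_right using ip_lincomb_coord[OF assms] by (simp add: ip_def mult.commute)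

lemma ip_nonneg: "ip n x x \<ge> 0"
  unfolding ip_def by (intro sum_nonneg) auto

lemma ip_eq_0:
  assumes "ip n x x = 0" "i < n" shows "x i = 0"
proof -
  have "x i * x i = 0" using assms by (subst (asm) ip_def, subst (asm) sum_nonneg_eq_0_iff) auto
  then show ?thesis by simp
qed

section \<open>Completion and completeness of orthonormal systems\<close>

definition unitv :: "nat \<Rightarrow> vec" where "unitv i = (\<lambda>_. 0)(i := 1)"

lemma unitv_Rn: "i < n \<Longrightarrow> unitv i \<in> Rn n" by (auto simp: unitv_def Rn_def)

lemma ip_unitv: "i < n \<Longrightarrow> ip n x (unitv i) = x i"
proof -
  assume "i < n"
  have "ip n x (unitv i) = (\<Sum>j<n. if j = i then x i else 0)"
    unfolding ip_def unitv_def by (rule sum.cong) auto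
  then show ?thesis using \<open>i < n\<close> by simp
qed

definition residual :: "nat \<Rightarrow> (nat \<Rightarrow> vec) \<Rightarrow> nat \<Rightarrow> vec" where
  "residual k v i = (\<lambda>a. unitv i a - lincomb k v (\<lambda>j. v j i) a)"

lemma residual_ip:
  assumes v: "orthonormal n k v" and i: "i < n"
  shows "j < k \<Longrightarrow> ip n (v j) (residual k v i) = 0"
    and "ip n (residual k v i) (residual k v i) = 1 - (\<Sum>j<k. (v j i)^2)"
proof -
  show 1: "ip n (v j) (residual k v i) = 0" if j: "j < k" for j
  proof -
    have "ip n (v j) (residual k v i) = ip n (v j) (unitv i) - ip n (lincomb k v (\<lambda>j. v j i)) (v j)"
      unfolding residual_def ip_diff_right by (simp add: ip_commute)
    then show ?thesis by (simp add: ip_unitv[OF i] ip_lincomb_coord[OF v j])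
  qed
  have "ip n (residual k v i) (residual k v i) = ip n (residual k v i) (unitv i) - ip n (residual k v i) (lincomb k v (\<lambda>j. v j i))"
    by (subst (2) residual_def) (rule ip_diff_right)
  also have "ip n (residual k v i) (lincomb k v (\<lambda>j. v j i)) = 0"
    unfolding ip_lincomb_right using 1 by (simp add: ip_commute)
  also have "ip n (residual k v i) (unitv i) = 1 - (\<Sum>j<k. (v j i)^2)"
    unfolding ip_unitv[OF i] by (simp add: residual_def unitv_def lincomb_def power2_eq_square)
  finally show "ip n (residual k v i) (residual k v i) = 1 - (\<Sum>j<k. (v j i)^2)" by simp
qed

text \<open>The trace of the complementary projection. It takes the place of dimension theory: for k
  < n some residual is nonzero and gives a new direction, and for k = n all residuals vanish, which
  is completeness.\<close>

lemma residual_sum: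
  assumes v: "orthonormal n k v"
  shows "(\<Sum>i<n. ip n (residual k v i) (residual k v i)) = real n - real k"
proof -
  have "(\<Sum>i<n. ip n (residual k v i) (residual k v i)) = (\<Sum>i<n. 1 - (\<Sum>j<k. (v j i)^2))"
    using residual_ip(2)[OF v] by simp
  also have "\<dots> = real n - (\<Sum>j<k. ip n (v j) (v j))"
    unfolding sum_subtractf ip_def by (subst sum.swap) (simp add: power2_eq_square)
  also have "(\<Sum>j<k. ip n (v j) (v j)) = real k" using orthonormalD(2)[OF v] by simp
  finally show ?thesis .
qed

lemma orthonormal_extend1:
  assumes v: "orthonormal n k v" and "k < n"
  shows "\<exists>u. orthonormal n (Suc k) (v(k := u))"
proof -
  have "\<exists>i<n. ip n (residual k v i) (residual k v i) > 0"
  proof (rule ccontr)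
    assume "\<not> ?thesis"
    then have "ip n (residual k v i) (residual k v i) \<le> 0" if "i < n" for i using that not_less by blast
    then have "(\<Sum>i<n. ip n (residual k v i) (residual k v i)) \<le> 0" by (intro sum_nonpos) simp
    then show False using residual_sum[OF v] assms by simp
  qed
  then obtain i where i: "i < n" and pos: "ip n (residual k v i) (residual k v i) > 0" by blast
  define r where "r = residual k v i"
  define N where "N = sqrt (ip n r r)"
  have N: "N > 0" "N * N = ip n r r" using pos by (auto simp: N_def r_def)
  define u where "u = (\<lambda>a. (1/N) * r a)"
  have rR: "r \<in> Rn n" unfolding r_def residual_def
    using unitv_Rn[OF i] lincomb_Rn[of k v n] orthonormalD(1)[OF v] by (auto simp: Rn_def)
  have uR: "u \<in> Rn n" using rR by (auto simp: u_def Rn_def)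
  have uu: "ip n u u = 1" unfolding u_def ip_scale_left ip_scale_right N(2)[symmetric] using N(1) by simp
  have vu: "ip n (v j) u = 0" if "j < k" for j
    unfolding u_def ip_scale_right r_def using residual_ip(1)[OF v i that] by simp
  have uv: "ip n u (v j) = 0" if "j < k" for j using vu[OF that] by (simp add: ip_commute)
  have "orthonormal n (Suc k) (v(k := u))"
    unfolding orthonormal_def
  proof (intro conjI allI impI)
    fix j assume "j < Suc k" then show "(v(k := u)) j \<in> Rn n"
      using orthonormalD(1)[OF v, of j] uR by (cases "j = k") auto
  next
    fix a b assume "a < Suc k" "b < Suc k"
    then consider "a < k" "b < k" | "a = k" "b < k" | "a < k" "b = k" | "a = k" "b = k" by linarith
    then show "ip n ((v(k := u)) a) ((v(k := u)) b) = (if a = b then 1 else 0)"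
      by cases (auto simp: orthonormalD(2)[OF v] vu uv uu)
  qed
  then show ?thesis by blast
qed

lemma orthonormal_extend:
  assumes v: "orthonormal n k v" and "k \<le> n"
  shows "\<exists>v'. orthonormal n n v' \<and> (\<forall>j<k. v' j = v j)"
  using assms
proof (induction "n - k" arbitrary: k v)
  case 0
  then show ?case by (intro exI[of _ v]) auto
next
  case (Suc d)
  then have "k < n" by simp
  then obtain u where u: "orthonormal n (Suc k) (v(k := u))" using orthonormal_extend1[OF Suc.prems(1)] by blast
  have "d = n - Suc k" "Suc k \<le> n" using Suc by auto
  from Suc.hyps(1)[OF this(1) u this(2)] obtain v' where "orthonormal n n v'" "\<forall>j<Suc k. v' j = (v(k := u)) j" by blast
  then show ?case by (intro exI[of _ v']) auto
qed

lemma orthonormal_resolution: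
  assumes v: "orthonormal n n v" and i: "i < n" "a < n"
  shows "(\<Sum>j<n. v j i * v j a) = (if i = a then 1 else 0)"
proof -
  have "\<forall>i\<in>{..<n}. ip n (residual n v i) (residual n v i) = 0"
    using residual_sum[OF v] by (subst sum_nonneg_eq_0_iff[symmetric]) (auto simp: ip_nonneg)
  then have "residual n v i a = 0" using ip_eq_0[of n "residual n v i" a] i by simp
  then show ?thesis by (simp add: residual_def unitv_def lincomb_def split: if_splits)
qed

lemma orthonormal_expand:
  assumes v: "orthonormal n n v" and x: "x \<in> Rn n"
  shows "lincomb n v (\<lambda>j. ip n x (v j)) = x"
proof
  fix a
  show "lincomb n v (\<lambda>j. ip n x (v j)) a = x a"
  proof (cases "a < n")
    case True
    have "lincomb n v (\<lambda>j. ip n x (v j)) a = (\<Sum>j<n. \<Sum>k<n. x k * (v j k * v j a))"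
      by (simp add: lincomb_def ip_def sum_distrib_right mult.assoc)
    also have "\<dots> = (\<Sum>k<n. x k * (\<Sum>j<n. v j k * v j a))"
      by (subst sum.swap) (simp add: sum_distrib_left)
    also have "\<dots> = (\<Sum>k<n. if k = a then x k else 0)"
      by (rule sum.cong) (use orthonormal_resolution[OF v] True in auto)
    also have "\<dots> = x a" using True by simp
    finally show ?thesis .
  next
    case False
    moreover have "lincomb n v (\<lambda>j. ip n x (v j)) \<in> Rn n" by (rule lincomb_Rn) (rule orthonormalD(1)[OF v])
    ultimately show ?thesis using x by (simp add: Rn_def)
  qed
qed

lemma lincomb_unitv: "j < l \<Longrightarrow> lincomb l u (unitv j) = u j"
proof
  fix a assume "j < l"
  have "lincomb l u (unitv j) a = (\<Sum>i<l. if i = j then u i a else 0)"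
    unfolding lincomb_def unitv_def by (rule sum.cong) auto
  then show "lincomb l u (unitv j) a = u j a" using \<open>j < l\<close> by simp
qed

lemma onb_lincomb_mem: "onb n l u F \<Longrightarrow> lincomb l u c \<in> F"
  unfolding onb_def by blast

lemma onb_basis_mem:
  assumes "onb n l u F" "j < l" shows "u j \<in> F"
  using onb_lincomb_mem[OF assms(1), of "unitv j"] lincomb_unitv[OF assms(2), of u] by simp

lemma lincomb_measurable[measurable]: "lincomb l u \<in> borel_measurable borel"
  by (rule vec_measurableI) (unfold lincomb_def, measurable)

lemma lincomb_add: "lincomb l u (\<lambda>i. c i + d i) = (\<lambda>i. lincomb l u c i + lincomb l u d i)"
  by (simp add: lincomb_def distrib_right sum.distrib)

lemma lincomb_minus: "lincomb l u (\<lambda>i. - c i) = (\<lambda>i. - lincomb l u c i)"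
  by (simp add: lincomb_def sum_negf)

lemma lincomb_scale: "lincomb l u (\<lambda>i. r * c i) = (\<lambda>i. r * lincomb l u c i)"
  by (simp add: lincomb_def sum_distrib_left mult.assoc)

lemma nn_integral_lebV_meas:
  assumes "(\<lambda>p. f (fst p) (snd p)) \<in> borel_measurable (lebV n \<Otimes>\<^sub>M lebV n)"
  shows "(\<integral>\<^sup>+x. \<integral>\<^sup>+y. f x y \<partial>lebV n \<partial>lebV n) = (\<integral>\<^sup>+y. \<integral>\<^sup>+x. f x y \<partial>lebV n \<partial>lebV n)"
  using lebVV.Fubini'[of "\<lambda>x y. f x y" n n] assms by (simp add: case_prod_beta)

text \<open>Uniqueness of translation invariant measures: integrating $f(x)\,g(Ty)$ over $\mathbb{R}^n\times\mathbb{R}^n$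
  and shifting each variable by the other exchanges the roles of Lebesgue measure and its image
  under $T$.\<close>
lemma nn_integral_orthonormal:
  assumes v: "orthonormal n n v" and [measurable]: "f \<in> borel_measurable borel"
  shows "(\<integral>\<^sup>+c. f (lincomb n v c) \<partial>lebV n) = (\<integral>\<^sup>+x. f x \<partial>lebV n)"
proof -
  let ?T = "lincomb n v"
  \<comment> \<open>The indicator of the unit ball is invariant under T, and its integral is
    positive and finite, so it can be cancelled at the end.\<close>
  define g :: "vec \<Rightarrow> ennreal" where "g = indicator {x. ip n x x \<le> 1}"
  have [measurable]: "g \<in> borel_measurable borel" unfolding g_def by measurable
  have gT: "g (?T y) = g y" for y unfolding g_def by (simp add: indicator_def ip_lincomb_lincomb[OF v])
  have TR: "?T y \<in> Rn n" for y using lincomb_Rn orthonormalD(1)[OF v] by blast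
  define G where "G = (\<integral>\<^sup>+x. g x \<partial>lebV n)"
  have G0: "G \<noteq> 0" and Gtop: "G \<noteq> top"
  proof -
    have Ge: "G = emeasure (lebV n) {x. ip n x x \<le> 1}" unfolding G_def g_def by simp
    have "{x. ip n x x \<le> 1} \<subseteq> cube n 1"
    proof
      fix x assume x: "x \<in> {x. ip n x x \<le> 1}"
      have "\<bar>x i\<bar> \<le> 1" if "i < n" for i
      proof -
        have "x i * x i \<le> ip n x x" unfolding ip_def by (rule member_le_sum) (use that in auto)
        then have "(x i)^2 \<le> 1" using x by (simp add: power2_eq_square)
        then show ?thesis by (simp add: abs_square_le_1)
      qed
      then show "x \<in> cube n 1" by (simp add: cube_def)
    qed
    then have "G \<le> emeasure (lebV n) (cube n 1)" unfolding Ge by (rule emeasure_mono) simp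
    then show "G \<noteq> top" by (auto simp: emeasure_lebV_cube top_unique)
    \<comment> \<open>Chosen so that n r^2 \<le> n r \<le> 1, which puts the cube of half side r
      inside the unit ball.\<close>
    define r where "r = 1 / (real n + 1)"
    have r: "r > 0" "r \<le> 1" "real n * r \<le> 1" by (auto simp: r_def field_simps)
    have "cube n r \<subseteq> {x. ip n x x \<le> 1}"
    proof
      fix x assume x: "x \<in> cube n r"
      have "ip n x x \<le> (\<Sum>i<n. r * 1)" unfolding ip_def
      proof (rule sum_mono)
        fix i assume "i \<in> {..<n}"
        then have "\<bar>x i\<bar> \<le> r" using x by (simp add: cube_def)
        then have "\<bar>x i\<bar> * \<bar>x i\<bar> \<le> r * 1" using r by (intro mult_mono) auto
        then show "x i * x i \<le> r * 1" by (simp add: abs_mult[symmetric])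
      qed
      then show "x \<in> {x. ip n x x \<le> 1}" using r by simp
    qed
    then have "emeasure (lebV n) (cube n r) \<le> G" unfolding Ge by (rule emeasure_mono) simp
    moreover have "emeasure (lebV n) (cube n r) > 0" using r by (simp add: emeasure_lebV_cube)
    ultimately show "G \<noteq> 0" by auto
  qed
  note vec_add_measurable[measurable (raw)]
  have "(\<integral>\<^sup>+x. f x \<partial>lebV n) * G = (\<integral>\<^sup>+x. f x * (\<integral>\<^sup>+y. g (?T y) \<partial>lebV n) \<partial>lebV n)"
    unfolding G_def gT by (rule nn_integral_multc[symmetric]) simp
  also have "\<dots> = (\<integral>\<^sup>+x. \<integral>\<^sup>+y. f x * g (?T y) \<partial>lebV n \<partial>lebV n)"
    by (rule nn_integral_cong, rule nn_integral_cmult[symmetric]) simp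
  also have "\<dots> = (\<integral>\<^sup>+y. \<integral>\<^sup>+x. f x * g (?T y) \<partial>lebV n \<partial>lebV n)"
    by (rule nn_integral_lebV_meas) measurable
  also have "\<dots> = (\<integral>\<^sup>+y. \<integral>\<^sup>+x. f (\<lambda>i. ?T y i + x i) * g (?T y) \<partial>lebV n \<partial>lebV n)"
    by (rule nn_integral_cong, rule lebV_translate[OF _ TR, where f="\<lambda>x. f x * g (?T y)" for y, symmetric]) simp
  also have "\<dots> = (\<integral>\<^sup>+x. \<integral>\<^sup>+y. f (\<lambda>i. ?T y i + x i) * g (?T y) \<partial>lebV n \<partial>lebV n)"
    by (rule nn_integral_lebV_meas[symmetric]) measurable
  also have "\<dots> = (\<integral>\<^sup>+x. \<integral>\<^sup>+y. f (?T y) * g (\<lambda>i. ?T y i + (-1) * x i) \<partial>lebV n \<partial>lebV n)"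
  proof (rule nn_integral_cong_AE)
    show "AE x in lebV n. (\<integral>\<^sup>+y. f (\<lambda>i. ?T y i + x i) * g (?T y) \<partial>lebV n) = (\<integral>\<^sup>+y. f (?T y) * g (\<lambda>i. ?T y i + (-1) * x i) \<partial>lebV n)"
      using AE_lebV_Rn
    proof eventually_elim
      case (elim x)
      \<comment> \<open>The preimage of -x under T: translating y by it replaces T y by T y - x,
        which moves the shift from f to g.\<close>
      define x' where "x' j = (if j < n then - ip n x (v j) else 0)" for j
      have x'R: "x' \<in> Rn n" by (auto simp: x'_def Rn_def)
      have "?T x' = ?T (\<lambda>j. - ip n x (v j))" by (simp add: lincomb_def x'_def)
      then have Tx': "?T x' = (\<lambda>i. - x i)" using orthonormal_expand[OF v elim] by (simp add: lincomb_minus)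
      define h where "h y = f (\<lambda>i. ?T y i + x i) * g (?T y)" for y
      have [measurable]: "h \<in> borel_measurable borel" unfolding h_def by measurable
      have "(\<integral>\<^sup>+y. h y \<partial>lebV n) = (\<integral>\<^sup>+y. h (\<lambda>i. x' i + y i) \<partial>lebV n)"
        by (rule lebV_translate[OF _ x'R, symmetric]) simp
      also have "\<dots> = (\<integral>\<^sup>+y. f (?T y) * g (\<lambda>i. ?T y i + (-1) * x i) \<partial>lebV n)"
        by (rule nn_integral_cong) (simp add: h_def lincomb_add Tx')
      finally show ?case unfolding h_def .
    qed
  qed
  also have "\<dots> = (\<integral>\<^sup>+y. \<integral>\<^sup>+x. f (?T y) * g (\<lambda>i. ?T y i + (-1) * x i) \<partial>lebV n \<partial>lebV n)"
    by (rule nn_integral_lebV_meas) measurable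
  also have "\<dots> = (\<integral>\<^sup>+y. f (?T y) * G \<partial>lebV n)"
  proof (rule nn_integral_cong)
    fix y
    have "(\<integral>\<^sup>+x. f (?T y) * g (\<lambda>i. ?T y i + (-1) * x i) \<partial>lebV n) = f (?T y) * (\<integral>\<^sup>+x. g (\<lambda>i. ?T y i + (-1) * x i) \<partial>lebV n)"
      by (rule nn_integral_cmult) measurable
    also have "(\<integral>\<^sup>+x. g (\<lambda>i. ?T y i + (-1) * x i) \<partial>lebV n) = G"
      unfolding G_def using lebV_affine[OF _ TR, of g "-1" y] by simp
    finally show "(\<integral>\<^sup>+x. f (?T y) * g (\<lambda>i. ?T y i + (-1) * x i) \<partial>lebV n) = f (?T y) * G" .
  qed
  also have "\<dots> = (\<integral>\<^sup>+y. f (?T y) \<partial>lebV n) * G" by (rule nn_integral_multc) simp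
  finally have "G * (\<integral>\<^sup>+x. f x \<partial>lebV n) = G * (\<integral>\<^sup>+y. f (?T y) \<partial>lebV n)" by (simp add: mult.commute)
  then show ?thesis using G0 Gtop by (simp add: ennreal_mult_cancel_left)
qed

lemma lebV_orthonormal_distr:
  assumes v: "orthonormal n n v"
  shows "lebV n = distr (lebV n) borel (lincomb n v)"
proof (rule measure_eq_nn)
  fix f :: "vec \<Rightarrow> ennreal" assume [measurable]: "f \<in> borel_measurable borel"
  have "nn_integral (distr (lebV n) borel (lincomb n v)) f = (\<integral>\<^sup>+c. f (lincomb n v c) \<partial>lebV n)"
    by (rule nn_integral_distr) simp_all
  also have "\<dots> = nn_integral (lebV n) f" by (rule nn_integral_orthonormal[OF v]) simp
  finally show "nn_integral (lebV n) f = nn_integral (distr (lebV n) borel (lincomb n v)) f" ..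
qed auto

text \<open>\<open>measF\<close> refers to an unspecified orthonormal basis of F. Two such bases
  differ by an orthogonal l by l matrix, here q, and Lebesgue measure is invariant under it.\<close>

lemma emeasure_onb_indep:
  assumes u: "onb n l u F" and u': "onb n l u' F" and [measurable]: "A \<in> sets borel"
  shows "emeasure (lebV l) {c. lincomb l u c \<in> A} = emeasure (lebV l) {c. lincomb l u' c \<in> A}"
proof -
  have o: "orthonormal n l u" "orthonormal n l u'" using u u' unfolding onb_orthonormal by simp_all
  define q where "q j = (\<lambda>k. if k < l then ip n (u j) (u' k) else 0)" for j
  have uexp: "u j = lincomb l u' (q j)" if "j < l" for j
  proof -
    have "u j \<in> F" by (rule onb_basis_mem[OF u that])
    then obtain c where c: "u j = lincomb l u' c" using u' by (auto simp: onb_def)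
    have "c k = q j k" if "k < l" for k
      using ip_lincomb_coord[OF o(2) that, of c] that by (simp add: c[symmetric] q_def)
    then show ?thesis unfolding c by (simp add: lincomb_def)
  qed
  have q: "orthonormal l l q"
    unfolding orthonormal_def
  proof (intro conjI allI impI)
    fix i j assume "i < l" "j < l"
    then show "ip l (q i) (q j) = (if i = j then 1 else 0)"
      using ip_lincomb_lincomb[OF o(2), of "q i" "q j"] orthonormalD(2)[OF o(1)] by (simp add: uexp[symmetric])
  qed (auto simp: q_def Rn_def)
  have comp: "lincomb l u c = lincomb l u' (lincomb l q c)" for c
  proof
    fix a
    have "lincomb l u c a = (\<Sum>j<l. c j * lincomb l u' (q j) a)"
      unfolding lincomb_def[of l u] by (rule sum.cong) (use uexp in auto)
    also have "\<dots> = (\<Sum>j<l. \<Sum>k<l. c j * q j k * u' k a)" by (simp add: lincomb_def sum_distrib_left mult.assoc)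
    also have "\<dots> = (\<Sum>k<l. \<Sum>j<l. c j * q j k * u' k a)" by (rule sum.swap)
    also have "\<dots> = lincomb l u' (lincomb l q c) a" by (simp add: lincomb_def sum_distrib_right)
    finally show "lincomb l u c a = lincomb l u' (lincomb l q c) a" .
  qed
  have "emeasure (lebV l) {c. lincomb l u c \<in> A} = (\<integral>\<^sup>+c. indicator {c. lincomb l u c \<in> A} c \<partial>lebV l)" by simp
  also have "\<dots> = (\<integral>\<^sup>+c. indicator {c. lincomb l u' c \<in> A} (lincomb l q c) \<partial>lebV l)"
    by (rule nn_integral_cong) (simp add: comp indicator_def)
  also have "\<dots> = (\<integral>\<^sup>+c. indicator {c. lincomb l u' c \<in> A} c \<partial>lebV l)"
    by (rule nn_integral_orthonormal[OF q]) measurable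
  finally show ?thesis by simp
qed

section \<open>Volume in F and projection to F in coordinates\<close>

lemma measF_eq:
  assumes u: "onb n l u F" and [measurable]: "A \<in> sets borel"
  shows "measF n l F A = measure (lebV l) {c. lincomb l u c \<in> A}"
proof -
  have s: "onb n l (SOME u. onb n l u F) F" by (rule someI[of "\<lambda>u. onb n l u F", OF u])
  have "measF n l F A = measure (lebV l) {c. lincomb l (SOME u. onb n l u F) c \<in> A}"
    unfolding measF_def by (rule lebn_eq) measurable
  then show ?thesis unfolding measure_def emeasure_onb_indep[OF s u assms(2)] .
qed

lemma Proj_eq:
  assumes u: "onb n l u F"
  shows "Proj n F x = lincomb l u (\<lambda>j. ip n x (u j))"
proof -
  have o: "orthonormal n l u" and F: "F = {lincomb l u c | c. True}" using u unfolding onb_orthonormal by simp_all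
  show ?thesis unfolding Proj_def
  proof (rule the_equality)
    have "ip n (vdiff x (lincomb l u (\<lambda>j. ip n x (u j)))) (lincomb l u c) = 0" for c
      unfolding vdiff_def ip_diff_left ip_lincomb_lincomb[OF o] unfolding ip_lincomb_right by (simp add: ip_def mult.commute)
    then show "lincomb l u (\<lambda>j. ip n x (u j)) \<in> F \<and> (\<forall>w\<in>F. ip n (vdiff x (lincomb l u (\<lambda>j. ip n x (u j)))) w = 0)"
      unfolding F by auto
  next
    fix y assume y: "y \<in> F \<and> (\<forall>w\<in>F. ip n (vdiff x y) w = 0)"
    then obtain c where c: "y = lincomb l u c" unfolding F by blast
    have "c j = ip n x (u j)" if j: "j < l" for j
    proof -
      have "u j \<in> F" by (rule onb_basis_mem[OF u j])
      then have "ip n (vdiff x y) (u j) = 0" using y by blast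
      then show ?thesis unfolding vdiff_def ip_diff_left c ip_lincomb_coord[OF o j] by simp
    qed
    then show "y = lincomb l u (\<lambda>j. ip n x (u j))" unfolding c by (simp add: lincomb_def)
  qed
qed

lemma Proj_fixed:
  assumes u: "onb n l u F" and "x \<in> F" shows "Proj n F x = x"
proof -
  have o: "orthonormal n l u" and "F = {lincomb l u c | c. True}" using u unfolding onb_orthonormal by simp_all
  then obtain c where c: "x = lincomb l u c" using assms(2) by blast
  show ?thesis unfolding Proj_eq[OF u] c using ip_lincomb_coord[OF o] by (simp add: lincomb_def)
qed

lemma ip_zero_right: "ip m x (\<lambda>_. 0) = 0" by (simp add: ip_def)

section \<open>Exponential integrals over projections and sections\<close>

lemma sum_lessThan_add: "(\<Sum>i<m+(l::nat). f i) = (\<Sum>i<m. f i) + (\<Sum>i<l. f (m + i) :: real)"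
  by (induction l) auto

lemma ip_join: "ip (m + l) (join m a b) (join m c d) = ip m a c + ip l b d"
  unfolding ip_def sum_lessThan_add by (simp add: join_def)

lemma nice_indicator:
  assumes [measurable]: "K \<in> sets borel" and "K \<subseteq> cube n R" "R \<ge> 0"
  shows "nice n (indicator K)"
  unfolding nice_def
proof (intro conjI exI[of _ "max 1 R"] allI impI)
  fix x assume "(indicator K x :: real) \<noteq> 0"
  then have "x \<in> cube n R" using assms by (auto split: split_indicator_asm)
  then show "x \<in> cube n (max 1 R)" by (auto simp: cube_def intro: order_trans)
qed (use assms in \<open>auto split: split_indicator\<close>)

lemma join_cube: "join m a b \<in> cube (m + l) R \<longleftrightarrow> a \<in> cube m R \<and> b \<in> cube l R"
proof
  assume h: "join m a b \<in> cube (m + l) R"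
  show "a \<in> cube m R \<and> b \<in> cube l R" unfolding cube_def
  proof (intro conjI CollectI allI impI)
    fix i assume "i < m" then show "\<bar>a i\<bar> \<le> R" using h[unfolded cube_def, THEN CollectD, THEN spec, of i] by (simp add: join_def)
  next
    fix i assume "i < l" then show "\<bar>b i\<bar> \<le> R" using h[unfolded cube_def, THEN CollectD, THEN spec, of "m + i"] by (simp add: join_def)
  qed
next
  assume "a \<in> cube m R \<and> b \<in> cube l R"
  then show "join m a b \<in> cube (m + l) R" by (auto simp: cube_def join_def)
qed

text \<open>Let S be the supremum of the fibre volumes. The tilt by (\<theta>, 0) gives |K| \<le> S
  I with I the exponential integral over A, and Rogers-Shephard gives s^l (1-s)^m |A| S \<le> |K|.
  Both contain S, which is cancelled once it is known to be positive and finite.\<close>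

lemma tilt_projection:
  assumes K[measurable]: "K \<in> sets borel" and conv: "is_convex K" and bd: "K \<subseteq> cube (l + m) R" "R \<ge> 0"
    and pos: "emeasure (lebV (l + m)) K \<noteq> 0"
    and bary: "\<And>i. i < l + m \<Longrightarrow> (\<integral>x. indicator K x * x i \<partial>lebV (l + m)) = 0"
    and A[measurable]: "A \<in> sets borel" and A1: "\<And>y. y \<in> A \<Longrightarrow> \<exists>w\<in>Rn m. join l y w \<in> K" and A2: "\<And>y w. join l y w \<in> K \<Longrightarrow> y \<in> A"
    and s: "0 < s" "s < 1"
  shows "ennreal (s^l * (1-s)^m) * emeasure (lebV l) A \<le> (\<integral>\<^sup>+y. indicator A y * ennreal (exp (ip l y \<theta>)) \<partial>lebV l)"
proof -
  define fib where "fib y = emeasure (lebV m) {w. join l y w \<in> K}" for y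
  define S where "S = (SUP y\<in>Rn l. fib y)"
  define I where "I = (\<integral>\<^sup>+y. indicator A y * ennreal (exp (ip l y \<theta>)) \<partial>lebV l)"
  have Kjoin: "(\<integral>\<^sup>+w. indicator K (join l y w) \<partial>lebV m) = fib y" for y
  proof -
    have "(\<integral>\<^sup>+w. indicator K (join l y w) \<partial>lebV m) = (\<integral>\<^sup>+w. indicator {w. join l y w \<in> K} w \<partial>lebV m)"
      by (rule nn_integral_cong) (simp add: indicator_def)
    then show ?thesis by (simp add: fib_def)
  qed
  have ni: "nice (l + m) (indicator K)" by (rule nice_indicator[OF K bd])
  have "emeasure (lebV (l + m)) K = (\<integral>\<^sup>+x. ennreal (indicator K x) \<partial>lebV (l + m))"
    by (simp add: ennreal_indicator)
  also have "\<dots> \<le> (\<integral>\<^sup>+x. ennreal (indicator K x * exp (ip (l + m) x (join l \<theta> (\<lambda>_. 0)))) \<partial>lebV (l + m))"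
    by (rule exp_tilt_ge[OF ni]) (use bary in blast)
  also have "\<dots> = (\<integral>\<^sup>+y. \<integral>\<^sup>+w. ennreal (indicator K (join l y w) * exp (ip (l + m) (join l y w) (join l \<theta> (\<lambda>_. 0)))) \<partial>lebV m \<partial>lebV l)"
    by (rule nn_integral_lebV_join) measurable
  also have "\<dots> = (\<integral>\<^sup>+y. \<integral>\<^sup>+w. ennreal (exp (ip l y \<theta>)) * indicator K (join l y w) \<partial>lebV m \<partial>lebV l)"
  proof -
    have "ip (l + m) (join l y w) (join l \<theta> (\<lambda>_. 0)) = ip l y \<theta>" for y w by (simp add: ip_join ip_zero_right)
    then show ?thesis by (intro nn_integral_cong) (simp add: ennreal_mult ennreal_indicator mult.commute)
  qed
  also have "\<dots> = (\<integral>\<^sup>+y. ennreal (exp (ip l y \<theta>)) * fib y \<partial>lebV l)"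
    unfolding Kjoin[symmetric] by (rule nn_integral_cong, rule nn_integral_cmult) measurable
  also have "\<dots> \<le> (\<integral>\<^sup>+y. S * (indicator A y * ennreal (exp (ip l y \<theta>))) \<partial>lebV l)"
  proof (rule nn_integral_mono_AE)
    show "AE y in lebV l. ennreal (exp (ip l y \<theta>)) * fib y \<le> S * (indicator A y * ennreal (exp (ip l y \<theta>)))"
      using AE_lebV_Rn
    proof eventually_elim
      case (elim y)
      show ?case
      proof (cases "y \<in> A")
        case True
        have "fib y \<le> S" unfolding S_def by (rule SUP_upper[OF elim])
        then show ?thesis using True by (simp add: mult.commute mult_right_mono)
      next
        case False
        then have "{w. join l y w \<in> K} = {}" using A2 by blast
        then show ?thesis by (simp add: fib_def)
      qed
    qed
  qed
  also have "\<dots> = S * I" unfolding I_def by (rule nn_integral_cmult) simp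
  finally have up: "emeasure (lebV (l + m)) K \<le> S * I" .
  \<comment> \<open>S need not be attained, so Rogers-Shephard is applied to every fibre and the
    supremum is taken afterwards.\<close>
  have "ennreal (s^l * (1-s)^m) * emeasure (lebV l) A * S = (SUP y\<in>Rn l. ennreal (s^l * (1-s)^m) * emeasure (lebV l) A * fib y)"
    unfolding S_def by (simp add: SUP_mult_left_ennreal)
  also have "\<dots> \<le> emeasure (lebV (l + m)) K"
  proof (rule SUP_least)
    fix y assume y: "y \<in> Rn l"
    show "ennreal (s^l * (1-s)^m) * emeasure (lebV l) A * fib y \<le> emeasure (lebV (l + m)) K"
      using rogers_shephard[OF K conv A A1 y s] by (simp add: fib_def mult.assoc)
  qed
  finally have "S * (ennreal (s^l * (1-s)^m) * emeasure (lebV l) A) \<le> S * I" using up by (simp add: mult.commute)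
  moreover have "S \<noteq> 0" using up pos by auto
  moreover have "S \<noteq> top"
  proof -
    have "S \<le> ennreal ((2*R)^m)" unfolding S_def
    proof (rule SUP_least)
      fix y
      have "{w. join l y w \<in> K} \<subseteq> cube m R" using bd join_cube by blast
      then have "fib y \<le> emeasure (lebV m) (cube m R)" unfolding fib_def by (rule emeasure_mono) simp
      then show "fib y \<le> ennreal ((2*R)^m)" using bd(2) by (simp add: emeasure_lebV_cube)
    qed
    then show ?thesis by (auto simp: top_unique)
  qed
  ultimately show ?thesis unfolding I_def[symmetric] by (simp add: ennreal_mult_le_mult_iff)
qed

lemma nice_tilt:
  assumes f: "nice n f"
  shows "nice n (\<lambda>x. f x * exp (ip n x \<theta>))"
proof -
  obtain R where R: "R \<ge> 0" "\<And>x. 0 \<le> f x \<and> f x \<le> R \<and> (f x \<noteq> 0 \<longrightarrow> x \<in> cube n R)"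
    and [measurable]: "f \<in> borel_measurable borel" using f by (auto simp: nice_def)
  define B where "B = exp (\<Sum>i<n. R * \<bar>\<theta> i\<bar>)"
  have B: "B \<ge> 1" unfolding B_def using R(1) by (auto intro!: sum_nonneg)
  show ?thesis unfolding nice_def
  proof (intro conjI exI[of _ "R * B"] allI impI)
    fix x
    show "f x * exp (ip n x \<theta>) \<le> R * B"
    proof (cases "f x = 0")
      case False
      then have "x \<in> cube n R" using R(2) by blast
      then have "ip n x \<theta> \<le> (\<Sum>i<n. R * \<bar>\<theta> i\<bar>)" using cube_ip_bound[of x n R \<theta>] by linarith
      then have "exp (ip n x \<theta>) \<le> B" unfolding B_def by simp
      then show ?thesis using R(2)[of x] R(1) by (intro mult_mono) auto
    qed (use R B in auto)
    assume "f x * exp (ip n x \<theta>) \<noteq> 0"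
    then have "x \<in> cube n R" using R(2) by auto
    moreover have "R \<le> R * B" using R(1) B by (simp add: mult_le_cancel_left1)
    ultimately show "x \<in> cube n (R * B)" by (auto simp: cube_def intro: order_trans)
  qed (use R B in auto)
qed

lemma logconc_tilt:
  assumes "is_convex K"
  shows "logconc n (\<lambda>x. indicator K x * exp (ip n x \<theta>))"
  unfolding logconc_def
proof (intro ballI allI impI, elim conjE)
  fix x y :: vec and t :: real assume t: "0 < t" "t < 1"
  define z where "z = (\<lambda>i. (1-t) * x i + t * y i)"
  show "(indicator K x * exp (ip n x \<theta>)) powr (1-t) * (indicator K y * exp (ip n y \<theta>)) powr t \<le> indicator K (\<lambda>i. (1-t) * x i + t * y i) * exp (ip n (\<lambda>i. (1-t) * x i + t * y i) \<theta>)"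
  proof (cases "x \<in> K \<and> y \<in> K")
    case True
    then have "z \<in> K" using assms t unfolding is_convex_def z_def by auto
    moreover have "ip n z \<theta> = (1-t) * ip n x \<theta> + t * ip n y \<theta>"
      by (simp add: z_def ip_def distrib_right sum.distrib sum_distrib_left mult.assoc)
    ultimately show ?thesis using True unfolding z_def by (simp add: powr_def exp_add[symmetric])
  qed auto
qed

text \<open>The tilted fibre mass \<psi> has \<psi>(0) equal to the exponential integral over the
  section. With \<psi>(w) e^(<w,\<eta>>) \<le> \<psi>(0), the joint tilt (\<eta>, \<theta>) gives
  |K| \<le> |P| \<psi>(0) for the set P where \<psi> is positive; Rogers-Shephard for P and the
  central section has |P| on the other side, and it cancels.\<close>

lemma tilt_section:
  assumes K[measurable]: "K \<in> sets borel" and conv: "is_convex K" and bd: "K \<subseteq> cube (m + l) R" "R \<ge> 0"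
    and bary: "\<And>i. i < m + l \<Longrightarrow> (\<integral>x. indicator K x * x i \<partial>lebV (m + l)) = 0"
    and nbh: "cube (m + l) \<delta> \<subseteq> K" "\<delta> > 0"
    and s: "0 < s" "s < 1"
  shows "ennreal (s^m * (1-s)^l) * emeasure (lebV l) {c. join m (\<lambda>_. 0) c \<in> K} \<le> (\<integral>\<^sup>+c. indicator {c. join m (\<lambda>_. 0) c \<in> K} c * ennreal (exp (ip l c \<theta>)) \<partial>lebV l)"
proof -
  define f where "f x = indicator K x * exp (ip (m + l) x (join m (\<lambda>_. 0) \<theta>))" for x
  have ni: "nice (m + l) (indicator K)" by (rule nice_indicator[OF K bd])
  have nf: "nice (m + l) f" unfolding f_def by (rule nice_tilt[OF ni])
  have lf: "logconc (m + l) f" unfolding f_def by (rule logconc_tilt[OF conv])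
  obtain \<psi> where \<psi>: "nice m \<psi>" "logconc m \<psi>" "\<And>x. ennreal (\<psi> x) = (\<integral>\<^sup>+w. ennreal (f (join m x w)) \<partial>lebV l)"
    using prekopa_marginal[OF nf lf] by blast
  have [measurable]: "f \<in> borel_measurable borel" using nf by (simp add: nice_def)
  have [measurable]: "\<psi> \<in> borel_measurable borel" and \<psi>nn: "\<And>x. \<psi> x \<ge> 0" using \<psi>(1) by (auto simp: nice_def)
  have fj: "f (join m x w) = indicator K (join m x w) * exp (ip l w \<theta>)" for x w
    unfolding f_def by (simp add: ip_join ip_zero_right)
  have \<psi>pos: "\<psi> w > 0" if w: "w \<in> cube m \<delta>" for w
  proof -
    define B where "B = (\<Sum>i<l. \<delta> * \<bar>\<theta> i\<bar>)"
    have "ennreal (exp (-B)) * ennreal ((2*\<delta>)^l) = (\<integral>\<^sup>+c. ennreal (exp (-B)) * indicator (cube l \<delta>) c \<partial>lebV l)"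
      using nbh(2) by (simp add: nn_integral_cmult emeasure_lebV_cube)
    also have "\<dots> \<le> (\<integral>\<^sup>+c. ennreal (f (join m w c)) \<partial>lebV l)"
    proof (rule nn_integral_mono)
      fix c
      show "ennreal (exp (-B)) * indicator (cube l \<delta>) c \<le> ennreal (f (join m w c))"
      proof (cases "c \<in> cube l \<delta>")
        case True
        then have "join m w c \<in> K" using w nbh join_cube by blast
        moreover have "- B \<le> ip l c \<theta>" using cube_ip_bound[OF True, of \<theta>] unfolding B_def by linarith
        ultimately show ?thesis using True by (simp add: fj ennreal_leI)
      qed simp
    qed
    finally have "ennreal (exp (-B)) * ennreal ((2*\<delta>)^l) \<le> ennreal (\<psi> w)" unfolding \<psi>(3) .
    moreover have "ennreal (exp (-B)) * ennreal ((2*\<delta>)^l) > 0" using nbh(2) by (simp add: ennreal_zero_less_mult_iff)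
    ultimately have "ennreal (\<psi> w) > 0" by (metis order_less_le_trans)
    then show ?thesis by simp
  qed
  have c0: "(\<lambda>_. 0) \<in> cube m \<delta>" using nbh(2) by (simp add: cube_def)
  have "\<exists>\<eta>\<in>Rn m. \<forall>w\<in>Rn m. \<psi> w * exp (ip m w \<eta>) \<le> \<psi> (\<lambda>_. 0)"
  proof (rule logconc_supergradient[OF \<psi>(2) \<psi>nn \<psi>pos[OF c0]])
    fix i
    have "(\<lambda>_. 0)(i := \<delta>) \<in> cube m \<delta>" "(\<lambda>_. 0)(i := -\<delta>) \<in> cube m \<delta>" using nbh(2) by (auto simp: cube_def)
    then show "\<exists>\<delta>>0. \<psi> ((\<lambda>_. 0)(i := \<delta>)) > 0 \<and> \<psi> ((\<lambda>_. 0)(i := -\<delta>)) > 0" using \<psi>pos nbh(2) by blast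
  qed
  then obtain \<eta> where \<eta>: "\<eta> \<in> Rn m" "\<And>w. w \<in> Rn m \<Longrightarrow> \<psi> w * exp (ip m w \<eta>) \<le> \<psi> (\<lambda>_. 0)" by blast
  \<comment> \<open>A Borel subset of the projection of K that carries all the mass of
    \<psi>.\<close>
  define P where "P = {w. \<psi> w > 0}"
  have [measurable]: "P \<in> sets borel" unfolding P_def by measurable
  have P1: "\<exists>c\<in>Rn l. join m w c \<in> K" if "w \<in> P" for w
  proof (rule ccontr)
    assume n: "\<not> ?thesis"
    have "(\<integral>\<^sup>+c. ennreal (f (join m w c)) \<partial>lebV l) = (\<integral>\<^sup>+c. 0 \<partial>lebV l)"
    proof (rule nn_integral_cong_AE)
      show "AE c in lebV l. ennreal (f (join m w c)) = 0" using AE_lebV_Rn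
        by eventually_elim (use n in \<open>auto simp: fj\<close>)
    qed
    then have "\<psi> w \<le> 0" using \<psi>(3)[of w] \<psi>nn[of w] by simp
    then show False using that by (simp add: P_def)
  qed
  have "emeasure (lebV (m + l)) K = (\<integral>\<^sup>+x. ennreal (indicator K x) \<partial>lebV (m + l))"
    by (simp add: ennreal_indicator)
  also have "\<dots> \<le> (\<integral>\<^sup>+x. ennreal (indicator K x * exp (ip (m + l) x (join m \<eta> \<theta>))) \<partial>lebV (m + l))"
    by (rule exp_tilt_ge[OF ni]) (use bary in blast)
  also have "\<dots> = (\<integral>\<^sup>+w. \<integral>\<^sup>+c. ennreal (indicator K (join m w c) * exp (ip (m + l) (join m w c) (join m \<eta> \<theta>))) \<partial>lebV l \<partial>lebV m)"
    by (rule nn_integral_lebV_join) measurable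
  also have "\<dots> = (\<integral>\<^sup>+w. \<integral>\<^sup>+c. ennreal (exp (ip m w \<eta>)) * ennreal (f (join m w c)) \<partial>lebV l \<partial>lebV m)"
    by (intro nn_integral_cong) (simp add: fj ip_join exp_add ennreal_mult ennreal_indicator mult_ac)
  also have "\<dots> = (\<integral>\<^sup>+w. ennreal (exp (ip m w \<eta>)) * ennreal (\<psi> w) \<partial>lebV m)"
    unfolding \<psi>(3) by (rule nn_integral_cong, rule nn_integral_cmult) measurable
  also have "\<dots> \<le> (\<integral>\<^sup>+w. ennreal (\<psi> (\<lambda>_. 0)) * indicator P w \<partial>lebV m)"
  proof (rule nn_integral_mono_AE)
    show "AE w in lebV m. ennreal (exp (ip m w \<eta>)) * ennreal (\<psi> w) \<le> ennreal (\<psi> (\<lambda>_. 0)) * indicator P w"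
      using AE_lebV_Rn
    proof eventually_elim
      case (elim w)
      show ?case
      proof (cases "w \<in> P")
        case True
        then show ?thesis using \<eta>(2)[OF elim] \<psi>nn by (simp add: ennreal_mult[symmetric] mult.commute ennreal_leI)
      next
        case False
        then have "\<psi> w = 0" using \<psi>nn[of w] by (simp add: P_def)
        then show ?thesis by simp
      qed
    qed
  qed
  also have "\<dots> = emeasure (lebV m) P * ennreal (\<psi> (\<lambda>_. 0))" by (subst nn_integral_cmult_indicator) (auto simp: mult.commute)
  finally have up: "emeasure (lebV (m + l)) K \<le> emeasure (lebV m) P * ennreal (\<psi> (\<lambda>_. 0))" .
  have "(\<lambda>_. 0) \<in> Rn m" by (simp add: Rn_def)
  from rogers_shephard[OF K conv _ P1 this s]
  have "ennreal (s^m * (1-s)^l) * (emeasure (lebV m) P * emeasure (lebV l) {c. join m (\<lambda>_. 0) c \<in> K}) \<le> emeasure (lebV m) P * ennreal (\<psi> (\<lambda>_. 0))"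
    using up by (meson order_trans \<open>P \<in> sets borel\<close>)
  then have "emeasure (lebV m) P * (ennreal (s^m * (1-s)^l) * emeasure (lebV l) {c. join m (\<lambda>_. 0) c \<in> K}) \<le> emeasure (lebV m) P * ennreal (\<psi> (\<lambda>_. 0))"
    by (simp add: mult_ac)
  moreover have "emeasure (lebV m) P \<noteq> 0"
  proof -
    have "cube m \<delta> \<subseteq> P" using \<psi>pos by (auto simp: P_def)
    then have "emeasure (lebV m) (cube m \<delta>) \<le> emeasure (lebV m) P" by (rule emeasure_mono) simp
    moreover have "emeasure (lebV m) (cube m \<delta>) > 0" using nbh(2) by (simp add: emeasure_lebV_cube)
    ultimately show ?thesis by auto
  qed
  moreover have "emeasure (lebV m) P \<noteq> top"
  proof -
    have "P \<subseteq> cube m R" using P1 bd join_cube by blast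
    then have "emeasure (lebV m) P \<le> emeasure (lebV m) (cube m R)" by (rule emeasure_mono) simp
    then show ?thesis using bd(2) by (auto simp: emeasure_lebV_cube top_unique)
  qed
  ultimately have "ennreal (s^m * (1-s)^l) * emeasure (lebV l) {c. join m (\<lambda>_. 0) c \<in> K} \<le> ennreal (\<psi> (\<lambda>_. 0))"
    by (simp add: ennreal_mult_le_mult_iff)
  also have "\<dots> = (\<integral>\<^sup>+c. indicator {c. join m (\<lambda>_. 0) c \<in> K} c * ennreal (exp (ip l c \<theta>)) \<partial>lebV l)"
    unfolding \<psi>(3) by (rule nn_integral_cong) (auto simp: fj split: split_indicator)
  finally show ?thesis .
qed

section \<open>Volumes of projections and polar sections\<close>

text \<open>Compares the volume of the ball with 1 / l!. The recursion of Gamma advances l / 2 by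
  one, so the induction goes in steps of two from l = 0 and l = 1, where Gamma(3/2)^2 = pi /
  4.\<close>

lemma Gamma_half_sq_bounds:
  "(Gamma (real l / 2 + 1))^2 \<le> fact l \<and> fact l \<le> 4^l * (Gamma (real l / 2 + 1))^2"
proof (induction l rule: induct_nat_012)
  case 0
  then show ?case by (simp add: Gamma_1)
next
  case 1
  have "Gamma (1/2 + 1 :: real) = (1/2) * Gamma (1/2)" by (rule Gamma_plus1) (auto dest: nonpos_Ints_nonpos)
  then have "(Gamma (1/2 + 1 :: real))^2 = (1/2)^2 * (sqrt pi)^2"
    by (simp only: Gamma_one_half_real power_mult_distrib)
  then have G: "(Gamma (1/2 + 1 :: real))^2 = pi / 4" by (simp add: power2_eq_square)
  have "real 1 / 2 + 1 = 1/2 + 1" by simp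
  then show ?case using G pi_gt3 pi_less_4 by simp
next
  case (ge2 l)
  have "Gamma ((real l / 2 + 1) + 1) = (real l / 2 + 1) * Gamma (real l / 2 + 1)"
    by (rule Gamma_plus1) (auto dest: nonpos_Ints_nonpos)
  moreover have "(real l / 2 + 1) + 1 = real (Suc (Suc l)) / 2 + 1" by (simp add: field_simps)
  ultimately have "(Gamma (real (Suc (Suc l)) / 2 + 1))^2 = (real l / 2 + 1)^2 * (Gamma (real l / 2 + 1))^2"
    by (simp only: power_mult_distrib)
  moreover have "(real l / 2 + 1)^2 = (real l + 2)^2 / 4" by (simp add: power2_eq_square field_simps)
  ultimately have G: "(Gamma (real (Suc (Suc l)) / 2 + 1))^2 = ((real l + 2)^2 / 4) * (Gamma (real l / 2 + 1))^2"
    by (simp only:)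
  have f: "fact (Suc (Suc l)) = ((real l + 2) * (real l + 1)) * fact l" by (simp add: algebra_simps)
  let ?G = "(Gamma (real l / 2 + 1))^2"
  have a: "(real l + 2)^2 / 4 \<le> (real l + 2) * (real l + 1)"
    by (simp add: power2_eq_square algebra_simps)
  have b: "(real l + 2) * (real l + 1) \<le> 4 * (real l + 2)^2"
    by (simp add: power2_eq_square algebra_simps)
  have "((real l + 2)^2 / 4) * ?G \<le> ((real l + 2) * (real l + 1)) * fact l"
    using ge2(1) by (intro mult_mono[OF a]) auto
  moreover have "((real l + 2) * (real l + 1)) * fact l \<le> (4 * (real l + 2)^2) * (4^l * ?G)"
    using ge2(1) by (intro mult_mono[OF b]) auto
  ultimately show ?case unfolding G f by (simp add: field_simps)
qed

lemma unit_ball_vol_sq: "(unit_ball_vol (real l))^2 = pi^l / (Gamma (real l / 2 + 1))^2"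
proof -
  have "(pi powr (real l / 2))^2 = pi powr (real l)" by (simp add: powr_power)
  then show ?thesis by (simp add: unit_ball_vol_def power_divide powr_realpow)
qed

lemma root_ball_bound:
  assumes "1 \<le> l" "0 \<le> c"
  shows "(c^l * (unit_ball_vol (real l))^2) powr (1 / real l) = c * unit_ball_vol (real l) powr (2 / real l)"
proof -
  have V: "unit_ball_vol (real l) > 0" by simp
  have "(c^l) powr (1 / real l) = c"
  proof (cases "c = 0")
    case False
    then have "c^l = c powr real l" using assms by (simp add: powr_realpow)
    then show ?thesis using assms by (simp add: powr_powr)
  qed (use assms in simp)
  moreover have "((unit_ball_vol (real l))^2) powr (1 / real l) = unit_ball_vol (real l) powr (2 / real l)"
  proof -
    have "(unit_ball_vol (real l))^2 = unit_ball_vol (real l) powr 2" using V by simp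
    then show ?thesis by (simp only: powr_powr) simp
  qed
  ultimately show ?thesis using assms V by (simp add: powr_mult)
qed

text \<open>The factor s^l is kept as n/l, the factor (1-s)^(n-l) costs at most 3^l, and l! is
  traded for the ball by l! |B_2^l|^2 \<ge> 1. Hence 48 = 3 * 16.\<close>

lemma volume_product_root_le:
  assumes l: "1 \<le> l" "l < n" and X: "0 \<le> X"
    and le: "((real l / real n)^l * (1 - real l / real n)^(n - l)) * fact l * X \<le> 16^l"
  shows "X powr (1 / real l) \<le> 48 * (real n / real l) * unit_ball_vol (real l) powr (2 / real l)"
proof -
  define s where "s = real l / real n"
  have s: "0 < s" "s < 1" using l by (auto simp: s_def)
  define m where "m = n - l"
  have m: "m > 0" "real n = real l + real m" using l by (auto simp: m_def)
  \<comment> \<open>With m = n - l this is (1 + l/m)^m \<le> e^l after taking the m-th power, so the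
    loss is exponential in l and not in n.\<close>
  have "1 / (1 - s) = 1 + real l / real m" using m l by (simp add: s_def field_simps)
  then have "(1 / (1 - s))^m \<le> exp (real l)" using exp_ge_one_plus_x_over_n_power_n[of m "real l"] m by simp
  also have "exp (real l) = exp 1 ^ l" by (simp add: exp_of_nat_mult[symmetric])
  also have "\<dots> \<le> 3 ^ l" by (intro power_mono exp_le) simp
  finally have sm: "1 \<le> 3^l * (1 - s)^m" using s by (simp add: power_divide field_simps)
  have "s^l * X * fact l \<le> s^l * X * fact l * (3^l * (1 - s)^m)"
    using mult_left_mono[OF sm, of "s^l * X * fact l"] s X by simp
  also have "\<dots> = 3^l * (((s^l * (1-s)^m)) * fact l * X)" by simp
  also have "\<dots> \<le> 3^l * 16^l" using le unfolding s_def m_def by (intro mult_left_mono) auto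
  also have "\<dots> = 48^l" by (simp add: power_mult_distrib[symmetric])
  finally have "X * fact l \<le> 48^l * (1/s)^l" using s by (simp add: power_divide field_simps)
  also have "\<dots> = (48 * (real n / real l))^l" using l by (simp add: s_def power_mult_distrib[symmetric])
  finally have 1: "X * fact l \<le> (48 * (real n / real l))^l" .
  let ?G = "(Gamma (real l / 2 + 1))^2"
  have G: "?G > 0" "?G \<le> fact l" using Gamma_half_sq_bounds[of l] by (auto simp: Gamma_real_pos less_imp_neq[symmetric])
  have "1 \<le> pi^l" using pi_gt3 by (intro one_le_power) simp
  then have "fact l * (unit_ball_vol (real l))^2 \<ge> 1"
    unfolding unit_ball_vol_sq using G by (simp add: field_simps) (smt (verit) mult_le_cancel_left1 fact_ge_zero)
  then have "X \<le> X * (fact l * (unit_ball_vol (real l))^2)" using X by (simp add: mult_le_cancel_left1)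
  also have "\<dots> \<le> (48 * (real n / real l))^l * (unit_ball_vol (real l))^2"
    using mult_right_mono[OF 1, of "(unit_ball_vol (real l))^2"] by (simp add: mult.assoc)
  finally have "X powr (1 / real l) \<le> ((48 * (real n / real l))^l * (unit_ball_vol (real l))^2) powr (1 / real l)"
    using X by (intro powr_mono2) auto
  then show ?thesis using l by (simp add: root_ball_bound)
qed

text \<open>Here |B_2^l|^2 \<le> 16^l / l! and l! \<le> l^l. One factor 16 comes from the ball and
  one from the hypothesis, hence 256 = 16 * 16.\<close>

lemma volume_product_root_ge:
  assumes l: "1 \<le> l" "l < n" and X: "real n ^ l / (16^l * (fact l)^2) \<le> X"
  shows "X powr (1 / real l) \<ge> (1/256) * (real n / real l) * unit_ball_vol (real l) powr (2 / real l)"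
proof -
  let ?G = "(Gamma (real l / 2 + 1))^2"
  have G: "?G > 0" "fact l \<le> 4^l * ?G" using Gamma_half_sq_bounds[of l] by (auto simp: Gamma_real_pos less_imp_neq[symmetric])
  have V: "(unit_ball_vol (real l))^2 \<le> 16^l / fact l"
  proof -
    have "pi^l * fact l \<le> 4^l * (4^l * ?G)" using G(2) pi_less_4 by (intro mult_mono power_mono) auto
    then have "pi^l * fact l \<le> 16^l * ?G" by (simp add: mult.assoc[symmetric] power_mult_distrib[symmetric])
    then show ?thesis unfolding unit_ball_vol_sq using G(1) by (simp add: field_simps)
  qed
  have fl: "fact l \<le> real l ^ l" using fact_le_power[where 'a=real, of l] by simp
  have "((1/256) * (real n / real l))^l * (unit_ball_vol (real l))^2 \<le> ((1/256) * (real n / real l))^l * (16^l / fact l)"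
    using V by (intro mult_left_mono) auto
  also have "\<dots> = real n ^ l / (16^l * fact l * real l ^ l)"
  proof -
    have "((1/256) * (real n / real l))^l = real n ^ l / ((16*16)^l * real l ^ l)" by (simp add: power_divide power_mult_distrib)
    then show ?thesis by (simp only: power_mult_distrib) (simp add: field_simps)
  qed
  also have "\<dots> \<le> real n ^ l / (16^l * fact l * fact l)"
    using fl l by (intro divide_left_mono mult_left_mono) (auto intro!: mult_pos_pos)
  also have "\<dots> \<le> X" using X by (simp add: power2_eq_square mult.assoc)
  finally have "(((1/256) * (real n / real l))^l * (unit_ball_vol (real l))^2) powr (1 / real l) \<le> X powr (1 / real l)"
    by (intro powr_mono2) auto
  then show ?thesis using l by (simp add: root_ball_bound)
qed

section \<open>Bounds, interior points and barycentres of convex bodies in coordinates\<close>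

lemma compact_vec_borel: "compact (K :: vec set) \<Longrightarrow> K \<in> sets borel"
  by (intro borel_closed compact_imp_closed)

lemma compact_vec_bounded:
  assumes "compact (K :: vec set)"
  obtains R where "R > 0" "\<And>x i. x \<in> K \<Longrightarrow> i < n \<Longrightarrow> \<bar>x i\<bar> \<le> R"
proof -
  have "continuous_on K (\<lambda>x. \<Sum>i<n. \<bar>x i\<bar>)"
    by (intro continuous_intros continuous_on_subset[OF continuous_on_product_coordinates]) auto
  then have "bounded ((\<lambda>x. \<Sum>i<n. \<bar>x i\<bar>) ` K)" using assms compact_continuous_image compact_imp_bounded by blast
  then obtain B where B: "\<And>x. x \<in> K \<Longrightarrow> \<bar>\<Sum>i<n. \<bar>x i\<bar>\<bar> \<le> B" unfolding bounded_iff by auto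
  show ?thesis
  proof (rule that[of "max 1 B"])
    fix x i assume "x \<in> K" "i < n"
    then show "\<bar>x i\<bar> \<le> max 1 B" using B[of x] sum_le_bound[of i n x] by linarith
  qed simp
qed

lemma in_interior_cube:
  assumes "in_interior n K x"
  obtains \<delta> where "\<delta> > 0" "\<And>y. y \<in> Rn n \<Longrightarrow> (\<And>i. i < n \<Longrightarrow> \<bar>y i - x i\<bar> \<le> \<delta>) \<Longrightarrow> y \<in> K"
proof -
  obtain r where r: "r > 0" "\<And>y. y \<in> Rn n \<Longrightarrow> ip n (vdiff y x) (vdiff y x) < r^2 \<Longrightarrow> y \<in> K"
    using assms by (auto simp: in_interior_def)
  \<comment> \<open>A cube of half side \<delta> has points at squared distance up to n \<delta>^2,
    which is below r^2 since n < (n+1)^2.\<close>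
  define \<delta> where "\<delta> = r / (real n + 1)"
  have \<delta>: "\<delta> > 0" using r by (simp add: \<delta>_def)
  show ?thesis
  proof (rule that[OF \<delta>])
    fix y assume y: "y \<in> Rn n" "\<And>i. i < n \<Longrightarrow> \<bar>y i - x i\<bar> \<le> \<delta>"
    have "ip n (vdiff y x) (vdiff y x) \<le> (\<Sum>i<n. \<delta>^2)" unfolding ip_def vdiff_def
    proof (rule sum_mono)
      fix i assume "i \<in> {..<n}"
      then have "\<bar>y i - x i\<bar>^2 \<le> \<delta>^2" using y(2) by (intro power_mono) auto
      then show "(y i - x i) * (y i - x i) \<le> \<delta>^2" by (simp add: power2_eq_square)
    qed
    also have "\<dots> = real n * \<delta>^2" by simp
    also have "\<dots> < (real n + 1)^2 * \<delta>^2"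
    proof -
      have "real n < (real n + 1)^2" by (simp add: power2_eq_square algebra_simps add_pos_nonneg)
      then show ?thesis using \<delta> by (intro mult_strict_right_mono) auto
    qed
    also have "\<dots> = r^2" by (simp add: \<delta>_def power_divide)
    finally show "y \<in> K" using r(2) y(1) by blast
  qed
qed

lemma interior_emeasure_pos:
  assumes "in_interior n K x" and [measurable]: "K \<in> sets borel"
  shows "emeasure (lebV n) K \<noteq> 0"
proof -
  obtain \<delta> where \<delta>: "\<delta> > 0" "\<And>y. y \<in> Rn n \<Longrightarrow> (\<And>i. i < n \<Longrightarrow> \<bar>y i - x i\<bar> \<le> \<delta>) \<Longrightarrow> y \<in> K"
    using in_interior_cube[OF assms(1)] by blast
  have xR: "x \<in> Rn n" using assms(1) by (simp add: in_interior_def)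
  have "ennreal ((2*\<delta>)^n) = (\<integral>\<^sup>+y. indicator (cube n \<delta>) y \<partial>lebV n)" using \<delta> by (simp add: emeasure_lebV_cube)
  also have "\<dots> \<le> (\<integral>\<^sup>+y. indicator K (\<lambda>i. x i + y i) \<partial>lebV n)"
  proof (rule nn_integral_mono_AE)
    show "AE y in lebV n. (indicator (cube n \<delta>) y :: ennreal) \<le> indicator K (\<lambda>i. x i + y i)" using AE_lebV_Rn
    proof eventually_elim
      case (elim y)
      have "(\<lambda>i. x i + y i) \<in> K" if "y \<in> cube n \<delta>"
        by (rule \<delta>(2)[OF Rn_add[OF xR elim]]) (use that in \<open>simp add: cube_def\<close>)
      then show ?case by (auto split: split_indicator)
    qed
  qed
  also have "\<dots> = (\<integral>\<^sup>+y. indicator K y \<partial>lebV n)" by (rule lebV_translate[OF _ xR]) simp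
  finally show ?thesis using \<delta>(1) by auto
qed

lemma lebV_cube_finite: "K \<subseteq> cube n R \<Longrightarrow> R \<ge> 0 \<Longrightarrow> K \<in> sets borel \<Longrightarrow> emeasure (lebV n) K < top"
  using emeasure_mono[of K "cube n R" "lebV n"] by (auto simp: emeasure_lebV_cube less_top[symmetric] top_unique)

lemma barycentre_zero_iff:
  assumes K[measurable]: "K \<in> sets borel" and pos: "lebn n K \<noteq> 0"
  shows "barycentre n K = zvec \<longleftrightarrow> (\<forall>i<n. (\<integral>x. indicator K x * x i \<partial>lebV n) = 0)"
proof -
  have "(\<integral>y. indicator (lebset n K) y * y i \<partial>lebM n) = (\<integral>x. indicator K x * x i \<partial>lebV n)" if i: "i < n" for i
  proof -
    have "(\<integral>x. indicator K x * x i \<partial>lebV n) = (\<integral>y. indicator K (ext0 n y) * ext0 n y i \<partial>lebM n)"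
      unfolding lebV_def by (rule integral_distr) auto
    also have "\<dots> = (\<integral>y. indicator (lebset n K) y * y i \<partial>lebM n)"
      by (rule Bochner_Integration.integral_cong) (use i in \<open>auto simp: lebset_def ext0_def split: split_indicator\<close>)
    finally show ?thesis ..
  qed
  then show ?thesis using pos by (auto simp: barycentre_def zvec_def fun_eq_iff)
qed

lemma is_convex_lincomb:
  assumes "is_convex K" shows "is_convex {c. lincomb n v c \<in> K}"
  unfolding is_convex_def
proof (intro ballI allI impI)
  fix x y and t :: real assume "x \<in> {c. lincomb n v c \<in> K}" "y \<in> {c. lincomb n v c \<in> K}" "0 \<le> t \<and> t \<le> 1"
  then have "(\<lambda>i. (1-t) * lincomb n v x i + t * lincomb n v y i) \<in> K" using assms by (auto simp: is_convex_def)
  moreover have "lincomb n v (\<lambda>i. (1-t) * x i + t * y i) = (\<lambda>i. (1-t) * lincomb n v x i + t * lincomb n v y i)"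
    by (simp add: lincomb_add lincomb_scale)
  ultimately show "(\<lambda>i. (1-t) * x i + t * y i) \<in> {c. lincomb n v c \<in> K}" by simp
qed

lemma orthonormal_coord_bound:
  assumes v: "orthonormal n k v" and j: "j < k" and i: "i < n"
  shows "\<bar>v j i\<bar> \<le> 1"
proof -
  have "v j i * v j i \<le> ip n (v j) (v j)" unfolding ip_def by (rule member_le_sum) (use i in auto)
  then have "(v j i)^2 \<le> 1" using orthonormalD(2)[OF v j j] by (simp add: power2_eq_square)
  then show ?thesis by (simp add: abs_square_le_1)
qed

lemma ip_abs_bound:
  assumes "\<And>i. i < n \<Longrightarrow> \<bar>x i\<bar> \<le> a" "\<And>i. i < n \<Longrightarrow> \<bar>y i\<bar> \<le> b" "0 \<le> a" "0 \<le> b"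
  shows "\<bar>ip n x y\<bar> \<le> real n * (a * b)"
proof -
  have "\<bar>ip n x y\<bar> \<le> (\<Sum>i<n. \<bar>x i * y i\<bar>)" unfolding ip_def by (rule sum_abs)
  also have "\<dots> \<le> (\<Sum>i<n. a * b)" unfolding abs_mult
    by (rule sum_mono) (use assms in \<open>auto intro!: mult_mono\<close>)
  finally show ?thesis by simp
qed

lemma lincomb_preimage_cube:
  assumes v: "orthonormal n n v" and K: "\<And>x i. x \<in> K \<Longrightarrow> i < n \<Longrightarrow> \<bar>x i\<bar> \<le> R" "R > 0"
  shows "{c. lincomb n v c \<in> K} \<subseteq> cube n (real n * R)"
proof
  fix c assume c: "c \<in> {c. lincomb n v c \<in> K}"
  have "\<bar>c j\<bar> \<le> real n * R" if j: "j < n" for j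
    using ip_abs_bound[of n "lincomb n v c" R "v j" 1] K c orthonormal_coord_bound[OF v j] ip_lincomb_coord[OF v j, of c] by auto
  then show "c \<in> cube n (real n * R)" by (simp add: cube_def)
qed

lemma lincomb_barycentre:
  assumes v: "orthonormal n n v" and K[measurable]: "K \<in> sets borel" and bd: "K \<subseteq> cube n R" "R \<ge> 0"
    and bary: "\<forall>i<n. (\<integral>x. indicator K x * x i \<partial>lebV n) = 0" and j: "j < n"
  shows "(\<integral>c. indicator {c. lincomb n v c \<in> K} c * c j \<partial>lebV n) = 0"
proof -
  have "(\<integral>x. indicator K x * ip n x (v j) \<partial>lebV n) = (\<integral>c. indicator K (lincomb n v c) * ip n (lincomb n v c) (v j) \<partial>lebV n)"
    by (subst lebV_orthonormal_distr[OF v], rule integral_distr) auto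
  also have "\<dots> = (\<integral>c. indicator {c. lincomb n v c \<in> K} c * c j \<partial>lebV n)"
    using ip_lincomb_coord[OF v j] by (intro Bochner_Integration.integral_cong) (auto simp: indicator_def)
  finally show ?thesis using ip_integral_zero[OF nice_indicator[OF K bd] bary] by simp
qed

lemma emeasure_lincomb_preimage:
  assumes v: "orthonormal n n v" and K[measurable]: "K \<in> sets borel"
  shows "emeasure (lebV n) {c. lincomb n v c \<in> K} = emeasure (lebV n) K"
proof -
  have "(\<integral>\<^sup>+c. indicator K (lincomb n v c) \<partial>lebV n) = (\<integral>\<^sup>+x. indicator K x \<partial>lebV n)"
    by (rule nn_integral_orthonormal[OF v]) simp
  moreover have "(\<integral>\<^sup>+c. indicator K (lincomb n v c) \<partial>lebV n) = (\<integral>\<^sup>+c. indicator {c. lincomb n v c \<in> K} c \<partial>lebV n)"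
    by (rule nn_integral_cong) (simp add: indicator_def)
  ultimately show ?thesis by simp
qed

section \<open>Projections and polars: compactness, measurability and duality\<close>

lemma Proj_image_compact:
  assumes u: "onb n l u F" and "compact K" shows "compact (Proj n F ` K)"
proof -
  have "continuous_on UNIV (\<lambda>x. lincomb l u (\<lambda>j. ip n x (u j)))"
    unfolding lincomb_def ip_def
    by (intro continuous_on_coordinatewise_then_product continuous_intros continuous_on_product_coordinates)
  then have "continuous_on K (Proj n F)" unfolding Proj_eq[OF u, abs_def] by (rule continuous_on_subset) simp
  then show ?thesis using assms(2) by (rule compact_continuous_image)
qed

lemma onb_borel:
  assumes u: "onb n l u F" shows "F \<in> sets borel"
proof -
  have F: "F = {x. \<forall>i. lincomb l u (\<lambda>j. ip n x (u j)) i = x i}"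
  proof (intro set_eqI iffI)
    fix x assume "x \<in> F" then show "x \<in> {x. \<forall>i. lincomb l u (\<lambda>j. ip n x (u j)) i = x i}"
      using Proj_fixed[OF u] Proj_eq[OF u] by simp
  next
    fix x assume "x \<in> {x. \<forall>i. lincomb l u (\<lambda>j. ip n x (u j)) i = x i}"
    then have "lincomb l u (\<lambda>j. ip n x (u j)) = x" by auto
    then show "x \<in> F" using onb_lincomb_mem[OF u] by metis
  qed
  have "closed F" unfolding F lincomb_def ip_def
    by (intro closed_Collect_all closed_Collect_eq continuous_intros continuous_on_product_coordinates)
  then show ?thesis by (rule borel_closed)
qed

lemma polar_closed: "closed (polar n K)"
proof -
  have eq: "polar n K = {y. \<forall>i. i \<ge> n \<longrightarrow> y i = 0} \<inter> (\<Inter>x\<in>K. {y. ip n x y \<le> 1})"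
    by (auto simp: polar_def Rn_def)
  have c1: "closed {y :: vec. \<forall>i. i \<ge> n \<longrightarrow> y i = 0}"
    by (intro closed_Collect_all closed_Collect_imp closed_Collect_eq continuous_on_product_coordinates continuous_on_const) auto
  have c2: "closed {y :: vec. ip n x y \<le> 1}" for x
    unfolding ip_def by (intro closed_Collect_le continuous_intros continuous_on_product_coordinates)
  show ?thesis unfolding eq by (intro closed_Int closed_INT ballI c1 c2)
qed

lemma polar_borel: "polar n K \<in> sets borel"
  using polar_closed by (rule borel_closed)

lemma is_convex_polar: "is_convex (polar n K)"
  unfolding is_convex_def
proof (intro ballI allI impI)
  fix x y and t :: real assume x: "x \<in> polar n K" and y: "y \<in> polar n K" and t: "0 \<le> t \<and> t \<le> 1"
  have "ip n z (\<lambda>i. (1-t) * x i + t * y i) \<le> 1" if "z \<in> K" for z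
  proof -
    have "(1-t) * ip n z x + t * ip n z y \<le> (1-t) * 1 + t * 1"
      using x y t that by (intro add_mono mult_left_mono) (auto simp: polar_def)
    then show ?thesis unfolding ip_add_right ip_scale_right by simp
  qed
  then show "(\<lambda>i. (1-t) * x i + t * y i) \<in> polar n K" using x y by (auto simp: polar_def Rn_def)
qed

text \<open>\<open>measure\<close> assigns 0 to sets of infinite volume, so in that case the real
  inequality is trivial.\<close>

lemma measure_product_le:
  assumes "ennreal c * emeasure M A * (ennreal d * emeasure M B) \<le> 16^l" "0 \<le> c" "0 \<le> d"
  shows "c * d * (measure M A * measure M B) \<le> 16^l"
proof (cases "emeasure M A = top \<or> emeasure M B = top")
  case False
  then have "emeasure M A = ennreal (measure M A)" "emeasure M B = ennreal (measure M B)"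
    by (auto simp: emeasure_eq_ennreal_measure)
  then have "ennreal c * emeasure M A * (ennreal d * emeasure M B) = ennreal (c * d * (measure M A * measure M B))"
    using assms by (simp add: ennreal_mult mult_ac)
  moreover have "(16::ennreal)^l = ennreal (16^l)" using ennreal_power[of 16 l] by simp
  ultimately have "ennreal (c * d * (measure M A * measure M B)) \<le> ennreal (16^l)" using assms(1) by simp
  then show ?thesis by simp
qed (auto simp: measure_def)

text \<open>For y in F, pairing with x and with its projection agree. This supplies the hypothesis
  of \<open>volume_product_bound\<close>, with either of the two sets as A.\<close>

lemma polar_Proj_ip:
  assumes u: "onb n l u F" and c: "lincomb l u c \<in> polar n K" and d: "lincomb l u d \<in> Proj n F ` K"
  shows "ip l c d \<le> 1"
proof -
  have o: "orthonormal n l u" using u by (simp add: onb_orthonormal)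
  obtain x where x: "x \<in> K" "lincomb l u d = Proj n F x" using d by blast
  have "ip l c d = ip n (lincomb l u d) (lincomb l u c)" by (simp add: ip_lincomb_lincomb[OF o] ip_commute)
  also have "\<dots> = ip l (\<lambda>j. ip n x (u j)) c" unfolding x(2) Proj_eq[OF u] by (rule ip_lincomb_lincomb[OF o])
  also have "\<dots> = ip n x (lincomb l u c)" unfolding ip_lincomb_right by (simp add: ip_def mult.commute)
  also have "\<dots> \<le> 1" using c x(1) by (simp add: polar_def)
  finally show ?thesis .
qed

lemma measF_polar:
  assumes u: "onb n l u F"
  shows "measF n l F (polar n K \<inter> F) = measure (lebV l) {c. lincomb l u c \<in> polar n K}"
proof -
  have "polar n K \<inter> F \<in> sets borel" using polar_borel onb_borel[OF u] by auto
  then show ?thesis using onb_lincomb_mem[OF u] by (simp add: measF_eq[OF u])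
qed

lemma measF_Proj:
  assumes u: "onb n l u F" and "compact K"
  shows "measF n l F (Proj n F ` K) = measure (lebV l) {c. lincomb l u c \<in> Proj n F ` K}"
  by (rule measF_eq[OF u compact_vec_borel[OF Proj_image_compact[OF u assms(2)]]])

text \<open>The basis of F is completed to one of R^n with u in front. In these coordinates the
  projection forgets the last m entries and \<open>tilt_projection\<close> applies with s =
  l/n.\<close>

lemma volume_product_barycentre:
  assumes l: "1 \<le> l" "l < n" and u: "onb n l u F" and K: "compact K" "is_convex K" "K \<subseteq> Rn n"
    and pos: "emeasure (lebV n) K \<noteq> 0" and bary: "\<forall>i<n. (\<integral>x. indicator K x * x i \<partial>lebV n) = 0"
  shows "((real l / real n)^l * (1 - real l / real n)^(n - l)) * fact l * (measF n l F (Proj n F ` K) * measF n l F (polar n K \<inter> F)) \<le> 16^l"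
proof -
  define m where "m = n - l"
  have n: "n = l + m" using l by (simp add: m_def)
  have o: "orthonormal n l u" using u by (simp add: onb_orthonormal)
  obtain v where v: "orthonormal n n v" "\<And>j. j < l \<Longrightarrow> v j = u j" using orthonormal_extend[OF o] l by auto
  have [measurable]: "K \<in> sets borel" using K by (simp add: compact_vec_borel)
  obtain R where R: "R > 0" "\<And>x i. x \<in> K \<Longrightarrow> i < n \<Longrightarrow> \<bar>x i\<bar> \<le> R" using compact_vec_bounded[OF K(1), of n] by blast
  have Kc: "K \<subseteq> cube n R" using R(2) by (auto simp: cube_def)
  define K' where "K' = {c. lincomb n v c \<in> K}"
  have K'm: "K' \<in> sets borel" unfolding K'_def by measurable
  have K'c: "K' \<subseteq> cube (l + m) (real n * R)" unfolding K'_def n[symmetric] by (rule lincomb_preimage_cube[OF v(1)]) (use R in auto)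
  define A where "A = {c. lincomb l u c \<in> Proj n F ` K}"
  define Q where "Q = {c. lincomb l u c \<in> polar n K}"
  have PK: "Proj n F ` K \<in> sets borel" by (rule compact_vec_borel[OF Proj_image_compact[OF u K(1)]])
  have Am[measurable]: "A \<in> sets borel" unfolding A_def using PK by measurable
  have Qm[measurable]: "Q \<in> sets borel" unfolding Q_def using polar_borel[of n K] by measurable
  have PT: "Proj n F (lincomb n v c) = lincomb l u c" for c
  proof -
    have "ip n (lincomb n v c) (u j) = c j" if "j < l" for j
      using ip_lincomb_coord[OF v(1), of j c] v(2)[OF that] that l by simp
    then show ?thesis unfolding Proj_eq[OF u] by (simp add: lincomb_def)
  qed
  have split: "lincomb l u (join l y w) = lincomb l u y" for y w by (simp add: lincomb_def join_def)
  have A2: "y \<in> A" if "join l y w \<in> K'" for y w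
    using that PT[of "join l y w"] unfolding A_def K'_def split by (metis imageI mem_Collect_eq)
  have A1: "\<exists>w\<in>Rn m. join l y w \<in> K'" if "y \<in> A" for y
  proof -
    have "lincomb l u y \<in> Proj n F ` K" using that by (simp add: A_def)
    then obtain x where x: "x \<in> K" "lincomb l u y = Proj n F x" by blast
    define w where "w = (\<lambda>j. if j < m then ip n x (v (l + j)) else 0)"
    have yj: "y j = ip n x (v j)" if "j < l" for j
      using ip_lincomb_coord[OF o that, of y] ip_lincomb_coord[OF o that, of "\<lambda>j. ip n x (u j)"] x(2) v(2)[OF that] unfolding Proj_eq[OF u] by simp
    have "lincomb n v (join l y w) = lincomb n v (\<lambda>j. ip n x (v j))"
      unfolding lincomb_def by (intro ext sum.cong refl) (use yj n in \<open>auto simp: join_def w_def\<close>)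
    also have "\<dots> = x" using orthonormal_expand[OF v(1)] x(1) K(3) by blast
    finally have "join l y w \<in> K'" using x(1) by (simp add: K'_def)
    moreover have "w \<in> Rn m" by (simp add: w_def Rn_def)
    ultimately show ?thesis by blast
  qed
  have s: "0 < real l / real n" "real l / real n < 1" using l by auto
  have "ennreal ((real l / real n)^l * (1 - real l / real n)^m) * emeasure (lebV l) A * (ennreal (fact l) * emeasure (lebV l) Q) \<le> 16^l"
  proof (rule volume_product_bound[OF Am Qm])
    fix x y assume "x \<in> A" "y \<in> Q" then show "ip l x y \<le> 1"
      using polar_Proj_ip[OF u, of y K x] by (simp add: A_def Q_def ip_commute)
  next
    fix \<theta>
    show "ennreal ((real l / real n)^l * (1 - real l / real n)^m) * emeasure (lebV l) A \<le> (\<integral>\<^sup>+x. indicator A x * ennreal (exp (ip l x \<theta>)) \<partial>lebV l)"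
    proof (rule tilt_projection[OF K'm _ K'c _ _ _ Am A1 A2 s])
      show "is_convex K'" unfolding K'_def by (rule is_convex_lincomb[OF K(2)])
      show "emeasure (lebV (l + m)) K' \<noteq> 0" unfolding K'_def n[symmetric] using pos by (simp add: emeasure_lincomb_preimage[OF v(1)])
      fix i assume "i < l + m" then show "(\<integral>x. indicator K' x * x i \<partial>lebV (l + m)) = 0"
        unfolding K'_def n[symmetric] using R(1) by (intro lincomb_barycentre[OF v(1) _ Kc _ bary]) auto
    qed (use R in auto)
  qed
  from measure_product_le[OF this] show ?thesis
    using s unfolding measF_Proj[OF u K(1)] measF_polar[OF u] A_def Q_def m_def by simp
qed

text \<open>The polar is now the centred body, so its section plays the role of A and the projection
  that of Q. The ratio is m/n because the complement of F occupies the first m coordinates in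
  \<open>tilt_section\<close>; the numerical factor is the same as in the other case.\<close>

lemma volume_product_polar_barycentre:
  assumes l: "1 \<le> l" "l < n" and u: "onb n l u F" and K: "compact K" "K \<subseteq> Rn n"
    and bd: "polar n K \<subseteq> cube n R'" "R' > 0"
    and bary: "\<forall>i<n. (\<integral>x. indicator (polar n K) x * x i \<partial>lebV n) = 0"
  shows "((real l / real n)^l * (1 - real l / real n)^(n - l)) * fact l * (measF n l F (Proj n F ` K) * measF n l F (polar n K \<inter> F)) \<le> 16^l"
proof -
  define m where "m = n - l"
  have n: "n = m + l" using l by (simp add: m_def)
  have o: "orthonormal n l u" using u by (simp add: onb_orthonormal)
  obtain v0 where v0: "orthonormal n n v0" "\<And>j. j < l \<Longrightarrow> v0 j = u j" using orthonormal_extend[OF o] l by auto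
  \<comment> \<open>The completed basis is rotated so that the m complementary vectors come first
    and u last.\<close>
  define v where "v j = (if j < m then v0 (l + j) else v0 (j - m))" for j
  have v: "orthonormal n n v"
    unfolding orthonormal_def
  proof (intro conjI allI impI)
    fix j assume "j < n" then show "v j \<in> Rn n" using n orthonormalD(1)[OF v0(1)] by (auto simp: v_def)
  next
    fix i j assume "i < n" "j < n"
    then show "ip n (v i) (v j) = (if i = j then 1 else 0)" using n orthonormalD(2)[OF v0(1)] by (auto simp: v_def)
  qed
  have M[measurable]: "polar n K \<in> sets borel" by (rule polar_borel)
  obtain R where R: "R > 0" "\<And>x i. x \<in> K \<Longrightarrow> i < n \<Longrightarrow> \<bar>x i\<bar> \<le> R" using compact_vec_bounded[OF K(1), of n] by blast
  define M' where "M' = {c. lincomb n v c \<in> polar n K}"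
  have M'm: "M' \<in> sets borel" unfolding M'_def by measurable
  have M'c: "M' \<subseteq> cube (m + l) (real n * R')" unfolding M'_def n[symmetric]
    by (rule lincomb_preimage_cube[OF v _ bd(2)]) (use bd in \<open>auto simp: cube_def\<close>)
  define A where "A = {c. lincomb l u c \<in> polar n K}"
  define Q where "Q = {c. lincomb l u c \<in> Proj n F ` K}"
  have PK: "Proj n F ` K \<in> sets borel" by (rule compact_vec_borel[OF Proj_image_compact[OF u K(1)]])
  have Am[measurable]: "A \<in> sets borel" unfolding A_def by measurable
  have Qm[measurable]: "Q \<in> sets borel" unfolding Q_def using PK by measurable
  have split: "lincomb n v (join m (\<lambda>_. 0) c) = lincomb l u c" for c
  proof
    fix a
    have "lincomb n v (join m (\<lambda>_. 0) c) a = (\<Sum>j<m. 0) + (\<Sum>j<l. c j * v (m + j) a)"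
      unfolding lincomb_def n sum_lessThan_add by (simp add: join_def)
    also have "\<dots> = lincomb l u c a" unfolding lincomb_def by (simp add: v_def v0(2))
    finally show "lincomb n v (join m (\<lambda>_. 0) c) a = lincomb l u c a" .
  qed
  have Aeq: "{c. join m (\<lambda>_. 0) c \<in> M'} = A" by (simp add: M'_def A_def split)
  \<comment> \<open>If all entries of c are at most \<delta>, those of \<open>lincomb n v c\<close>
    are at most n \<delta>, and its pairing with a point of K is at most n * R * (n \<delta>) \<le>
    1. So a cube around 0 lies in the polar.\<close>
  define \<delta> where "\<delta> = 1 / (real n * (R * real n) + 1)"
  have \<delta>: "\<delta> > 0" "real n * (R * (real n * \<delta>)) \<le> 1"
  proof -
    have p: "real n * (R * real n) \<ge> 0" using R by simp
    then show "\<delta> > 0" by (simp add: \<delta>_def add_nonneg_pos)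
    have "real n * (R * (real n * \<delta>)) = (real n * (R * real n)) / (real n * (R * real n) + 1)" by (simp add: \<delta>_def)
    also have "\<dots> \<le> 1" using p by (simp add: divide_le_eq_1)
    finally show "real n * (R * (real n * \<delta>)) \<le> 1" .
  qed
  have nbh: "cube (m + l) \<delta> \<subseteq> M'"
  proof
    fix c assume "c \<in> cube (m + l) \<delta>"
    then have c: "\<bar>c j\<bar> \<le> \<delta>" if "j < n" for j using that n by (simp add: cube_def)
    have "\<bar>lincomb n v c i\<bar> \<le> real n * \<delta>" if i: "i < n" for i
    proof -
      have "\<bar>lincomb n v c i\<bar> \<le> (\<Sum>j<n. \<bar>c j * v j i\<bar>)" unfolding lincomb_def by (rule sum_abs)
      also have "\<dots> \<le> (\<Sum>j<n. \<delta> * 1)" unfolding abs_mult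
        by (rule sum_mono) (use c orthonormal_coord_bound[OF v _ i] \<delta> in \<open>auto intro!: mult_mono simp del: mult_1_right\<close>)
      finally show ?thesis by simp
    qed
    then have "ip n x (lincomb n v c) \<le> 1" if "x \<in> K" for x
      using ip_abs_bound[of n x R "lincomb n v c" "real n * \<delta>"] R that \<delta> by fastforce
    moreover have "lincomb n v c \<in> Rn n" by (rule lincomb_Rn) (rule orthonormalD(1)[OF v])
    ultimately show "c \<in> M'" by (simp add: M'_def polar_def)
  qed
  have s: "0 < real m / real n" "real m / real n < 1" "1 - real m / real n = real l / real n"
    using l n by (auto simp: field_simps)
  have "ennreal ((real m / real n)^m * (real l / real n)^l) * emeasure (lebV l) A * (ennreal (fact l) * emeasure (lebV l) Q) \<le> 16^l"
  proof (rule volume_product_bound[OF Am Qm])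
    fix x y assume "x \<in> A" "y \<in> Q" then show "ip l x y \<le> 1"
      using polar_Proj_ip[OF u] by (simp add: A_def Q_def)
  next
    fix \<theta>
    show "ennreal ((real m / real n)^m * (real l / real n)^l) * emeasure (lebV l) A \<le> (\<integral>\<^sup>+x. indicator A x * ennreal (exp (ip l x \<theta>)) \<partial>lebV l)"
      unfolding Aeq[symmetric] s(3)[symmetric]
    proof (rule tilt_section[OF M'm _ M'c _ _ nbh \<delta>(1) s(1,2)])
      show "is_convex M'" unfolding M'_def by (rule is_convex_lincomb[OF is_convex_polar])
      fix i assume "i < m + l" then show "(\<integral>x. indicator M' x * x i \<partial>lebV (m + l)) = 0"
        unfolding M'_def n[symmetric] using bd(2) by (intro lincomb_barycentre[OF v M bd(1) _ bary]) auto
    qed (use bd in auto)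
  qed
  from measure_product_le[OF this]
  have "(real m / real n)^m * (real l / real n)^l * fact l * (measure (lebV l) A * measure (lebV l) Q) \<le> 16^l"
    using s by simp
  moreover have "1 - real l / real n = real m / real n" using s(3) by linarith
  ultimately show ?thesis
    unfolding measF_Proj[OF u K(1)] measF_polar[OF u] A_def Q_def m_def by (simp add: mult_ac)
qed

section \<open>The Santalo point\<close>

abbreviation polar_at :: "nat \<Rightarrow> vec set \<Rightarrow> vec \<Rightarrow> vec set" where
  "polar_at n K w \<equiv> polar n ((\<lambda>x. vdiff x w) ` K)"

lemma polar_at_iff: "y \<in> polar_at n K w \<longleftrightarrow> y \<in> Rn n \<and> (\<forall>x\<in>K. ip n x y - ip n w y \<le> 1)"
  by (simp add: polar_def vdiff_def ip_diff_left)

lemma polar_at_zvec: "polar_at n K zvec = polar n K"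
  by (simp add: vdiff_def zvec_def)

definition support :: "nat \<Rightarrow> vec set \<Rightarrow> vec \<Rightarrow> real" where
  "support n K y = (SUP x\<in>K. ip n x y)"

lemma support_le_iff:
  assumes K: "compact K" "K \<noteq> {}"
  shows "support n K y \<le> s \<longleftrightarrow> (\<forall>x\<in>K. ip n x y \<le> s)"
proof -
  obtain R where R: "R > 0" "\<And>x i. x \<in> K \<Longrightarrow> i < n \<Longrightarrow> \<bar>x i\<bar> \<le> R" using compact_vec_bounded[OF K(1), of n] by blast
  have "bdd_above ((\<lambda>x. ip n x y) ` K)"
  proof (rule bdd_aboveI2)
    fix x assume "x \<in> K"
    then have "x \<in> cube n R" using R(2) by (simp add: cube_def)
    from cube_ip_bound[OF this, of y] show "ip n x y \<le> (\<Sum>i<n. R * \<bar>y i\<bar>)" by linarith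
  qed
  then show ?thesis unfolding support_def by (rule cSUP_le_iff[OF K(2)])
qed

text \<open>The gauge of the polar of K - w is h_K(y) - <w,y> with h_K the support function.
  Translating K therefore only tilts a fixed density by a linear exponent.\<close>

lemma gexp_polar_at:
  assumes K: "compact K" and w: "w \<in> K" and y: "y \<in> Rn n"
  shows "gexp (polar_at n K w) y = ennreal (exp (ip n w y - support n K y))"
proof -
  have ne: "K \<noteq> {}" using w by auto
  define a where "a = support n K y - ip n w y"
  have a0: "a \<ge> 0" using support_le_iff[OF K ne, of n y "support n K y"] w by (simp add: a_def)
  have iff: "(\<lambda>i. 0 + (1/s) * y i) \<in> polar_at n K w \<longleftrightarrow> a \<le> s" if s: "s > 0" for s
  proof -
    have "(\<lambda>i. 0 + (1/s) * y i) \<in> Rn n" using y by (simp add: Rn_def)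
    then have "(\<lambda>i. 0 + (1/s) * y i) \<in> polar_at n K w \<longleftrightarrow> (\<forall>x\<in>K. (1/s) * ip n x y - (1/s) * ip n w y \<le> 1)"
      unfolding polar_at_iff by (simp only: add_0_left ip_scale_right simp_thms)
    also have "\<dots> \<longleftrightarrow> (\<forall>x\<in>K. ip n x y \<le> s + ip n w y)"
    proof (rule ball_cong[OF refl])
      fix x
      have "(1/s) * ip n x y - (1/s) * ip n w y = (ip n x y - ip n w y) / s" by (simp add: diff_divide_distrib)
      then show "(1/s) * ip n x y - (1/s) * ip n w y \<le> 1 \<longleftrightarrow> ip n x y \<le> s + ip n w y"
        using s by (simp add: pos_divide_le_eq) linarith
    qed
    also have "\<dots> \<longleftrightarrow> a \<le> s" unfolding support_le_iff[OF K ne, symmetric] a_def by linarith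
    finally show ?thesis .
  qed
  have "gexp (polar_at n K w) y = (\<integral>\<^sup>+s. ennreal (exp (-s)) * indicator {a..} s \<partial>lborel)"
    unfolding gexp_def
  proof (rule nn_integral_cong_AE)
    show "AE s in lborel. ennreal (exp (-s)) * indicator {0<..} s * indicator (polar_at n K w) (\<lambda>i. 0 + (1/s) * y i) = ennreal (exp (-s)) * indicator {a..} s"
      using AE_lborel_singleton[of "0::real"]
    proof eventually_elim
      case (elim s)
      show ?case
      proof (cases "s > 0")
        case True then show ?thesis using iff[OF True] by (simp only: indicator_def mem_Collect_eq greaterThan_iff atLeast_iff) simp
      next
        case False then show ?thesis using elim a0 by (auto split: split_indicator)
      qed
    qed
  qed
  then show ?thesis by (simp add: nn_integral_exp_from a_def)
qed

text \<open>On \<open>Rn n\<close> this is e^(-h_K) with h_K the support function, when K is compact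
  and contains the origin. Going through \<open>gexp\<close> makes it Borel without a study of
  h_K.\<close>

definition polar_density :: "nat \<Rightarrow> vec set \<Rightarrow> vec \<Rightarrow> real" where
  "polar_density n K y = enn2real (gexp (polar n K) y)"

lemma polar_density_measurable[measurable]: "polar_density n K \<in> borel_measurable borel"
proof -
  have [measurable]: "gexp (polar n K) \<in> borel_measurable borel" by (rule gexp_measurable[OF polar_borel])
  show ?thesis unfolding polar_density_def[abs_def] by measurable
qed

lemma polar_density_eq:
  assumes "compact K" "zvec \<in> K" "y \<in> Rn n"
  shows "polar_density n K y = exp (- support n K y)"
proof -
  have "ip n zvec y = 0" by (simp add: zvec_def ip_def)
  then show ?thesis using gexp_polar_at[OF assms] unfolding polar_density_def polar_at_zvec by simp
qed

lemma gexp_polar_density: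
  assumes "compact K" "zvec \<in> K" "w \<in> K" "y \<in> Rn n"
  shows "gexp (polar_at n K w) y = ennreal (polar_density n K y * exp (ip n w y))"
  unfolding gexp_polar_at[OF assms(1,3,4)] polar_density_eq[OF assms(1,2,4)] by (simp add: exp_add[symmetric])

lemma polar_density_nonneg: "polar_density n K y \<ge> 0" by (simp add: polar_density_def)

text \<open>The volume minimised by the Santalo point becomes the Laplace transform of one density,
  to be studied as a function of w.\<close>

lemma polar_at_volume:
  assumes K: "compact K" "zvec \<in> K" "w \<in> K"
  shows "(\<integral>\<^sup>+y. ennreal (polar_density n K y * exp (ip n w y)) \<partial>lebV n) = ennreal (fact n) * emeasure (lebV n) (polar_at n K w)"
proof -
  have "(\<integral>\<^sup>+y. ennreal (polar_density n K y * exp (ip n w y)) \<partial>lebV n) = (\<integral>\<^sup>+y. gexp (polar_at n K w) y \<partial>lebV n)"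
  proof (rule nn_integral_cong_AE)
    show "AE y in lebV n. ennreal (polar_density n K y * exp (ip n w y)) = gexp (polar_at n K w) y"
      using AE_lebV_Rn by eventually_elim (simp add: gexp_polar_density[OF K])
  qed
  then show ?thesis by (simp only: gexp_integral_1[OF polar_borel])
qed

lemma in_interior_of_cube:
  assumes "w \<in> Rn n" "\<delta> > 0" and K: "\<And>y. y \<in> Rn n \<Longrightarrow> (\<And>i. i < n \<Longrightarrow> \<bar>y i - w i\<bar> \<le> \<delta>) \<Longrightarrow> y \<in> K"
  shows "in_interior n K w"
  unfolding in_interior_def
proof (intro conjI exI[of _ \<delta>] ballI impI assms(1,2))
  fix y assume y: "y \<in> Rn n" "ip n (vdiff y w) (vdiff y w) < \<delta>^2"
  show "y \<in> K"
  proof (rule K[OF y(1)])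
    fix i assume i: "i < n"
    have "(y i - w i) * (y i - w i) \<le> ip n (vdiff y w) (vdiff y w)"
      unfolding ip_def vdiff_def by (rule member_le_sum[where f="\<lambda>i. (y i - w i) * (y i - w i)"]) (use i in auto)
    then have "\<bar>y i - w i\<bar>^2 \<le> \<delta>^2" using y(2) by (simp add: power2_eq_square)
    then show "\<bar>y i - w i\<bar> \<le> \<delta>" using assms(2) by (simp add: power2_le_iff_abs_le)
  qed
qed

lemma in_interior_mem: "in_interior n K w \<Longrightarrow> w \<in> K"
proof -
  assume "in_interior n K w"
  then obtain r where "r > 0" "\<And>y. y \<in> Rn n \<Longrightarrow> ip n (vdiff y w) (vdiff y w) < r\<^sup>2 \<Longrightarrow> y \<in> K" "w \<in> Rn n"
    by (auto simp: in_interior_def)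
  moreover have "ip n (vdiff w w) (vdiff w w) = 0" by (simp add: ip_def vdiff_def)
  ultimately show ?thesis by simp
qed

lemma polar_at_bounded:
  assumes "in_interior n K w"
  obtains R where "R > 0" "polar_at n K w \<subseteq> cube n R"
proof -
  obtain \<delta> where \<delta>: "\<delta> > 0" "\<And>y. y \<in> Rn n \<Longrightarrow> (\<And>i. i < n \<Longrightarrow> \<bar>y i - w i\<bar> \<le> \<delta>) \<Longrightarrow> y \<in> K"
    using in_interior_cube[OF assms] by blast
  have wR: "w \<in> Rn n" using assms by (simp add: in_interior_def)
  show ?thesis
  proof (rule that[of "1/\<delta>"])
    show "1/\<delta> > 0" using \<delta> by simp
    show "polar_at n K w \<subseteq> cube n (1/\<delta>)"
    proof
      fix y assume y: "y \<in> polar_at n K w"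
      have "\<bar>y i\<bar> \<le> 1/\<delta>" if i: "i < n" for i
      proof -
        \<comment> \<open>From w one moves by \<delta> along the i-th axis in the direction of the
          sign of y_i; the polar inequality at this point reads \<delta> |y_i| \<le> 1.\<close>
        define x where "x = (\<lambda>j. w j + (\<delta> * sgn (y i)) * unitv i j)"
        have "x \<in> K"
        proof (rule \<delta>(2))
          show "x \<in> Rn n" using wR unitv_Rn[OF i] by (simp add: x_def Rn_def)
          fix j assume "j < n" show "\<bar>x j - w j\<bar> \<le> \<delta>" using \<delta>(1) by (auto simp: x_def unitv_def abs_mult sgn_if)
        qed
        then have "ip n x y - ip n w y \<le> 1" using y unfolding polar_at_iff by blast
        then have "(\<delta> * sgn (y i)) * y i \<le> 1" unfolding x_def ip_add_left ip_scale_left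
          by (subst (asm) ip_commute[of n "unitv i"]) (simp add: ip_unitv[OF i])
        then have "\<delta> * \<bar>y i\<bar> \<le> 1" by (simp add: abs_sgn mult_ac)
        then show ?thesis using \<delta>(1) by (simp add: field_simps)
      qed
      then show "y \<in> cube n (1/\<delta>)" by (simp add: cube_def)
    qed
  qed
qed

lemma polar_at_finite:
  assumes "in_interior n K w" shows "emeasure (lebV n) (polar_at n K w) < top"
proof -
  obtain R where "R > 0" "polar_at n K w \<subseteq> cube n R" using polar_at_bounded[OF assms] by blast
  then show ?thesis using lebV_cube_finite[OF _ _ polar_borel] by auto
qed

lemma tilt_integrable:
  assumes K: "compact K" "in_interior n K zvec" "in_interior n K w"
  shows "integrable (lebV n) (\<lambda>y. polar_density n K y * exp (ip n w y))"
    "(\<integral>y. polar_density n K y * exp (ip n w y) \<partial>lebV n) = fact n * lebn n (polar_at n K w)"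
proof -
  note mem = K(1) in_interior_mem[OF K(2)] in_interior_mem[OF K(3)]
  have "emeasure (lebV n) (polar_at n K w) = ennreal (lebn n (polar_at n K w))"
    unfolding lebn_eq[OF polar_borel] using polar_at_finite[OF K(3)] by (intro emeasure_eq_ennreal_measure) auto
  then have e: "(\<integral>\<^sup>+y. ennreal (polar_density n K y * exp (ip n w y)) \<partial>lebV n) = ennreal (fact n * lebn n (polar_at n K w))"
    unfolding polar_at_volume[OF mem] by (simp add: ennreal_mult lebn_def)
  show "integrable (lebV n) (\<lambda>y. polar_density n K y * exp (ip n w y))"
  proof (rule integrableI_bounded)
    show "(\<integral>\<^sup>+y. ennreal (norm (polar_density n K y * exp (ip n w y))) \<partial>lebV n) < \<infinity>"
      using e by (simp add: abs_mult polar_density_nonneg)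
  qed simp
  show "(\<integral>y. polar_density n K y * exp (ip n w y) \<partial>lebV n) = fact n * lebn n (polar_at n K w)"
    by (rule integral_eq_nn_integral[THEN trans]) (use e in \<open>auto simp: polar_density_nonneg lebn_def\<close>)
qed

text \<open>The factor comes from integrating a function homogeneous of degree one against the exponential
  of minus the gauge of the polar body.\<close>
lemma polar_density_moment:
  assumes K: "compact K" "in_interior n K zvec" and i: "i < n"
  shows "integrable (lebV n) (\<lambda>y. polar_density n K y * y i)"
    "(\<integral>y. polar_density n K y * y i \<partial>lebV n) = fact (n + 1) * (\<integral>y. indicator (polar n K) y * y i \<partial>lebV n)"
proof -
  note z = in_interior_mem[OF K(2)]
  have [measurable]: "polar n K \<in> sets borel" by (rule polar_borel)
  obtain R where R: "R > 0" "polar n K \<subseteq> cube n R" using polar_at_bounded[OF K(2)] unfolding polar_at_zvec by blast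
  have dens: "AE y in lebV n. ennreal (polar_density n K y) = gexp (polar n K) y"
    using AE_lebV_Rn
  proof eventually_elim
    case (elim y)
    have "ip n zvec y = 0" by (simp add: zvec_def ip_def)
    then show ?case using gexp_polar_density[OF K(1) z z elim] unfolding polar_at_zvec by simp
  qed
  \<comment> \<open>\<open>ennreal\<close> sends negative reals to 0, so \<sigma> = 1 and \<sigma> =
    -1 give the positive and the negative part of the moment.\<close>
  have mom: "(\<integral>\<^sup>+y. ennreal (polar_density n K y * (\<sigma> * y i)) \<partial>lebV n) = ennreal (fact (n + 1)) * (\<integral>\<^sup>+y. ennreal (indicator (polar n K) y * (\<sigma> * y i)) \<partial>lebV n)" for \<sigma>
  proof -
    have "(\<integral>\<^sup>+y. ennreal (polar_density n K y * (\<sigma> * y i)) \<partial>lebV n) = (\<integral>\<^sup>+y. ennreal (\<sigma> * y i) * gexp (polar n K) y \<partial>lebV n)"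
    proof (rule nn_integral_cong_AE)
      show "AE y in lebV n. ennreal (polar_density n K y * (\<sigma> * y i)) = ennreal (\<sigma> * y i) * gexp (polar n K) y"
        using dens
      proof eventually_elim
        case (elim y)
        have "ennreal (polar_density n K y * (\<sigma> * y i)) = ennreal (polar_density n K y) * ennreal (\<sigma> * y i)"
          by (rule ennreal_mult'[OF polar_density_nonneg])
        then show ?case unfolding elim by (simp only: mult.commute)
      qed
    qed
    also have "\<dots> = ennreal (fact (n + 1)) * (\<integral>\<^sup>+y. ennreal (\<sigma> * y i) * indicator (polar n K) y \<partial>lebV n)"
    proof (rule gexp_integral)
      fix s :: real and y :: vec assume "s > 0"
      then show "ennreal (\<sigma> * (s * y i)) = ennreal (s^1) * ennreal (\<sigma> * y i)"
        using ennreal_mult'[of s "\<sigma> * y i"] by (simp add: mult_ac)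
    qed measurable
    also have "(\<integral>\<^sup>+y. ennreal (\<sigma> * y i) * indicator (polar n K) y \<partial>lebV n) = (\<integral>\<^sup>+y. ennreal (indicator (polar n K) y * (\<sigma> * y i)) \<partial>lebV n)"
      by (rule nn_integral_cong) (auto split: split_indicator)
    finally show ?thesis .
  qed
  have ni: "nice n (indicator (polar n K))" by (rule nice_indicator) (use R in auto)
  have int: "integrable (lebV n) (\<lambda>y. indicator (polar n K) y * y i)" by (rule nice_integrable_coord[OF ni i])
  have fin: "(\<integral>\<^sup>+y. ennreal (indicator (polar n K) y * (\<sigma> * y i)) \<partial>lebV n) < top" for \<sigma>
  proof -
    have "integrable (lebV n) (\<lambda>y. \<sigma> * (indicator (polar n K) y * y i))" by (rule integrable_mult_right[OF int])
    then have "(\<integral>\<^sup>+y. ennreal (norm (\<sigma> * (indicator (polar n K) y * y i))) \<partial>lebV n) < \<infinity>" unfolding integrable_iff_bounded by (rule conjunct2)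
    moreover have "(\<integral>\<^sup>+y. ennreal (indicator (polar n K) y * (\<sigma> * y i)) \<partial>lebV n) \<le> (\<integral>\<^sup>+y. ennreal (norm (\<sigma> * (indicator (polar n K) y * y i))) \<partial>lebV n)"
      by (rule nn_integral_mono) (auto intro!: ennreal_leI split: split_indicator)
    ultimately show ?thesis unfolding infinity_ennreal_def by (rule le_less_trans[rotated])
  qed
  have fin2: "(\<integral>\<^sup>+y. ennreal (polar_density n K y * (\<sigma> * y i)) \<partial>lebV n) < top" for \<sigma>
    unfolding mom using fin[of \<sigma>] by (simp add: ennreal_mult_less_top)
  show intd: "integrable (lebV n) (\<lambda>y. polar_density n K y * y i)"
  proof (rule integrableI_bounded)
    have "(\<integral>\<^sup>+y. ennreal (norm (polar_density n K y * y i)) \<partial>lebV n) \<le> (\<integral>\<^sup>+y. ennreal (polar_density n K y * (1 * y i)) + ennreal (polar_density n K y * ((-1) * y i)) \<partial>lebV n)"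
    proof (rule nn_integral_mono)
      fix y
      show "ennreal (norm (polar_density n K y * y i)) \<le> ennreal (polar_density n K y * (1 * y i)) + ennreal (polar_density n K y * ((-1) * y i))"
        using polar_density_nonneg[of n K y] by (cases "y i \<ge> 0") (auto simp: abs_mult)
    qed
    also have "\<dots> = (\<integral>\<^sup>+y. ennreal (polar_density n K y * (1 * y i)) \<partial>lebV n) + (\<integral>\<^sup>+y. ennreal (polar_density n K y * ((-1) * y i)) \<partial>lebV n)"
      by (rule nn_integral_add) simp_all
    also have "\<dots> < \<infinity>" using fin2[of 1] fin2[of "-1"] by simp
    finally show "(\<integral>\<^sup>+y. ennreal (norm (polar_density n K y * y i)) \<partial>lebV n) < \<infinity>" .
  qed simp
  show "(\<integral>y. polar_density n K y * y i \<partial>lebV n) = fact (n + 1) * (\<integral>y. indicator (polar n K) y * y i \<partial>lebV n)"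
    unfolding real_lebesgue_integral_def[OF intd] real_lebesgue_integral_def[OF int]
    using mom[of 1] mom[of "-1"] by (simp add: enn2real_mult right_diff_distrib)
qed

section \<open>The first-order condition at the Santalo point\<close>

lemma exp_le_quadratic: "exp v \<le> 1 + v + v^2 * exp \<bar>v\<bar>" for v :: real
proof -
  have a: "exp v - 1 \<le> v * exp v"
  proof -
    have "(1 - v) * exp v \<le> exp (-v) * exp v" using exp_ge_add_one_self[of "-v"] by (intro mult_right_mono) auto
    also have "\<dots> = 1" by (simp add: exp_minus)
    finally show ?thesis by (simp add: algebra_simps)
  qed
  have "v * (exp v - 1) \<le> v^2 * exp \<bar>v\<bar>"
  proof (cases "v \<ge> 0")
    case True
    then have "v * (exp v - 1) \<le> v * (v * exp v)" using a by (rule mult_left_mono[rotated])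
    then show ?thesis using True by (simp add: power2_eq_square mult.assoc)
  next
    case False
    have "v \<le> exp v - 1" using exp_ge_add_one_self[of v] by linarith
    then have "v * (exp v - 1) \<le> v * v" using False by (intro mult_left_mono_neg) auto
    also have "\<dots> \<le> v * v * exp \<bar>v\<bar>" by (simp add: mult_le_cancel_left1 not_less)
    finally show ?thesis by (simp add: power2_eq_square)
  qed
  then show ?thesis using a by (simp add: algebra_simps)
qed

text \<open>A second-order expansion whose remainder is controlled by the two tilts with parameters
  2\<rho> and -2\<rho>, uniformly in \<epsilon>. Their integrability makes differentiation under the
  integral elementary; u^2 is absorbed by e^(\<rho>|u|).\<close>

lemma exp_perturbation:
  fixes u :: real
  assumes "\<rho> > 0" "\<bar>\<epsilon>\<bar> \<le> \<rho>"
  shows "exp (\<epsilon> * u) \<le> 1 + \<epsilon> * u + \<epsilon>^2 * ((2/\<rho>^2) * (exp (2*\<rho>*u) + exp (-2*\<rho>*u)))"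
proof -
  have "\<bar>\<epsilon> * u\<bar> \<le> \<rho> * \<bar>u\<bar>" using assms by (simp add: abs_mult mult_right_mono)
  then have 1: "(\<epsilon> * u)^2 * exp \<bar>\<epsilon> * u\<bar> \<le> (\<epsilon> * u)^2 * exp (\<rho> * \<bar>u\<bar>)" by (intro mult_left_mono) auto
  have "1 + \<rho> * \<bar>u\<bar> + (\<rho> * \<bar>u\<bar>)^2/2 \<le> exp (\<rho> * \<bar>u\<bar>)" using assms by (intro exp_lower_Taylor_quadratic) auto
  then have "(\<rho> * \<bar>u\<bar>)^2/2 \<le> exp (\<rho> * \<bar>u\<bar>)" using assms by (smt (verit) mult_nonneg_nonneg abs_ge_zero)
  then have "u^2 \<le> (2/\<rho>^2) * exp (\<rho> * \<bar>u\<bar>)" using assms by (simp add: power_mult_distrib field_simps)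
  then have "\<epsilon>^2 * (u^2 * exp (\<rho> * \<bar>u\<bar>)) \<le> \<epsilon>^2 * ((2/\<rho>^2) * exp (\<rho> * \<bar>u\<bar>) * exp (\<rho> * \<bar>u\<bar>))"
    by (intro mult_left_mono mult_right_mono) auto
  also have "(2/\<rho>^2) * exp (\<rho> * \<bar>u\<bar>) * exp (\<rho> * \<bar>u\<bar>) = (2/\<rho>^2) * exp (2 * \<rho> * \<bar>u\<bar>)"
    by (simp add: mult.assoc exp_add[symmetric])
  also have "\<epsilon>^2 * \<dots> \<le> \<epsilon>^2 * ((2/\<rho>^2) * (exp (2*\<rho>*u) + exp (-2*\<rho>*u)))"
    by (intro mult_left_mono) (auto simp: abs_if)
  finally show ?thesis using 1 exp_le_quadratic[of "\<epsilon> * u"] by (simp add: power_mult_distrib mult.assoc)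
qed

text \<open>For D \<noteq> 0, a step of length t against the sign of D with t |C| < |D| would make
  the expression negative.\<close>

lemma linear_term_zero:
  fixes D C :: real
  assumes "\<rho> > 0" "\<And>\<epsilon>. \<bar>\<epsilon>\<bar> \<le> \<rho> \<Longrightarrow> 0 \<le> \<epsilon> * D + \<epsilon>^2 * C"
  shows "D = 0"
proof (rule ccontr)
  assume D: "D \<noteq> 0"
  define t where "t = min \<rho> (\<bar>D\<bar> / (2 * (\<bar>C\<bar> + 1)))"
  have t: "t > 0" "t \<le> \<rho>" using assms(1) D by (auto simp: t_def)
  have "t \<le> \<bar>D\<bar> / (2 * (\<bar>C\<bar> + 1))" by (simp add: t_def)
  then have "t * (2 * (\<bar>C\<bar> + 1)) \<le> \<bar>D\<bar>" by (subst (asm) pos_le_divide_eq) auto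
  then have tc: "t * \<bar>C\<bar> < \<bar>D\<bar>" using t(1) D by (simp add: algebra_simps)
  have "0 \<le> (- sgn D * t) * D + (- sgn D * t)^2 * C" using t by (intro assms(2)) (simp add: abs_mult abs_sgn_eq D)
  also have "(- sgn D * t) * D = - t * \<bar>D\<bar>" by (simp add: abs_sgn mult_ac)
  also have "(- sgn D * t)^2 * C = t * (t * C)" using D by (simp add: power2_eq_square sgn_if)
  finally have "t * \<bar>D\<bar> \<le> t * (t * C)" by simp
  then have "\<bar>D\<bar> \<le> t * C" using t(1) by simp
  also have "\<dots> \<le> t * \<bar>C\<bar>" using t(1) by (intro mult_left_mono) auto
  finally show False using tc by simp
qed

text \<open>The Santalo point is moved by \<epsilon> along the i-th axis with either sign.
  Minimality and \<open>exp_perturbation\<close> leave an inequality whose linear coefficient is the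
  i-th moment of the polar density, which must vanish; it is a positive multiple of the moment of
  the polar.\<close>

lemma santalo_point_barycentre_polar:
  assumes K: "compact K" and pos: "lebn n K > 0" and S: "santalo_point n K zvec" and i: "i < n"
  shows "(\<integral>y. indicator (polar n K) y * y i \<partial>lebV n) = 0"
proof -
  have int0: "in_interior n K zvec" using S by (simp add: santalo_point_def)
  obtain \<delta> where \<delta>: "\<delta> > 0" "\<And>y. y \<in> Rn n \<Longrightarrow> (\<And>i. i < n \<Longrightarrow> \<bar>y i - zvec i\<bar> \<le> \<delta>) \<Longrightarrow> y \<in> K"
    using in_interior_cube[OF int0] by blast
  \<comment> \<open>The tilts by 2\<rho> and -2\<rho> must correspond to interior points: 2\<rho> =
    \<delta>/2 leaves room for a cube of half side \<delta>/2 around them.\<close>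
  define \<rho> where "\<rho> = \<delta> / 4"
  have \<rho>: "\<rho> > 0" using \<delta> by (simp add: \<rho>_def)
  define w where "w \<epsilon> = (\<lambda>j. \<epsilon> * unitv i j)" for \<epsilon>
  have wi: "in_interior n K (w \<epsilon>)" if e: "\<bar>\<epsilon>\<bar> \<le> 2 * \<rho>" for \<epsilon>
  proof (rule in_interior_of_cube[where \<delta>="\<delta>/2"])
    show "w \<epsilon> \<in> Rn n" using unitv_Rn[OF i] by (simp add: w_def Rn_def)
    fix y assume y: "y \<in> Rn n" "\<And>j. j < n \<Longrightarrow> \<bar>y j - w \<epsilon> j\<bar> \<le> \<delta>/2"
    show "y \<in> K"
    proof (rule \<delta>(2)[OF y(1)])
      fix j assume "j < n"
      have "\<bar>w \<epsilon> j\<bar> \<le> \<delta>/2" using e \<delta>(1) by (auto simp: w_def unitv_def \<rho>_def)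
      moreover have "\<bar>y j - w \<epsilon> j\<bar> \<le> \<delta>/2" using y(2) \<open>j < n\<close> by blast
      ultimately show "\<bar>y j - zvec j\<bar> \<le> \<delta>" unfolding zvec_def by linarith
    qed
  qed (use \<delta> in auto)
  have wip: "ip n (w \<epsilon>) y = \<epsilon> * y i" for \<epsilon> y
    unfolding w_def ip_scale_left by (subst ip_commute) (simp add: ip_unitv[OF i])
  let ?E = "polar_density n K"
  have J: "integrable (lebV n) (\<lambda>y. ?E y * exp (\<epsilon> * y i))" "(\<integral>y. ?E y * exp (\<epsilon> * y i) \<partial>lebV n) = fact n * lebn n (polar_at n K (w \<epsilon>))" if "\<bar>\<epsilon>\<bar> \<le> 2 * \<rho>" for \<epsilon>
    using tilt_integrable[OF K int0 wi[OF that]] unfolding wip by auto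
  have w0: "w 0 = zvec" by (simp add: w_def zvec_def)
  have intE: "integrable (lebV n) ?E" using J(1)[of 0] \<rho> by simp
  have intEy: "integrable (lebV n) (\<lambda>y. ?E y * y i)" by (rule polar_density_moment(1)[OF K int0 i])
  define D where "D = (\<integral>y. ?E y * y i \<partial>lebV n)"
  define Cf where "Cf y = (2/\<rho>^2) * (?E y * exp (2*\<rho> * y i) + ?E y * exp (-2*\<rho> * y i))" for y
  have intC: "integrable (lebV n) Cf" unfolding Cf_def
    using J(1)[of "2*\<rho>"] J(1)[of "-2*\<rho>"] \<rho> by (intro integrable_mult_right Bochner_Integration.integrable_add) auto
  define C where "C = (\<integral>y. Cf y \<partial>lebV n)"
  have "0 \<le> \<epsilon> * D + \<epsilon>^2 * C" if e: "\<bar>\<epsilon>\<bar> \<le> \<rho>" for \<epsilon>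
  proof -
    have e2: "\<bar>\<epsilon>\<bar> \<le> 2 * \<rho>" using e \<rho> by linarith
    have "lebn n K * lebn n (polar_at n K zvec) \<le> lebn n K * lebn n (polar_at n K (w \<epsilon>))"
      using S wi[OF e2] unfolding santalo_point_def by blast
    then have "lebn n (polar_at n K zvec) \<le> lebn n (polar_at n K (w \<epsilon>))" using pos by simp
    then have "(\<integral>y. ?E y \<partial>lebV n) \<le> (\<integral>y. ?E y * exp (\<epsilon> * y i) \<partial>lebV n)"
      using J(2)[OF e2] J(2)[of 0] \<rho> unfolding w0 by (simp add: mult_left_mono)
    also have "\<dots> \<le> (\<integral>y. ?E y + \<epsilon> * (?E y * y i) + \<epsilon>^2 * Cf y \<partial>lebV n)"
    proof (rule integral_mono)
      fix y
      have "?E y * exp (\<epsilon> * y i) \<le> ?E y * (1 + \<epsilon> * y i + \<epsilon>^2 * ((2/\<rho>^2) * (exp (2*\<rho>*y i) + exp (-2*\<rho>*y i))))"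
        by (intro mult_left_mono exp_perturbation \<rho> e polar_density_nonneg)
      also have "\<dots> = ?E y + \<epsilon> * (?E y * y i) + \<epsilon>^2 * Cf y" unfolding Cf_def by (simp only: distrib_left mult_1_right mult_ac)
      finally show "?E y * exp (\<epsilon> * y i) \<le> ?E y + \<epsilon> * (?E y * y i) + \<epsilon>^2 * Cf y" .
    qed (use J(1)[OF e2] intE intEy intC in auto)
    also have "\<dots> = (\<integral>y. ?E y \<partial>lebV n) + \<epsilon> * D + \<epsilon>^2 * C"
      unfolding D_def C_def using intE intEy intC by simp
    finally show ?thesis by simp
  qed
  then have "D = 0" by (rule linear_term_zero[OF \<rho>])
  then show ?thesis unfolding D_def polar_density_moment(2)[OF K int0 i] by simp
qed

lemma AE_lebV_translate:
  assumes "AE x in lebV n. P x" "z \<in> Rn n" and [measurable]: "Measurable.pred borel P"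
  shows "AE x in lebV n. P (\<lambda>i. z i + x i)"
proof -
  note vec_add_measurable[measurable (raw)]
  have "AE x in distr (lebV n) borel (\<lambda>x i. z i + x i). P x" by (subst lebV_translate_distr[OF assms(2), symmetric]) (rule assms(1))
  then show ?thesis by (subst (asm) AE_distr_iff) auto
qed

text \<open>By translation invariance <w,y> and <w, w + y> both vanish for almost every y; their
  difference is <w,w>.\<close>

lemma AE_hyperplane_imp_zero:
  assumes "AE y in lebV n. ip n w y = 0" "w \<in> Rn n" shows "w = zvec"
proof -
  have "AE y in lebV n. ip n w (\<lambda>i. w i + y i) = 0" by (rule AE_lebV_translate[OF assms]) measurable
  with assms(1) have "AE y in lebV n. ip n w w = 0" by eventually_elim (simp add: ip_add_right)
  moreover have "\<not> (AE y in lebV n. False)"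
  proof
    assume "AE y in lebV n. False"
    then obtain N where "{y \<in> space (lebV n). \<not> False} \<subseteq> N" "emeasure (lebV n) N = 0" "N \<in> sets (lebV n)" by (rule AE_E)
    then have "emeasure (lebV n) (cube n 1) \<le> 0" using emeasure_mono[of "cube n 1" N "lebV n"] by auto
    then show False by (simp add: emeasure_lebV_cube)
  qed
  ultimately have "ip n w w = 0" by (cases "ip n w w = 0") auto
  then have "w i = 0" for i using ip_eq_0[of n w i] assms(2) by (cases "i < n") (auto simp: Rn_def)
  then show ?thesis by (auto simp: zvec_def)
qed

text \<open>The converse direction, used for the polar of the simplex. Integrating e^v \<ge> 1 + v
  with v = <w,y> against the centred positive density makes the origin a minimiser, and the equality
  case of this inequality makes it the only one.\<close>

lemma santalo_pointI:
  assumes K: "compact K" and int0: "in_interior n K zvec" and pos: "lebn n K > 0"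
    and bary: "\<forall>i<n. (\<integral>y. indicator (polar n K) y * y i \<partial>lebV n) = 0"
  shows "santalo_point n K zvec"
proof -
  let ?E = "polar_density n K"
  have iz: "ip n zvec y = 0" for y by (simp add: zvec_def ip_def)
  note I0 = tilt_integrable[OF K int0 int0]
  have intE: "integrable (lebV n) ?E" using I0(1) unfolding iz by simp
  have key: "lebn n (polar_at n K zvec) \<le> lebn n (polar_at n K w)"
    "lebn n (polar_at n K w) \<le> lebn n (polar_at n K zvec) \<Longrightarrow> w = zvec" if w: "in_interior n K w" for w
  proof -
    note Iw = tilt_integrable[OF K int0 w]
    have wR: "w \<in> Rn n" using w by (simp add: in_interior_def)
    have intW: "integrable (lebV n) (\<lambda>y. ?E y * ip n w y)"
    proof -
      have "integrable (lebV n) (\<lambda>y. \<Sum>i<n. w i * (?E y * y i))"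
        by (intro Bochner_Integration.integrable_sum integrable_mult_right) (use polar_density_moment(1)[OF K int0] in auto)
      then show ?thesis by (simp add: ip_def sum_distrib_left mult_ac)
    qed
    have "(\<integral>y. ?E y * ip n w y \<partial>lebV n) = (\<integral>y. (\<Sum>i<n. w i * (?E y * y i)) \<partial>lebV n)"
      by (simp add: ip_def sum_distrib_left mult_ac)
    also have "\<dots> = (\<Sum>i<n. \<integral>y. w i * (?E y * y i) \<partial>lebV n)"
      by (rule Bochner_Integration.integral_sum) (use polar_density_moment(1)[OF K int0] in auto)
    also have "\<dots> = 0" using polar_density_moment(2)[OF K int0] bary by simp
    finally have W0: "(\<integral>y. ?E y * ip n w y \<partial>lebV n) = 0" .
    define G where "G y = ?E y * exp (ip n w y) - (?E y + ?E y * ip n w y)" for y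
    have intG: "integrable (lebV n) G" unfolding G_def
      by (intro Bochner_Integration.integrable_diff Bochner_Integration.integrable_add Iw(1) intE intW)
    have Gnn: "G y \<ge> 0" for y
    proof -
      have "G y = ?E y * (exp (ip n w y) - (1 + ip n w y))" by (simp add: G_def algebra_simps)
      then show ?thesis using exp_ge_add_one_self[of "ip n w y"] polar_density_nonneg[of n K y] by simp
    qed
    have "(\<integral>y. G y \<partial>lebV n) = (\<integral>y. ?E y * exp (ip n w y) \<partial>lebV n) - ((\<integral>y. ?E y \<partial>lebV n) + (\<integral>y. ?E y * ip n w y \<partial>lebV n))"
      unfolding G_def by (simp add: Iw(1) intE intW)
    also have "\<dots> = fact n * lebn n (polar_at n K w) - fact n * lebn n (polar_at n K zvec)"
      using Iw(2) I0(2) W0 unfolding iz by simp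
    finally have IG: "(\<integral>y. G y \<partial>lebV n) = fact n * (lebn n (polar_at n K w) - lebn n (polar_at n K zvec))"
      by (simp add: right_diff_distrib)
    have nn: "(\<integral>y. G y \<partial>lebV n) \<ge> 0" using Gnn by (intro integral_nonneg_AE) auto
    show "lebn n (polar_at n K zvec) \<le> lebn n (polar_at n K w)"
    proof (rule ccontr)
      assume "\<not> ?thesis"
      then have "fact n * (lebn n (polar_at n K w) - lebn n (polar_at n K zvec)) < 0" by (intro mult_pos_neg) auto
      then show False using nn unfolding IG by linarith
    qed
    assume "lebn n (polar_at n K w) \<le> lebn n (polar_at n K zvec)"
    then have "(\<integral>y. G y \<partial>lebV n) \<le> 0" unfolding IG by (intro mult_nonneg_nonpos) auto
    then have "(\<integral>y. G y \<partial>lebV n) = 0" using nn by simp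
    then have "AE y in lebV n. G y = 0" using integral_nonneg_eq_0_iff_AE[OF intG] Gnn by auto
    then have "AE y in lebV n. ip n w y = 0" using AE_lebV_Rn
    proof eventually_elim
      case (elim y)
      have "?E y > 0" using polar_density_eq[OF K in_interior_mem[OF int0] elim(2)] by simp
      moreover have "?E y * (exp (ip n w y) - (1 + ip n w y)) = 0" using elim(1) by (simp add: G_def algebra_simps)
      ultimately have e: "exp (ip n w y) = 1 + ip n w y" by simp
      \<comment> \<open>With x = e^v the equality e^v = 1 + v reads ln x = x - 1, which forces x =
        1.\<close>
      have "ln (exp (ip n w y)) = exp (ip n w y) - 1" unfolding ln_exp using e by linarith
      then have "exp (ip n w y) = 1" by (rule ln_eq_minus_one[OF exp_gt_zero])
      then show "ip n w y = 0" by simp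
    qed
    then show "w = zvec" using AE_hyperplane_imp_zero wR by blast
  qed
  show ?thesis unfolding santalo_point_def
    using key int0 pos by auto
qed

text \<open>Both centrings lead to the same inequality for the volume product, one with K and the
  other with its polar as the centred body, so a single root extraction finishes.\<close>

theorem volume_product_upper:
  assumes l: "1 \<le> l" "l < n" and K: "convex_body n K"
    and c: "barycentre n K = zvec \<or> santalo_point n K zvec" and F: "F \<in> Grass n l"
  shows "(measF n l F (Proj n F ` K) * measF n l F (polar n K \<inter> F)) powr (1 / real l)
      \<le> 48 * (real n / real l) * unit_ball_vol (real l) powr (2 / real l)"
proof -
  obtain u where u: "onb n l u F" using F by (auto simp: Grass_def)
  have Kc: "compact K" "is_convex K" "K \<subseteq> Rn n" and "\<exists>x. in_interior n K x" using K by (auto simp: convex_body_def)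
  then obtain x where x: "in_interior n K x" by blast
  have Km: "K \<in> sets borel" using Kc by (simp add: compact_vec_borel)
  obtain R where R: "R > 0" "\<And>x i. x \<in> K \<Longrightarrow> i < n \<Longrightarrow> \<bar>x i\<bar> \<le> R" using compact_vec_bounded[OF Kc(1), of n] by blast
  have fin: "emeasure (lebV n) K < top" by (rule lebV_cube_finite[of K n R]) (use R Km in \<open>auto simp: cube_def\<close>)
  have pos: "emeasure (lebV n) K \<noteq> 0" by (rule interior_emeasure_pos[OF x Km])
  have lpos: "lebn n K > 0" unfolding lebn_eq[OF Km] using pos fin by (simp add: measure_def enn2real_positive_iff zero_less_iff_neq_zero)
  have "((real l / real n)^l * (1 - real l / real n)^(n - l)) * fact l * (measF n l F (Proj n F ` K) * measF n l F (polar n K \<inter> F)) \<le> 16^l"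
    using c
  proof
    assume "barycentre n K = zvec"
    then have b: "\<forall>i<n. (\<integral>x. indicator K x * x i \<partial>lebV n) = 0" using barycentre_zero_iff[OF Km] lpos by auto
    show ?thesis by (rule volume_product_barycentre[OF l u Kc pos b])
  next
    assume S: "santalo_point n K zvec"
    then have int0: "in_interior n K zvec" by (simp add: santalo_point_def)
    obtain R' where R': "R' > 0" "polar n K \<subseteq> cube n R'" using polar_at_bounded[OF int0] unfolding polar_at_zvec by blast
    have b: "\<forall>i<n. (\<integral>y. indicator (polar n K) y * y i \<partial>lebV n) = 0"
      using santalo_point_barycentre_polar[OF Kc(1) lpos S] by blast
    show ?thesis by (rule volume_product_polar_barycentre[OF l u Kc(1,3) R'(2,1) b])
  qed
  moreover have "0 \<le> measF n l F (Proj n F ` K) * measF n l F (polar n K \<inter> F)"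
    by (simp add: measF_def lebn_def)
  ultimately show ?thesis by (intro volume_product_root_le[OF l])
qed

section \<open>The polar of the regular simplex\<close>

lemma emeasure_simplex:
  assumes "0 \<le> t"
  shows "emeasure (lebV l) {x. (\<forall>i<l. 0 \<le> x i) \<and> (\<Sum>i<l. x i) \<le> t} = ennreal (t ^ l / fact l)"
proof -
  have [measurable]: "{x :: vec. (\<forall>i<l. 0 \<le> x i) \<and> (\<Sum>i<l. x i) \<le> t} \<in> sets borel" by measurable
  have "emeasure (lebV l) {x. (\<forall>i<l. 0 \<le> x i) \<and> (\<Sum>i<l. x i) \<le> t} =
    emeasure (lebM l) (ext0 l -` {x. (\<forall>i<l. 0 \<le> x i) \<and> (\<Sum>i<l. x i) \<le> t} \<inter> space (lebM l))"
    unfolding lebV_def by (rule emeasure_distr) simp_all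
  also have "ext0 l -` {x. (\<forall>i<l. 0 \<le> x i) \<and> (\<Sum>i<l. x i) \<le> t} \<inter> space (lebM l) =
    {x. (\<forall>i\<in>{..<l}. 0 \<le> x i) \<and> sum x {..<l} \<le> t} \<inter> space (lebM l)"
    by (auto simp: ext0_def)
  also have "emeasure (lebM l) \<dots> = ennreal (t ^ l / fact l)"
    using emeasure_std_simplex_aux[of "{..<l}" t] assms unfolding lebM_def by simp
  finally show ?thesis .
qed

text \<open>Tychonoff: a product of intervals in the first n coordinates and of {0} in all others is
  compact.\<close>

lemma closed_bounded_compact:
  assumes "closed (C :: vec set)" "C \<subseteq> Rn n" "C \<subseteq> cube n R"
  shows "compact C"
proof -
  define B where "B i = (if i < n then {-R..R} else {0})" for i :: nat
  have "compactin (product_topology (\<lambda>i. euclidean) UNIV) (Pi\<^sub>E UNIV B)"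
    unfolding compactin_PiE by (auto simp: B_def)
  then have "compact (Pi\<^sub>E UNIV B)" unfolding euclidean_product_topology by simp
  moreover have "C \<subseteq> Pi\<^sub>E UNIV B"
  proof
    fix x assume "x \<in> C"
    then have x: "x \<in> Rn n" "x \<in> cube n R" using assms by auto
    have "x i \<in> B i" for i
    proof (cases "i < n")
      case True
      then have "\<bar>x i\<bar> \<le> R" using x(2) by (simp add: cube_def)
      then show ?thesis using True by (auto simp: B_def)
    qed (use x(1) in \<open>auto simp: B_def Rn_def\<close>)
    then show "x \<in> Pi\<^sub>E UNIV B" by auto
  qed
  ultimately show ?thesis using assms(1) compact_Int_closed[of "Pi\<^sub>E UNIV B" C] by (simp add: Int_absorb1)
qed

section \<open>Reflections, and barycentres by symmetry\<close>

definition reflect :: "nat \<Rightarrow> vec \<Rightarrow> vec \<Rightarrow> vec" where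
  "reflect n e x = (\<lambda>i. x i + (- (2 * ip n x e / ip n e e)) * e i)"

lemma reflect_Rn: "x \<in> Rn n \<Longrightarrow> e \<in> Rn n \<Longrightarrow> reflect n e x \<in> Rn n"
  by (simp add: reflect_def Rn_def)

lemma ip_reflect_left: "ip n (reflect n e x) y = ip n x y - 2 * ip n x e / ip n e e * ip n e y"
  unfolding reflect_def ip_add_left ip_scale_left by simp

lemma ip_reflect_sym: "ip n (reflect n e x) y = ip n x (reflect n e y)"
proof -
  have "ip n x (reflect n e y) = ip n y x - 2 * ip n y e / ip n e e * ip n e x"
    by (subst ip_commute) (rule ip_reflect_left)
  then show ?thesis unfolding ip_reflect_left by (simp add: ip_commute)
qed

lemma reflect_reflect:
  assumes "ip n e e \<noteq> 0" shows "reflect n e (reflect n e x) = x"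
proof
  fix i
  have "ip n (reflect n e x) e = - ip n x e" unfolding ip_reflect_left using assms by simp
  then show "reflect n e (reflect n e x) i = x i" unfolding reflect_def[of n e "reflect n e x"] by (simp add: reflect_def)
qed

text \<open>The reflection is orthogonal, since its images of the unit vectors are orthonormal. It
  preserves M and the measure and changes the sign of <x,e>, so the integral equals its own
  negative.\<close>

lemma reflect_integral_zero:
  assumes e: "e \<in> Rn n" "ip n e e \<noteq> 0" and M[measurable]: "M \<in> sets borel"
    and inv: "\<And>x. x \<in> M \<Longrightarrow> reflect n e x \<in> M"
  shows "(\<integral>x. indicator M x * ip n x e \<partial>lebV n) = 0"
proof -
  define r where "r j = reflect n e (unitv j)" for j
  have r: "orthonormal n n r" unfolding orthonormal_def
  proof (intro conjI allI impI)
    fix j assume "j < n" then show "r j \<in> Rn n" unfolding r_def using e unitv_Rn reflect_Rn by blast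
  next
    fix i j assume ij: "i < n" "j < n"
    have "ip n (r i) (r j) = ip n (unitv i) (unitv j)"
      unfolding r_def ip_reflect_sym reflect_reflect[OF e(2)] ..
    then show "ip n (r i) (r j) = (if i = j then 1 else 0)" using ij by (simp add: ip_unitv) (simp add: unitv_def)
  qed
  have T: "lincomb n r c = reflect n e c" if c: "c \<in> Rn n" for c
  proof
    fix a
    have s: "(\<Sum>j<n. c j * unitv j a) = c a"
    proof (cases "a < n")
      case True
      have "(\<Sum>j<n. c j * unitv j a) = (\<Sum>j<n. if j = a then c j else 0)"
        by (rule sum.cong) (auto simp: unitv_def)
      then show ?thesis using True by simp
    next
      case False
      then have "(\<Sum>j<n. c j * unitv j a) = 0" by (intro sum.neutral) (auto simp: unitv_def)
      then show ?thesis using c False by (simp add: Rn_def)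
    qed
    have "lincomb n r c a = (\<Sum>j<n. c j * unitv j a + (- (2 / ip n e e) * e a) * (c j * e j))"
      unfolding lincomb_def
    proof (rule sum.cong[OF refl])
      fix j assume "j \<in> {..<n}"
      then have "ip n (unitv j) e = e j" by (subst ip_commute) (simp add: ip_unitv)
      then show "c j * r j a = c j * unitv j a + (- (2 / ip n e e) * e a) * (c j * e j)"
        by (simp add: r_def reflect_def algebra_simps)
    qed
    also have "\<dots> = c a + (- (2 / ip n e e) * e a) * ip n c e"
      unfolding sum.distrib s sum_distrib_left[symmetric] by (simp add: ip_def)
    finally show "lincomb n r c a = reflect n e c a" by (simp add: reflect_def)
  qed
  have inv': "reflect n e x \<in> M \<longleftrightarrow> x \<in> M" for x
    using inv[of x] inv[of "reflect n e x"] reflect_reflect[OF e(2), of x] by auto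
  have "(\<integral>x. indicator M x * ip n x e \<partial>lebV n) = (\<integral>c. indicator M (lincomb n r c) * ip n (lincomb n r c) e \<partial>lebV n)"
    by (subst lebV_orthonormal_distr[OF r], rule integral_distr) auto
  also have "\<dots> = (\<integral>c. - (indicator M c * ip n c e) \<partial>lebV n)"
  proof (rule integral_cong_AE)
    show "AE c in lebV n. indicator M (lincomb n r c) * ip n (lincomb n r c) e = - (indicator M c * ip n c e)"
      using AE_lebV_Rn
    proof eventually_elim
      case (elim c)
      have "ip n (reflect n e c) e = - ip n c e" unfolding ip_reflect_left using e(2) by simp
      then show ?case unfolding T[OF elim] by (simp add: indicator_def inv')
    qed
  qed simp_all
  finally show ?thesis by simp
qed

text \<open>Symmetry under the reflection in v_j - v_k equates the moments against v_j and v_k. All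
  n + 1 moments are equal and add up to 0, because the vertices do.\<close>

lemma simplex_barycentre_zero:
  assumes v: "\<And>k. k \<le> n \<Longrightarrow> v k \<in> Rn n"
    and gram: "\<And>j k. j \<le> n \<Longrightarrow> k \<le> n \<Longrightarrow> ip n (v j) (v k) = (if j = k then real n else -1)"
    and sum0: "\<And>i. (\<Sum>k\<le>n. v k i) = 0"
    and M[measurable]: "M \<in> sets borel" "M \<subseteq> cube n R" "R \<ge> 0"
    and inv: "\<And>j k x. j \<le> n \<Longrightarrow> k \<le> n \<Longrightarrow> j \<noteq> k \<Longrightarrow> x \<in> M \<Longrightarrow> reflect n (\<lambda>i. v j i - v k i) x \<in> M"
    and j: "j \<le> n"
  shows "(\<integral>x. indicator M x * ip n x (v j) \<partial>lebV n) = 0"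
proof -
  have ni: "nice n (indicator M)" by (rule nice_indicator[OF M])
  have int: "integrable (lebV n) (\<lambda>x. indicator M x * ip n x y)" for y
    by (rule nice_integrable[OF ni]) (auto intro: cube_ip_bound)
  have eq: "(\<integral>x. indicator M x * ip n x (v j) \<partial>lebV n) = (\<integral>x. indicator M x * ip n x (v k) \<partial>lebV n)" if k: "k \<le> n" for k
  proof (cases "j = k")
    case False
    define e where "e = (\<lambda>i. v j i - v k i)"
    have eR: "e \<in> Rn n" using v j k by (simp add: e_def Rn_def)
    have "ip n e e = 2 * (real n + 1)" unfolding e_def ip_diff_left ip_diff_right using gram j k False by simp
    then have "(\<integral>x. indicator M x * ip n x e \<partial>lebV n) = 0"
      using inv[OF j k False] by (intro reflect_integral_zero[OF eR]) (auto simp: e_def)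
    moreover have "(\<integral>x. indicator M x * ip n x e \<partial>lebV n) = (\<integral>x. indicator M x * ip n x (v j) - indicator M x * ip n x (v k) \<partial>lebV n)"
      unfolding e_def ip_diff_right by (simp add: right_diff_distrib)
    ultimately show ?thesis using int by simp
  qed simp
  have s0: "(\<Sum>k\<le>n. ip n x (v k)) = 0" for x
  proof -
    have "(\<Sum>k\<le>n. ip n x (v k)) = ip n x (\<lambda>i. \<Sum>k\<le>n. v k i)" by (rule ip_sum_right[symmetric])
    then show ?thesis unfolding sum0 by (simp add: ip_zero_right)
  qed
  have "(real n + 1) * (\<integral>x. indicator M x * ip n x (v j) \<partial>lebV n) = (\<Sum>k\<le>n. \<integral>x. indicator M x * ip n x (v j) \<partial>lebV n)"
    by (simp add: algebra_simps)
  also have "\<dots> = (\<Sum>k\<le>n. \<integral>x. indicator M x * ip n x (v k) \<partial>lebV n)" using eq by (intro sum.cong) auto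
  also have "\<dots> = (\<integral>x. (\<Sum>k\<le>n. indicator M x * ip n x (v k)) \<partial>lebV n)"
    by (rule Bochner_Integration.integral_sum[symmetric]) (rule int)
  also have "\<dots> = 0" unfolding sum_distrib_left[symmetric] s0 by simp
  finally show ?thesis by simp
qed

text \<open>The constants are chosen so that the Gram matrix of the $n+1$ vertices is $(n+1)I-J$, with $J$
  the all-ones matrix.\<close>
definition simplex_vertex :: "nat \<Rightarrow> nat \<Rightarrow> vec" where
  "simplex_vertex n k = (\<lambda>i. if i < n then
     (if k < n then (if i = k then sqrt (real n + 1) else 0) - (sqrt (real n + 1) - 1) / real n else -1) else 0)"

section \<open>The regular simplex, its polar and their symmetries\<close>

locale standard_simplex =
  fixes n :: nat assumes n: "n \<ge> 1"
begin

abbreviation "v \<equiv> simplex_vertex n"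
definition "a = sqrt (real n + 1)"
definition "b = (a - 1) / real n"

lemma a: "a > 1" "a * a = real n + 1"
  using n by (auto simp: a_def)

lemma b: "real n * b = a - 1" "b \<ge> 0"
  using n a by (auto simp: b_def)

lemma v_lt: "k < n \<Longrightarrow> i < n \<Longrightarrow> v k i = a * unitv k i - b"
  by (simp add: simplex_vertex_def a_def b_def unitv_def)

lemma v_n: "i < n \<Longrightarrow> v n i = -1"
  by (simp add: simplex_vertex_def)

lemma v_Rn: "v k \<in> Rn n"
  by (simp add: simplex_vertex_def Rn_def)

lemma ip_v_lt: "k < n \<Longrightarrow> ip n x (v k) = a * x k - b * (\<Sum>i<n. x i)"
proof -
  assume k: "k < n"
  have "ip n x (v k) = (\<Sum>i<n. a * (x i * unitv k i) - b * x i)"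
    unfolding ip_def
  proof (rule sum.cong[OF refl])
    fix i assume "i \<in> {..<n}"
    then have "v k i = a * unitv k i - b" using v_lt[OF k] by simp
    then show "x i * v k i = a * (x i * unitv k i) - b * x i" by (simp only:) (simp add: algebra_simps)
  qed
  also have "\<dots> = a * ip n x (unitv k) - b * (\<Sum>i<n. x i)"
    by (simp add: sum_subtractf sum_distrib_left ip_def)
  finally show ?thesis using ip_unitv[OF k] by simp
qed

lemma ip_v_n: "ip n x (v n) = - (\<Sum>i<n. x i)"
  unfolding ip_def sum_negf[symmetric] by (rule sum.cong) (auto simp: v_n)

lemma sum_v_lt: "k < n \<Longrightarrow> (\<Sum>i<n. v k i) = 1"
proof -
  assume k: "k < n"
  have "(\<Sum>i<n. v k i) = - ip n (v k) (v n)" by (simp add: ip_v_n)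
  also have "\<dots> = - ip n (v n) (v k)" by (simp add: ip_commute)
  also have "\<dots> = - (a * v n k - b * (\<Sum>i<n. v n i))" using ip_v_lt[OF k] by simp
  also have "(\<Sum>i<n. v n i) = - real n" by (simp add: v_n)
  also have "- (a * v n k - b * (- real n)) = a - real n * b" using v_n[OF k] by (simp add: mult.commute)
  finally show ?thesis using b(1) by simp
qed

lemma gram: "j \<le> n \<Longrightarrow> k \<le> n \<Longrightarrow> ip n (v j) (v k) = (if j = k then real n else -1)"
proof -
  assume "j \<le> n" "k \<le> n"
  then consider "k = n" "j = n" | "k = n" "j < n" | "k < n" "j = n" | "k < n" "j < n" by linarith
  then show ?thesis
  proof cases
    case 1 then show ?thesis by (simp add: ip_v_n) (simp add: v_n)
  next
    case 2 then show ?thesis using sum_v_lt[of j] by (simp add: ip_v_n)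
  next
    case 3
    then show ?thesis using sum_v_lt[of k] by (subst ip_commute) (simp add: ip_v_n)
  next
    case 4
    have "ip n (v j) (v k) = a * (a * unitv j k - b) - b" using 4 ip_v_lt[of k "v j"] sum_v_lt[of j] v_lt[of j k] by simp
    also have "\<dots> = (a * a) * unitv j k - (a + 1) * b" by (simp add: algebra_simps)
    also have "\<dots> = (real n + 1) * unitv j k - (a + 1) * b" unfolding a(2) ..
    also have "(a + 1) * b = 1"
    proof -
      have "real n * ((a + 1) * b) = (a + 1) * (a - 1)" using b(1) by (simp add: mult_ac)
      also have "\<dots> = real n * 1" using a(2) by (simp add: algebra_simps)
      finally show ?thesis using n by (subst (asm) mult_left_cancel) auto
    qed
    finally show ?thesis by (auto simp: unitv_def)
  qed
qed

lemma sum_v: "(\<Sum>k\<le>n. v k i) = 0"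
proof (cases "i < n")
  case True
  have "(\<Sum>k\<le>n. v k i) = (\<Sum>k<n. v k i) + v n i" by (simp add: lessThan_Suc_atMost[symmetric])
  also have "(\<Sum>k<n. v k i) = (\<Sum>k<n. (if k = i then a else 0) - b)"
    by (rule sum.cong) (use v_lt True in \<open>auto simp: unitv_def\<close>)
  also have "\<dots> = a - real n * b" using True by (simp add: sum_subtractf)
  finally show ?thesis using b(1) v_n[OF True] by simp
qed (simp add: simplex_vertex_def)

lemma ip_sum_v: "(\<Sum>k\<le>n. ip n x (v k)) = 0"
proof -
  have "(\<Sum>k\<le>n. ip n x (v k)) = ip n x (\<lambda>i. \<Sum>k\<le>n. v k i)" by (rule ip_sum_right[symmetric])
  then show ?thesis unfolding sum_v by (simp add: ip_zero_right)
qed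

text \<open>An explicit form of the fact that the vertices span R^n; it carries bounds and moments
  from pairings with vertices to coordinates.\<close>

lemma coord_v: "i < n \<Longrightarrow> x i = (ip n x (v i) - b * ip n x (v n)) / a"
  using ip_v_lt[of i x] ip_v_n[of x] a(1) by (simp add: field_simps)

definition S :: "vec set" where
  "S = {(\<lambda>i. \<Sum>k\<le>n. t k * v k i) | t. (\<forall>k\<le>n. 0 \<le> t k) \<and> (\<Sum>k\<le>n. t k) = 1}"

lemma S_regular: "regular_simplex_centred n S"
  unfolding regular_simplex_centred_def
proof (intro exI[of _ v] exI[of _ "2 * (real n + 1)"] conjI allI impI)
  fix j k assume "j \<le> n" "k \<le> n" "j \<noteq> k"
  then show "ip n (vdiff (v j) (v k)) (vdiff (v j) (v k)) = 2 * (real n + 1)"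
    unfolding vdiff_def ip_diff_left ip_diff_right using gram by simp
qed (use v_Rn sum_v in \<open>auto simp: S_def\<close>)

definition K :: "vec set" where "K = polar n S"

lemma v_S: "k \<le> n \<Longrightarrow> v k \<in> S"
proof -
  assume k: "k \<le> n"
  have "(\<Sum>j\<le>n. (if j = k then 1 else 0) * v j i) = v k i" for i
  proof -
    have "(\<Sum>j\<le>n. (if j = k then 1 else 0) * v j i) = (\<Sum>j\<le>n. if j = k then v j i else 0)" by (rule sum.cong) auto
    then show ?thesis using k by simp
  qed
  then have "v k = (\<lambda>i. \<Sum>j\<le>n. (if j = k then 1 else 0) * v j i)" by auto
  then show ?thesis unfolding S_def using k by (intro CollectI exI[of _ "\<lambda>j. if j = k then 1 else 0"]) auto
qed

lemma K_iff: "x \<in> K \<longleftrightarrow> x \<in> Rn n \<and> (\<forall>k\<le>n. ip n x (v k) \<le> 1)"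
proof
  assume "x \<in> K" then show "x \<in> Rn n \<and> (\<forall>k\<le>n. ip n x (v k) \<le> 1)"
    using v_S by (auto simp: K_def polar_def ip_commute)
next
  assume x: "x \<in> Rn n \<and> (\<forall>k\<le>n. ip n x (v k) \<le> 1)"
  have "ip n s x \<le> 1" if s: "s \<in> S" for s
  proof -
    obtain t where t: "s = (\<lambda>i. \<Sum>k\<le>n. t k * v k i)" "\<forall>k\<le>n. 0 \<le> t k" "(\<Sum>k\<le>n. t k) = 1" using s unfolding S_def by blast
    have "ip n s x = (\<Sum>k\<le>n. t k * ip n x (v k))"
      unfolding t(1) by (subst ip_commute, subst ip_sum_right) (simp add: ip_scale_right)
    also have "\<dots> \<le> (\<Sum>k\<le>n. t k * 1)" using x t by (intro sum_mono mult_left_mono) auto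
    finally show ?thesis using t by simp
  qed
  then show "x \<in> K" using x by (auto simp: K_def polar_def)
qed

lemma S_subset_polar: "S \<subseteq> polar n K"
proof
  fix s assume s: "s \<in> S"
  then have "s \<in> Rn n" using v_Rn by (auto simp: S_def Rn_def)
  moreover have "ip n x s \<le> 1" if "x \<in> K" for x using that s unfolding K_def polar_def by (auto simp: ip_commute)
  ultimately show "s \<in> polar n K" by (simp add: polar_def)
qed

definition "RK = real n * (1 + b)"

lemma K_cube: "K \<subseteq> cube n RK" "RK \<ge> 0"
proof -
  show "RK \<ge> 0" using b by (simp add: RK_def)
  show "K \<subseteq> cube n RK"
  proof
    fix x assume x: "x \<in> K"
    have le: "ip n x (v k) \<le> 1" if "k \<le> n" for k using x that by (simp add: K_iff)
    \<comment> \<open>The pairings of x with all vertices add up to 0 and the other n are at most 1,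
      so none can be below -n.\<close>
    have ge: "ip n x (v k) \<ge> - real n" if k: "k \<le> n" for k
    proof -
      have "0 = ip n x (v k) + (\<Sum>j\<in>{..n}-{k}. ip n x (v j))"
        using ip_sum_v[of x] sum.remove[of "{..n}" k "\<lambda>j. ip n x (v j)"] k by simp
      also have "(\<Sum>j\<in>{..n}-{k}. ip n x (v j)) \<le> (\<Sum>j\<in>{..n}-{k}. 1)" by (rule sum_mono) (use le in auto)
      also have "(\<Sum>j\<in>{..n}-{k}. 1 :: real) = real n" using k by (simp add: card_Diff_singleton)
      finally show ?thesis by linarith
    qed
    have "1 \<le> real n" using n by simp
    have abs: "\<bar>ip n x (v k)\<bar> \<le> real n" if "k \<le> n" for k using le[OF that] ge[OF that] \<open>1 \<le> real n\<close> by linarith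
    have "\<bar>x i\<bar> \<le> RK" if i: "i < n" for i
    proof -
      have "a * x i = ip n x (v i) - b * ip n x (v n)" using coord_v[OF i, of x] a(1) by (simp add: field_simps)
      then have "\<bar>a * x i\<bar> \<le> \<bar>ip n x (v i)\<bar> + b * \<bar>ip n x (v n)\<bar>" using b(2) by (simp add: abs_mult abs_triangle_ineq4 order_trans[OF abs_triangle_ineq4])
      also have "\<dots> \<le> real n + b * real n" using abs[of i] abs[of n] i b(2) by (intro add_mono mult_left_mono) auto
      finally have "a * \<bar>x i\<bar> \<le> RK" using a(1) by (simp add: abs_mult RK_def algebra_simps)
      moreover have "1 * \<bar>x i\<bar> \<le> a * \<bar>x i\<bar>" using a(1) by (intro mult_right_mono) auto
      ultimately show ?thesis by linarith
    qed
    then show "x \<in> cube n RK" by (simp add: cube_def)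
  qed
qed

lemma K_compact: "compact K"
  using polar_closed[of n S] K_cube unfolding K_def by (intro closed_bounded_compact[of _ n RK]) (auto simp: polar_def)

lemma K_borel: "K \<in> sets borel" by (rule compact_vec_borel[OF K_compact])

lemma K_interior: "in_interior n K zvec"
proof -
  \<comment> \<open>a + b + 1 bounds the entries of every vertex, so a vector with entries at most
    \<delta> pairs with any vertex to at most 1.\<close>
  define \<delta> where "\<delta> = 1 / (real n * (a + b + 1))"
  have p: "real n * (a + b + 1) > 0" using n a b by simp
  have \<delta>: "\<delta> > 0" using p by (simp add: \<delta>_def)
  have "P * (1 / P) = 1" if "P > 0" for P :: real using that by simp
  from this[OF p] have nd: "real n * (\<delta> * (a + b + 1)) = 1" unfolding \<delta>_def by (simp only: mult_ac)
  show ?thesis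
  proof (rule in_interior_of_cube[OF _ \<delta>])
    show "zvec \<in> Rn n" by (simp add: zvec_def Rn_def)
    fix y assume y: "y \<in> Rn n" "\<And>i. i < n \<Longrightarrow> \<bar>y i - zvec i\<bar> \<le> \<delta>"
    have "ip n y (v k) \<le> 1" if "k \<le> n" for k
    proof -
      have "\<bar>v k i\<bar> \<le> a + b + 1" if "i < n" for i
        using that \<open>k \<le> n\<close> a b v_lt[of k i] v_n[of i] by (cases "k < n") (auto simp: unitv_def)
      then have "\<bar>ip n y (v k)\<bar> \<le> real n * (\<delta> * (a + b + 1))"
        using y(2) \<delta> a b by (intro ip_abs_bound) (auto simp: zvec_def)
      then show ?thesis unfolding nd by linarith
    qed
    then show "y \<in> K" using y(1) by (simp add: K_iff)
  qed
qed

lemma K_convex_body: "convex_body n K"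
  unfolding convex_body_def
  using K_compact K_interior is_convex_polar by (auto simp: K_def polar_def)

text \<open>The reflection exchanges v_j and v_k and fixes the other vertices, which are orthogonal
  to v_j - v_k by the Gram matrix.\<close>

lemma reflect_vertex:
  assumes "j \<le> n" "k \<le> n" "j \<noteq> k" "i \<le> n"
  shows "\<exists>i'\<le>n. reflect n (\<lambda>x. v j x - v k x) (v i) = v i'"
proof -
  have e: "ip n (\<lambda>x. v j x - v k x) (\<lambda>x. v j x - v k x) = 2 * (real n + 1)"
    unfolding ip_diff_left ip_diff_right using gram assms by simp
  have ie: "ip n (v i) (\<lambda>x. v j x - v k x) = (if i = j then real n + 1 else if i = k then - (real n + 1) else 0)"
    unfolding ip_diff_right using gram assms by simp
  have n1: "real n + 1 \<noteq> 0" by linarith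
  show ?thesis
  proof (cases "i = j \<or> i = k")
    case True
    then show ?thesis
    proof
      assume "i = j"
      then have c: "ip n (v i) (\<lambda>x. v j x - v k x) = real n + 1" using ie by simp
      have "2 * (real n + 1) / (2 * (real n + 1)) = 1" using n1 by simp
      then have "reflect n (\<lambda>x. v j x - v k x) (v i) = v k" unfolding reflect_def e c using \<open>i = j\<close> by (simp only:) auto
      then show ?thesis using assms by blast
    next
      assume "i = k"
      then have c: "ip n (v i) (\<lambda>x. v j x - v k x) = - (real n + 1)" using ie assms by simp
      have "2 * (- (real n + 1)) / (2 * (real n + 1)) = - 1" using n1 by (simp only: mult_minus_right minus_divide_left[symmetric]) simp
      then have "reflect n (\<lambda>x. v j x - v k x) (v i) = v j" unfolding reflect_def e c using \<open>i = k\<close> by (simp only:) auto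
      then show ?thesis using assms by blast
    qed
  next
    case False
    then have "reflect n (\<lambda>x. v j x - v k x) (v i) = v i" unfolding reflect_def e ie by auto
    then show ?thesis using assms by blast
  qed
qed

lemma diff_Rn: "(\<lambda>x. v j x - v k x) \<in> Rn n" using v_Rn by (simp add: Rn_def)

lemma K_reflect:
  assumes "j \<le> n" "k \<le> n" "j \<noteq> k" "x \<in> K"
  shows "reflect n (\<lambda>x. v j x - v k x) x \<in> K"
proof -
  have "ip n (reflect n (\<lambda>x. v j x - v k x) x) (v i) \<le> 1" if i: "i \<le> n" for i
  proof -
    obtain i' where "i' \<le> n" "reflect n (\<lambda>x. v j x - v k x) (v i) = v i'" using reflect_vertex[OF assms(1-3) i] by blast
    then show ?thesis using assms(4) unfolding ip_reflect_sym by (simp add: K_iff)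
  qed
  then show ?thesis using assms(4) reflect_Rn[OF _ diff_Rn] by (simp add: K_iff)
qed

lemma polar_K_reflect:
  assumes "j \<le> n" "k \<le> n" "j \<noteq> k" "y \<in> polar n K"
  shows "reflect n (\<lambda>x. v j x - v k x) y \<in> polar n K"
  using assms(4) K_reflect[OF assms(1-3)] reflect_Rn[OF _ diff_Rn] by (auto simp: polar_def ip_reflect_sym[symmetric])

lemma coord_integral_zero:
  assumes M: "M \<in> sets borel" "M \<subseteq> cube n R" "R \<ge> 0"
    and inv: "\<And>j k x. j \<le> n \<Longrightarrow> k \<le> n \<Longrightarrow> j \<noteq> k \<Longrightarrow> x \<in> M \<Longrightarrow> reflect n (\<lambda>i. v j i - v k i) x \<in> M"
    and i: "i < n"
  shows "(\<integral>x. indicator M x * x i \<partial>lebV n) = 0"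
proof -
  have z: "(\<integral>x. indicator M x * ip n x (v j) \<partial>lebV n) = 0" if "j \<le> n" for j
    by (rule simplex_barycentre_zero[where v=v and R=R]) (use v_Rn gram sum_v M inv that in auto)
  have ni: "nice n (indicator M)" by (rule nice_indicator[OF M])
  have int: "integrable (lebV n) (\<lambda>x. indicator M x * ip n x y)" for y
    by (rule nice_integrable[OF ni]) (auto intro: cube_ip_bound)
  have "(\<integral>x. indicator M x * x i \<partial>lebV n) = (\<integral>x. (indicator M x * ip n x (v i) - b * (indicator M x * ip n x (v n))) / a \<partial>lebV n)"
    by (rule Bochner_Integration.integral_cong[OF refl]) (subst coord_v[OF i], simp add: algebra_simps)
  also have "\<dots> = ((\<integral>x. indicator M x * ip n x (v i) \<partial>lebV n) - b * (\<integral>x. indicator M x * ip n x (v n) \<partial>lebV n)) / a"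
    using int by simp
  also have "\<dots> = 0" using z[of i] z[of n] i by simp
  finally show ?thesis .
qed

lemma K_lebn_pos: "lebn n K > 0"
proof -
  have "emeasure (lebV n) K < top" by (rule lebV_cube_finite[OF K_cube K_borel])
  then show ?thesis unfolding lebn_eq[OF K_borel] using interior_emeasure_pos[OF K_interior K_borel]
    by (simp add: measure_def enn2real_positive_iff zero_less_iff_neq_zero)
qed

lemma K_barycentre: "barycentre n K = zvec"
  using barycentre_zero_iff[OF K_borel] K_lebn_pos coord_integral_zero[OF K_borel K_cube K_reflect] by auto

lemma K_santalo: "santalo_point n K zvec"
proof (rule santalo_pointI[OF K_compact K_interior K_lebn_pos], intro allI impI)
  fix i assume i: "i < n"
  obtain R where R: "R > 0" "polar n K \<subseteq> cube n R" using polar_at_bounded[OF K_interior] unfolding polar_at_zvec by blast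
  show "(\<integral>y. indicator (polar n K) y * y i \<partial>lebV n) = 0"
    by (rule coord_integral_zero[OF polar_borel R(2) _ polar_K_reflect i]) (use R in auto)
qed

section \<open>The subspace spanned by l vertices, and the lower bound\<close>

context
  fixes l :: nat assumes l: "1 \<le> l" "l < n"
begin

text \<open>The Gram matrix of the l vertices is (n+1) I - J. Its eigenvalue on the all-ones vector
  is g^2 and on the complement a^2, so its positive square root is a I - \<beta> J.\<close>

definition "g = sqrt (real (n + 1 - l))"
definition "\<beta> = (a - g) / real l"
definition "\<tau> = \<beta> / g"
text \<open>Symmetric orthonormalisation: the inverse square root of the Gram matrix, which is (1/a)
  (I + \<tau> J), is applied to the vertices. Unlike Gram-Schmidt it treats them all alike and gives
  closed formulas.\<close>

definition "u k = (\<lambda>i. (1 / a) * (v k i + \<tau> * (\<Sum>j<l. v j i)))"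

lemma g: "g > 0" "g * g = real n + 1 - real l" "g \<le> a"
  using l by (auto simp: g_def a_def of_nat_diff)

lemma \<beta>: "real l * \<beta> = a - g" "\<beta> \<ge> 0" "\<tau> * g = \<beta>"
  using l g by (auto simp: \<beta>_def \<tau>_def)

lemma ip_v_sum: "k < l \<Longrightarrow> ip n (v k) (\<lambda>i. \<Sum>j<l. v j i) = g * g"
proof -
  assume k: "k < l"
  have "ip n (v k) (\<lambda>i. \<Sum>j<l. v j i) = (\<Sum>j<l. (if j = k then real n + 1 else 0) - 1)"
    unfolding ip_sum_right by (rule sum.cong) (use gram l k in auto)
  also have "\<dots> = real n + 1 - real l" using k by (simp add: sum_subtractf)
  finally show ?thesis using g(2) by simp
qed

lemma ip_sum_sum: "ip n (\<lambda>i. \<Sum>j<l. v j i) (\<lambda>i. \<Sum>j<l. v j i) = real l * (g * g)"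
  by (subst ip_sum_right) (simp add: ip_commute[of n "\<lambda>i. \<Sum>j<l. v j i"] ip_v_sum)

text \<open>The correction by \<tau> adds exactly 1 to every entry of the Gram matrix, which cancels
  the off-diagonal entries -1.\<close>

lemma \<tau>_identity: "2 * \<tau> * (g * g) + \<tau> * \<tau> * (real l * (g * g)) = 1"
proof -
  have "2 * \<tau> * (g * g) + \<tau> * \<tau> * (real l * (g * g)) = 2 * (\<tau> * g) * g + (real l * (\<tau> * g)) * (\<tau> * g)" by (simp add: algebra_simps)
  also have "\<dots> = 2 * \<beta> * g + (a - g) * \<beta>" unfolding \<beta> ..
  also have "\<dots> = \<beta> * (a + g)" by (simp add: algebra_simps)
  finally have "real l * (2 * \<tau> * (g * g) + \<tau> * \<tau> * (real l * (g * g))) = (real l * \<beta>) * (a + g)" by simp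
  also have "\<dots> = a * a - g * g" unfolding \<beta> by (simp add: algebra_simps)
  also have "\<dots> = real l * 1" unfolding a(2) g(2) by simp
  finally show ?thesis using l by (subst (asm) mult_left_cancel) auto
qed

lemma u_orthonormal: "orthonormal n l u"
  unfolding orthonormal_def
proof (intro conjI allI impI)
  fix j assume "j < l" then show "u j \<in> Rn n" using v_Rn by (simp add: u_def Rn_def)
next
  fix i j assume ij: "i < l" "j < l"
  let ?s = "\<lambda>i. \<Sum>j<l. v j i"
  have s: "ip n ?s (v j) = g * g" using ip_v_sum[OF ij(2)] by (simp add: ip_commute)
  have "ip n (u i) (u j) = (1/a) * ((1/a) * (ip n (v i) (v j) + \<tau> * ip n (v i) ?s + \<tau> * (ip n ?s (v j) + \<tau> * ip n ?s ?s)))"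
    unfolding u_def ip_scale_left ip_scale_right ip_add_left ip_add_right by (simp add: algebra_simps)
  also have "\<dots> = (1/a) * ((1/a) * (ip n (v i) (v j) + (2 * \<tau> * (g * g) + \<tau> * \<tau> * (real l * (g * g)))))"
    unfolding s ip_v_sum[OF ij(1)] ip_sum_sum by (simp add: algebra_simps)
  also have "\<dots> = (1/a) * ((1/a) * (ip n (v i) (v j) + 1))" unfolding \<tau>_identity ..
  also have "ip n (v i) (v j) + 1 = (if i = j then a * a else 0)" unfolding a(2) using gram[of i j] ij l by auto
  finally show "ip n (u i) (u j) = (if i = j then 1 else 0)" using a(1) by auto
qed

definition "F = {lincomb l u c | c. True}"

lemma u_onb: "onb n l u F"
  unfolding onb_orthonormal F_def using u_orthonormal by simp

lemma v_lincomb: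
  assumes k: "k < l"
  shows "v k i = a * u k i - \<beta> * (\<Sum>j<l. u j i)"
proof -
  let ?s = "\<Sum>j<l. v j i"
  have au: "a * u j i = v j i + \<tau> * ?s" for j using a(1) by (simp add: u_def)
  have "a * (\<Sum>j<l. u j i) = ?s + real l * (\<tau> * ?s)" by (simp add: sum_distrib_left au sum.distrib)
  then have "g * (a * (\<Sum>j<l. u j i)) = (g + real l * (\<tau> * g)) * ?s" by (simp add: algebra_simps)
  also have "g + real l * (\<tau> * g) = a" unfolding \<beta> by simp
  finally have "a * (g * (\<Sum>j<l. u j i)) = a * ?s" by (simp add: mult_ac)
  then have "g * (\<Sum>j<l. u j i) = ?s" using a(1) by simp
  then have "\<beta> * (\<Sum>j<l. u j i) = \<tau> * ?s" unfolding \<beta>(3)[symmetric] by simp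
  then show ?thesis using au[of k] by simp
qed

text \<open>The passage from weights t on the vertices to orthonormal coordinates c is
  multiplication by the square root a I - \<beta> J of the Gram matrix.\<close>

lemma lincomb_v:
  assumes c: "\<And>j. j < l \<Longrightarrow> c j = a * t j - \<beta> * (\<Sum>k<l. t k)"
  shows "lincomb l u c = (\<lambda>i. \<Sum>k<l. t k * v k i)"
proof
  fix i
  define T U where "T = (\<Sum>k<l. t k)" and "U = (\<Sum>j<l. u j i)"
  have "lincomb l u c i = (\<Sum>j<l. a * (t j * u j i) - (T * \<beta>) * u j i)"
    unfolding lincomb_def
  proof (rule sum.cong[OF refl])
    fix j assume "j \<in> {..<l}"
    then have "c j = a * t j - \<beta> * T" using c by (simp add: T_def)
    then show "c j * u j i = a * (t j * u j i) - (T * \<beta>) * u j i" by (simp only:) (simp add: algebra_simps)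
  qed
  also have "\<dots> = a * (\<Sum>j<l. t j * u j i) - (\<Sum>k<l. t k) * (\<beta> * U)"
    by (simp add: sum_subtractf sum_distrib_left[symmetric] U_def T_def)
  also have "\<dots> = (\<Sum>k<l. a * (t k * u k i) - t k * (\<beta> * U))"
    by (simp only: sum_subtractf sum_distrib_left sum_distrib_right)
  also have "\<dots> = (\<Sum>k<l. t k * (a * u k i - \<beta> * (\<Sum>j<l. u j i)))"
    unfolding U_def[symmetric] by (simp add: right_diff_distrib mult.left_commute)
  also have "\<dots> = (\<Sum>k<l. t k * v k i)" by (rule sum.cong) (use v_lincomb in auto)
  finally show "lincomb l u c i = (\<Sum>k<l. t k * v k i)" .
qed

text \<open>Coordinates of a slab of the convex hull of the origin and $v_0,\dots,v_{l-1}$, which lies in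
  $K^\circ\cap F$ and whose reflection lies in $K\cap F$.\<close>
definition D :: "vec set" where
  "D = {c. (\<forall>j<l. 0 \<le> c j + \<beta>/2) \<and> a/2 < (\<Sum>j<l. c j + \<beta>/2) \<and> (\<Sum>j<l. c j + \<beta>/2) \<le> (a + g)/2}"

text \<open>With total weight \<sigma>, nonnegativity of the weights reads c_j + \<beta> \<sigma>
  \<ge> 0. For \<sigma> \<ge> 1/2 it follows from c_j + \<beta>/2 \<ge> 0, a condition free of
  \<sigma>; this decoupling is why D keeps only the half with larger total weight.\<close>

lemma D_weights:
  assumes c: "c \<in> D"
  obtains t where "\<And>k. k < l \<Longrightarrow> 0 \<le> t k" "(\<Sum>k<l. t k) \<le> 1" "lincomb l u c = (\<lambda>i. \<Sum>k<l. t k * v k i)"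
proof -
  \<comment> \<open>The coordinates of a combination of the vertices add up to g times its total
    weight. Total weights 1/2 and 1 correspond to the bounds a/2 and (a+g)/2 in D.\<close>
  define \<sigma> where "\<sigma> = (\<Sum>j<l. c j) / g"
  have "(\<Sum>j<l. c j + \<beta>/2) = (\<Sum>j<l. c j) + (real l * \<beta>)/2" by (simp add: sum.distrib)
  also have "\<dots> = \<sigma> * g + (a - g)/2" unfolding \<beta> using g(1) by (simp add: \<sigma>_def)
  finally have s: "(\<Sum>j<l. c j + \<beta>/2) = \<sigma> * g + (a - g)/2" .
  have \<sigma>: "\<sigma> \<ge> 1/2" "\<sigma> \<le> 1"
  proof -
    have "a/2 < \<sigma> * g + (a - g)/2" "\<sigma> * g + (a - g)/2 \<le> (a + g)/2" using c unfolding D_def mem_Collect_eq s by blast+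
    then have "g < \<sigma> * g * 2" "\<sigma> * g \<le> g" by (simp_all add: diff_divide_distrib add_divide_distrib)
    then have "0 < (\<sigma> * 2 - 1) * g" "0 \<le> (1 - \<sigma>) * g" by (simp_all add: algebra_simps)
    then show "\<sigma> \<ge> 1/2" "\<sigma> \<le> 1" using g(1) by (auto simp: zero_less_mult_iff zero_le_mult_iff)
  qed
  define t where "t k = (c k + \<beta> * \<sigma>) / a" for k
  have sum_t: "(\<Sum>k<l. t k) = \<sigma>"
  proof -
    have "(\<Sum>k<l. t k) = ((\<Sum>k<l. c k) + real l * (\<beta> * \<sigma>)) / a"
      unfolding t_def sum_divide_distrib[symmetric] by (simp add: sum.distrib)
    also have "(\<Sum>k<l. c k) = g * \<sigma>" using g(1) by (simp add: \<sigma>_def)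
    also have "real l * (\<beta> * \<sigma>) = (a - g) * \<sigma>" unfolding mult.assoc[symmetric] \<beta> ..
    also have "(g * \<sigma> + (a - g) * \<sigma>) / a = \<sigma>" using a(1) by (simp add: field_simps)
    finally show ?thesis .
  qed
  show ?thesis
  proof (rule that[of t])
    fix k assume k: "k < l"
    have "\<beta> * (1/2) \<le> \<beta> * \<sigma>" using \<sigma> \<beta>(2) by (intro mult_left_mono) auto
    moreover have "0 \<le> c k + \<beta>/2" using c k by (simp add: D_def)
    ultimately have "0 \<le> c k + \<beta> * \<sigma>" by simp
    then show "0 \<le> t k" using a(1) by (simp add: t_def)
  next
    show "(\<Sum>k<l. t k) \<le> 1" using sum_t \<sigma> by simp
    show "lincomb l u c = (\<lambda>i. \<Sum>k<l. t k * v k i)"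
    proof (rule lincomb_v)
      show "c j = a * t j - \<beta> * (\<Sum>k<l. t k)" for j unfolding sum_t using a(1) by (simp add: t_def)
    qed
  qed
qed

text \<open>The simplex contains its vertices and, as their mean, the origin; hence it contains
  every combination of the l vertices with nonnegative weights of sum at most 1.\<close>

lemma D_in_polar:
  assumes "c \<in> D" shows "lincomb l u c \<in> polar n K"
proof -
  obtain t where t: "\<And>k. k < l \<Longrightarrow> 0 \<le> t k" "(\<Sum>k<l. t k) \<le> 1" "lincomb l u c = (\<lambda>i. \<Sum>k<l. t k * v k i)"
    using D_weights[OF assms] by blast
  \<comment> \<open>The missing weight is spread evenly over all n + 1 vertices, which leaves the
    point unchanged because the vertices add up to 0.\<close>
  define r where "r = (1 - (\<Sum>k<l. t k)) / (real n + 1)"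
  have r: "r \<ge> 0" using t(2) by (simp add: r_def)
  define t' where "t' k = (if k < l then t k else 0) + r" for k
  have split: "(\<Sum>k\<le>n. if k < l then f k else 0) = (\<Sum>k<l. f k)" for f :: "nat \<Rightarrow> real"
  proof -
    have "{..n} \<inter> {k. k < l} = {..<l}" using l by auto
    then show ?thesis by (simp add: sum.If_cases)
  qed
  have "(\<Sum>k\<le>n. t' k) = 1"
    unfolding t'_def sum.distrib split by (simp add: r_def add.commute)
  moreover have "(\<Sum>k\<le>n. t' k * v k i) = (\<Sum>k<l. t k * v k i)" for i
  proof -
    have "(\<Sum>k\<le>n. t' k * v k i) = (\<Sum>k\<le>n. (if k < l then t k * v k i else 0) + r * v k i)"
    proof (rule sum.cong[OF refl])
      fix k show "t' k * v k i = (if k < l then t k * v k i else 0) + r * v k i"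
        by (cases "k < l") (simp_all add: t'_def distrib_right)
    qed
    also have "\<dots> = (\<Sum>k<l. t k * v k i) + r * (\<Sum>k\<le>n. v k i)"
      unfolding sum.distrib split sum_distrib_left ..
    finally show ?thesis by (simp add: sum_v)
  qed
  moreover have "\<forall>k\<le>n. 0 \<le> t' k" using t(1) r by (simp add: t'_def)
  ultimately have "lincomb l u c \<in> S" unfolding S_def t(3) by (intro CollectI exI[of _ t']) auto
  then show ?thesis using S_subset_polar by blast
qed

text \<open>The Gram matrix has no entry below -1, so minus a vertex pairs with each vertex to at
  most 1 and lies in K. The reflected combinations thus lie in K and in F, where the projection is
  the identity.\<close>

lemma D_in_Proj:
  assumes "c \<in> D" shows "lincomb l u (\<lambda>i. - c i) \<in> Proj n F ` K"
proof -
  obtain t where t: "\<And>k. k < l \<Longrightarrow> 0 \<le> t k" "(\<Sum>k<l. t k) \<le> 1" "lincomb l u c = (\<lambda>i. \<Sum>k<l. t k * v k i)"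
    using D_weights[OF assms] by blast
  define x where "x = lincomb l u (\<lambda>i. - c i)"
  have x: "x = (\<lambda>i. - (\<Sum>k<l. t k * v k i))" unfolding x_def lincomb_minus t(3) ..
  have "ip n x (v j) \<le> 1" if j: "j \<le> n" for j
  proof -
    have "ip n x (v j) = ip n (v j) (\<lambda>i. (-1) * (\<Sum>k<l. t k * v k i))" unfolding x by (simp add: ip_commute)
    also have "\<dots> = - (\<Sum>k<l. t k * ip n (v j) (v k))" unfolding ip_scale_right ip_sum_right by simp
    also have "\<dots> = (\<Sum>k<l. t k * (- ip n (v j) (v k)))" by (simp add: sum_negf)
    also have "\<dots> \<le> (\<Sum>k<l. t k * 1)"
      by (rule sum_mono, rule mult_left_mono) (use gram j l t(1) in auto)
    finally show ?thesis using t(2) by simp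
  qed
  moreover have "x \<in> Rn n" unfolding x_def by (rule lincomb_Rn) (rule orthonormalD(1)[OF u_orthonormal])
  ultimately have "x \<in> K" by (simp add: K_iff)
  moreover have "Proj n F x = x" unfolding x_def by (rule Proj_fixed[OF u_onb onb_lincomb_mem[OF u_onb]])
  ultimately show ?thesis unfolding x_def by (metis imageI)
qed

lemma D_borel[measurable]: "D \<in> sets borel"
  unfolding D_def by measurable

text \<open>Up to the translation by \<beta>/2 in each coordinate, D is the standard simplex of size
  (a+g)/2 without the one of size a/2. By Bernoulli the larger power exceeds the smaller by half of
  it as soon as l g \<ge> a/2.\<close>

lemma D_volume: "ennreal ((a/2)^l / (2 * fact l)) \<le> emeasure (lebV l) D"
proof -
  define s where "s r = {x :: vec. (\<forall>i<l. 0 \<le> x i) \<and> (\<Sum>i<l. x i) \<le> r}" for r :: real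
  have [measurable]: "s r \<in> sets borel" for r unfolding s_def by measurable
  define h where "h = (\<lambda>j. if j < l then \<beta>/2 else 0)"
  have "h \<in> Rn l" by (simp add: h_def Rn_def)
  have bern: "(a/2)^l / 2 \<le> ((a + g)/2)^l - (a/2)^l"
  proof -
    have "(real l * (g / a))^2 \<ge> (1/2)^2"
    proof -
      \<comment> \<open>Expanding this product gives n \<le> l (n + 1 - l) = l g^2, from which l^2
        g^2 \<ge> a^2 / 4 follows.\<close>
      have "(real l - 1) * (real n - real l) \<ge> 0" using l by (intro mult_nonneg_nonneg) auto
      then have "real n \<le> real l * (real n + 1 - real l)" by (simp add: algebra_simps)
      also have "\<dots> \<le> (real l * real l) * (real n + 1 - real l)"
      proof (rule mult_right_mono)
        have "real l * 1 \<le> real l * real l" using l by (intro mult_left_mono) auto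
        then show "real l \<le> real l * real l" by simp
      qed (use l in auto)
      finally have "real n \<le> (real l * real l) * (real n + 1 - real l)" .
      moreover have "(real n + 1) * (1/4) \<le> real n" using l by simp
      ultimately have "(real n + 1) * (1/4) \<le> (real l * real l) * (real n + 1 - real l)" by (rule order_trans[rotated])
      then have "(a * a) * (1/4) \<le> (real l * real l) * (g * g)" unfolding a(2) g(2) .
      then show ?thesis using a(1) by (simp add: power2_eq_square field_simps)
    qed
    moreover have "0 \<le> real l * (g / a)" using g(1) a(1) by simp
    ultimately have lg: "real l * (g / a) \<ge> 1/2" by (rule power2_le_imp_le)
    have "(1 + g / a)^l \<ge> 1 + real l * (g / a)"
    proof (rule Bernoulli_inequality)
      have "0 \<le> g / a" using g(1) a(1) by simp
      then show "-1 \<le> g / a" by linarith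
    qed
    then have "1/2 \<le> (1 + g/a)^l - 1" using lg by linarith
    then have "(a/2)^l * (1/2) \<le> (a/2)^l * ((1 + g/a)^l - 1)" using a(1) by (intro mult_left_mono) auto
    also have "\<dots> = ((a/2) * (1 + g/a))^l - (a/2)^l" by (simp add: right_diff_distrib power_mult_distrib[symmetric])
    also have "(a/2) * (1 + g/a) = (a + g)/2" using a(1) by (simp add: field_simps)
    finally show ?thesis by simp
  qed
  have "ennreal ((a/2)^l / (2 * fact l)) \<le> ennreal (((a + g)/2)^l / fact l - (a/2)^l / fact l)"
    using bern by (intro ennreal_leI) (simp add: field_simps)
  also have "\<dots> = ennreal (((a + g)/2)^l / fact l) - ennreal ((a/2)^l / fact l)"
    using a(1) by (intro ennreal_minus[symmetric]) simp
  also have "\<dots> = emeasure (lebV l) (s ((a + g)/2)) - emeasure (lebV l) (s (a/2))"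
    unfolding s_def using a(1) g(1) by (subst (1 2) emeasure_simplex) auto
  also have "\<dots> = emeasure (lebV l) (s ((a + g)/2) - s (a/2))"
  proof (rule emeasure_Diff[symmetric])
    show "emeasure (lebV l) (s (a/2)) \<noteq> \<infinity>" unfolding s_def using a(1) by (subst emeasure_simplex) auto
    show "s (a/2) \<subseteq> s ((a + g)/2)" using g(1) by (auto simp: s_def)
  qed simp_all
  also have "\<dots> = (\<integral>\<^sup>+x. indicator (s ((a + g)/2) - s (a/2)) x \<partial>lebV l)" by simp
  also have "\<dots> = (\<integral>\<^sup>+x. indicator (s ((a + g)/2) - s (a/2)) (\<lambda>i. h i + x i) \<partial>lebV l)"
    by (rule lebV_translate[OF _ \<open>h \<in> Rn l\<close>, symmetric]) simp
  also have "\<dots> = (\<integral>\<^sup>+x. indicator D x \<partial>lebV l)"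
  proof (rule nn_integral_cong)
    fix x
    have "(\<Sum>i<l. h i + x i) = (\<Sum>i<l. x i + \<beta>/2)" by (rule sum.cong) (auto simp: h_def)
    then have "(\<lambda>i. h i + x i) \<in> s ((a + g)/2) - s (a/2) \<longleftrightarrow> x \<in> D"
      unfolding s_def D_def by (auto simp: h_def add.commute)
    then show "(indicator (s ((a + g)/2) - s (a/2)) (\<lambda>i. h i + x i) :: ennreal) = indicator D x"
      by (simp add: indicator_def)
  qed
  finally show ?thesis by simp
qed

lemma simplex_volume_product:
  "real n ^ l / (16^l * (fact l)^2) \<le> measF n l F (Proj n F ` K) * measF n l F (polar n K \<inter> F)"
proof -
  define V where "V = (a/2)^l / (2 * fact l)"
  have V0: "V \<ge> 0" using a(1) by (simp add: V_def)
  define A where "A = {c. lincomb l u c \<in> Proj n F ` K}"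
  define B where "B = {c. lincomb l u c \<in> polar n K}"
  have PK: "Proj n F ` K \<in> sets borel" by (rule compact_vec_borel[OF Proj_image_compact[OF u_onb K_compact]])
  have [measurable]: "A \<in> sets borel" unfolding A_def using PK by measurable
  have [measurable]: "B \<in> sets borel" unfolding B_def using polar_borel[of n K] by measurable
  obtain R where R: "R > 0" "polar n K \<subseteq> cube n R" using polar_at_bounded[OF K_interior] unfolding polar_at_zvec by blast
  have bnd: "\<bar>ip n x (u j)\<bar> \<le> real n * (R' * 1)" if "x \<in> cube n R'" "j < l" "R' \<ge> 0" for x j R'
    using that orthonormal_coord_bound[OF u_orthonormal] by (intro ip_abs_bound) (auto simp: cube_def)
  have Bc: "B \<subseteq> cube l (real n * (R * 1))"
  proof
    fix c assume "c \<in> B"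
    then have "lincomb l u c \<in> cube n R" using R by (auto simp: B_def)
    then have "\<bar>c j\<bar> \<le> real n * (R * 1)" if "j < l" for j
      using bnd[of "lincomb l u c" R j] that R ip_lincomb_coord[OF u_orthonormal that, of c] by simp
    then show "c \<in> cube l (real n * (R * 1))" unfolding cube_def by blast
  qed
  have Ac: "A \<subseteq> cube l (real n * (RK * 1))"
  proof
    fix c assume "c \<in> A"
    then have "lincomb l u c \<in> Proj n F ` K" by (simp add: A_def)
    then obtain x where x: "x \<in> K" "lincomb l u c = lincomb l u (\<lambda>j. ip n x (u j))" unfolding Proj_eq[OF u_onb] by blast
    have "\<bar>c j\<bar> \<le> real n * (RK * 1)" if "j < l" for j
    proof -
      have "c j = ip n x (u j)"
        using ip_lincomb_coord[OF u_orthonormal that, of c] ip_lincomb_coord[OF u_orthonormal that, of "\<lambda>j. ip n x (u j)"] x(2) by simp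
      then show ?thesis using bnd[of x RK j] x(1) K_cube that by auto
    qed
    then show "c \<in> cube l (real n * (RK * 1))" unfolding cube_def by blast
  qed
  \<comment> \<open>\<open>measure\<close> would return 0 on sets of infinite volume, so lower
    bounds on \<open>emeasure\<close> transfer only after finiteness is known.\<close>
  have fin: "emeasure (lebV l) A < top" "emeasure (lebV l) B < top"
    using lebV_cube_finite[OF Ac] lebV_cube_finite[OF Bc] K_cube(2) R by auto
  have "ennreal V \<le> emeasure (lebV l) D" unfolding V_def by (rule D_volume)
  also have "\<dots> \<le> emeasure (lebV l) B"
  proof (rule emeasure_mono)
    show "D \<subseteq> B" using D_in_polar unfolding B_def by blast
  qed simp
  finally have VB: "V \<le> measure (lebV l) B" using fin(2) V0 by (simp add: emeasure_eq_ennreal_measure ennreal_le_iff)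
  have "ennreal V \<le> (\<integral>\<^sup>+c. indicator D c \<partial>lebV l)" using D_volume by (simp add: V_def)
  also have "\<dots> = ennreal (\<bar>-1\<bar>^l) * (\<integral>\<^sup>+c. indicator D (\<lambda>i. (\<lambda>_. 0) i + (-1) * c i) \<partial>lebV l)"
    by (rule lebV_affine) (auto simp: Rn_def)
  also have "\<dots> = (\<integral>\<^sup>+c. indicator D (\<lambda>i. - c i) \<partial>lebV l)" by simp
  also have "\<dots> \<le> (\<integral>\<^sup>+c. indicator A c \<partial>lebV l)"
  proof (rule nn_integral_mono)
    fix c
    have "c \<in> A" if "(\<lambda>i. - c i) \<in> D" using D_in_Proj[OF that] by (simp add: A_def)
    then show "(indicator D (\<lambda>i. - c i) :: ennreal) \<le> indicator A c" by (auto split: split_indicator)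
  qed
  also have "\<dots> = emeasure (lebV l) A" by simp
  finally have VA: "V \<le> measure (lebV l) A" using fin(1) V0 by (simp add: emeasure_eq_ennreal_measure ennreal_le_iff)
  have "real n ^ l / (16^l * (fact l)^2) \<le> V * V"
  proof -
    have "V * V = ((a * a) / 4)^l / (4 * (fact l)^2)"
      by (simp add: V_def power_divide power_mult_distrib power2_eq_square) (simp add: power_mult_distrib[symmetric])
    also have "\<dots> = (real n + 1)^l / (4^l * 4 * (fact l)^2)" unfolding a(2) by (simp add: power_divide)
    finally have VV: "V * V = (real n + 1)^l / (4^l * 4 * (fact l)^2)" .
    \<comment> \<open>V * V has the denominator 4^l * 4 * (l!)^2; the loss of 1/2 in each volume is
      absorbed into 16^l by 4 \<le> 4^l.\<close>
    have "(4::real)^l * 4 \<le> 4^l * 4^l" using l by (intro mult_left_mono) (auto simp: self_le_power)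
    also have "\<dots> = 16^l" by (simp add: power_mult_distrib[symmetric])
    finally have "(4::real)^l * 4 * (fact l)^2 \<le> 16^l * (fact l)^2" by (intro mult_right_mono) auto
    then show ?thesis unfolding VV by (intro frac_le power_mono) auto
  qed
  also have "\<dots> \<le> measure (lebV l) A * measure (lebV l) B" using VA VB V0 by (intro mult_mono) auto
  finally show ?thesis unfolding measF_Proj[OF u_onb K_compact] measF_polar[OF u_onb] A_def B_def .
qed

end

end

theorem theorem1p4:
  shows "(\<exists>C0::real. \<forall>n l K F.
            1 \<le> l \<and> l < n \<and> convex_body n K \<and>
            (barycentre n K = zvec \<or> santalo_point n K zvec) \<and> F \<in> Grass n l \<longrightarrow>
            (measF n l F (Proj n F ` K) * measF n l F (polar n K \<inter> F)) powr (1 / real l)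
              \<le> C0 * (real n / real l) * unit_ball_vol (real l) powr (2 / real l))
       \<and> (\<exists>c::real>0. \<forall>n l. 1 \<le> l \<and> l < n \<longrightarrow>
            (\<exists>K F. convex_body n K \<and> barycentre n K = zvec \<and> santalo_point n K zvec \<and>
               (\<exists>S. regular_simplex_centred n S \<and> K = polar n S) \<and> F \<in> Grass n l \<and>
               (measF n l F (Proj n F ` K) * measF n l F (polar n K \<inter> F)) powr (1 / real l)
                 \<ge> c * (real n / real l) * unit_ball_vol (real l) powr (2 / real l)))"
proof (rule conjI[OF exI[of _ 48] exI[of _ "1/256"]], intro allI impI, goal_cases upper lower)
  case (upper n l K F)
  then show ?case by (intro volume_product_upper) auto
next
  case lower
  have "\<exists>K F. convex_body n K \<and> barycentre n K = zvec \<and> santalo_point n K zvec \<and>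
               (\<exists>S. regular_simplex_centred n S \<and> K = polar n S) \<and> F \<in> Grass n l \<and>
               (measF n l F (Proj n F ` K) * measF n l F (polar n K \<inter> F)) powr (1 / real l)
                 \<ge> 1/256 * (real n / real l) * unit_ball_vol (real l) powr (2 / real l)"
    if l1: "1 \<le> l" and l2: "l < n" for n l
  proof -
    interpret standard_simplex n by standard (use l1 l2 in auto)
    show ?thesis
    proof (rule exI[of _ K], rule exI[of _ "F l"], intro conjI)
      show "\<exists>S. regular_simplex_centred n S \<and> K = polar n S" using S_regular K_def by blast
      show "F l \<in> Grass n l" using u_onb[OF l1 l2] by (auto simp: Grass_def)
      show "(measF n l (F l) (Proj n (F l) ` K) * measF n l (F l) (polar n K \<inter> F l)) powr (1 / real l)
                   \<ge> 1/256 * (real n / real l) * unit_ball_vol (real l) powr (2 / real l)"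
        by (rule volume_product_root_ge[OF l1 l2 simplex_volume_product[OF l1 l2]])
    qed (rule K_convex_body K_barycentre K_santalo)+
  qed
  then show ?case by simp
qed

end
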